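(* Let $L$ be the length of the longest run of consecutive equal parts in a uniformly random integer composition of size $n$. Then, as $n\to\infty$, the variance of $L$ satisfies $$\mathbb{V}_n(L)=\frac1{12}+\frac{\pi^2}{6\log^2 2}+\epsilon+O\left(\frac{\log^4 n}{\sqrt n}\right),$$ where $\epsilon=\epsilon(n)$ is a quantity (depending on $n$) with $|\epsilon|<10^{-4}$ for all $n$.
   Context: A composition of size $n$ is a finite sequence $(x_1,\dots,x_m)$ of positive integers (the parts) with $x_1+\cdots+x_m=n$. $\mathbb{V}_n$ denotes variance under the model in which all compositions of size $n$ are equally likely. $L$ is the random variable giving the maximal length of a block of consecutive equal parts. $\log$ is the natural logarithm, and $\log^2 2=(\log 2)^2$, $\log^4 n=(\log n)^4$. *)

theory Defs
  imports "HOL-Probability.Probability" "HOL-Library.Sublist" "HOL-Library.Landau_Symbols"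
begin

definition compositions :: "nat \<Rightarrow> nat list set" where
  "compositions n = {xs. (\<forall>x\<in>set xs. 0 < x) \<and> sum_list xs = n}"

text \<open>
  The blocks of consecutive equal parts of a composition are its contiguous sublists of the
  form \<^term>\<open>replicate k a\<close>; for the empty composition (of size 0) the value is 0.
\<close>

definition longest_run :: "'a list \<Rightarrow> nat" where
  "longest_run xs = Max {k. \<exists>a. sublist (replicate k a) xs}"

lemma finite_run_lengths: "finite {k. \<exists>a. sublist (replicate k a) xs}"
proof (rule finite_subset)
  show "{k. \<exists>a. sublist (replicate k a) xs} \<subseteq> {..length xs}"
    using sublist_length_le by fastforce
qed simp

lemma run_lengths_nonempty: "{k. \<exists>a. sublist (replicate k a) xs} \<noteq> {}"
proof -
  have "0 \<in> {k. \<exists>a. sublist (replicate k a) xs}" by simp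
  then show ?thesis by blast
qed

lemma length_le_sum_list_pos:
  fixes xs :: "nat list"
  assumes "\<forall>x\<in>set xs. 0 < x"
  shows "length xs \<le> sum_list xs"
  using assms by (induction xs) auto

lemma finite_compositions: "finite (compositions n)"
proof (rule finite_subset)
  show "compositions n \<subseteq> {xs. set xs \<subseteq> {..n} \<and> length xs \<le> n}"
    using length_le_sum_list_pos member_le_sum_list by (fastforce simp: compositions_def)
  show "finite {xs. set xs \<subseteq> {..n} \<and> length xs \<le> n}"
    by (rule finite_lists_length_le) simp
qed

lemma compositions_nonempty: "compositions n \<noteq> {}"
proof -
  have "(if n = 0 then [] else [n]) \<in> compositions n" by (simp add: compositions_def)
  then show ?thesis by blast
qed

text \<open>
  By \<open>finite_compositions\<close> and \<open>compositions_nonempty\<close>, \<^const>\<open>pmf_of_set\<close> below is the uniform distribution.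
\<close>

definition random_composition :: "nat \<Rightarrow> nat list pmf" where
  "random_composition n = pmf_of_set (compositions n)"

end

theory Submission
  imports Defs "HOL-Real_Asymp.Real_Asymp"
begin

text \<open>
  Near \<open>k = log 2 n\<close> the longest run is a run of ones: the expected number of blocks of \<open>k\<close> parts
  equal to \<open>a\<close> is of order \<open>n / 2 ^ (a * k)\<close>, so all \<open>a \<ge> 2\<close> together change the
  probability of the event \<open>longest_run xs < k\<close> by at most \<open>4 * (n + 1) / 4 ^ k\<close>
  (\<open>ones_free_prob_le_prob_longest_run_less\<close>). The probability \<open>p n\<close> that a composition of \<open>n\<close>
  has no \<open>k\<close> consecutive ones satisfies \<open>p (n + 1) = p n - q * p (n - k - 1)\<close> with
  \<open>q = 1 / 2 ^ (k + 2)\<close>. Since \<open>p\<close> varies slowly, its successive ratios are \<open>1 - q\<close> up to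
  \<open>O(k * q\<^sup>2)\<close>, and hence \<open>p n = exp (- n / 2 ^ (k + 2)) + O(k / 2 ^ k)\<close>
  (\<open>ones_free_prob_approx\<close>).

  The exponential is itself a distribution function: if \<open>v\<close> is a standard exponential variable,
  \<open>T = - log 2 v\<close> and \<open>x = log 2 n - 2\<close>, then the integer \<open>\<lfloor>T + x\<rfloor>\<close> is less than \<open>k\<close>
  with exactly this probability. The first two moments are weighted sums of tail probabilities, so the
  variance of the longest run is that of \<open>\<lfloor>T + x\<rfloor>\<close> up to an error that is estimated by cutting
  the sums at \<open>K\<close> near \<open>3 / 4 * log 2 n\<close>: below \<open>K\<close> both distribution functions are tiny, above
  it the errors decay geometrically, and the dominant term \<open>n / 4 ^ K\<close> is of order
  \<open>1 / sqrt n\<close> (\<open>variance_longest_run_approx\<close>, \<open>run_error_bigo\<close>).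

  The variance of \<open>\<lfloor>T + x\<rfloor>\<close> is \<open>\<phi>\<^sub>2 x - (\<phi>\<^sub>1 x)\<^sup>2\<close>, where \<open>\<phi>\<^sub>j x\<close> is the
  expectation of \<open>(\<lfloor>T + x\<rfloor> - x) ^ j\<close>, a continuous function of period 1. Its Fourier
  coefficients come from integrating over \<open>x\<close> first: what remains is the characteristic function of
  \<open>T\<close> and its derivative, that is, \<open>Gamma\<close> and \<open>Gamma * Digamma\<close> at
  \<open>1 - \<i> * 2 * pi * m / ln 2\<close>. The coefficients with \<open>m = 0\<close> give the constant
  \<open>1 / 12 + pi\<^sup>2 / (6 * (ln 2)\<^sup>2)\<close>. The others are minute because
  \<open>\<bar>Gamma (1 - \<i> * y)\<bar>\<^sup>2 = pi * y / sinh (pi * y)\<close>, and by positivity of the Fejer kernel their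
  absolute sum bounds the oscillation (\<open>saw_variance_fluctuation\<close>).
\<close>

section \<open>Counting compositions\<close>

lemma compositions_0 [simp]: "compositions 0 = {[]}"
proof -
  have "xs = []" if "\<forall>x\<in>set xs. 0 < x" "\<forall>x\<in>set xs. x = 0" for xs :: "nat list"
    using that by (cases xs) auto
  then show ?thesis by (auto simp: compositions_def)
qed

lemma compositions_Suc:
  "compositions (Suc m) = (\<Union>i\<le>m. (#) (Suc m - i) ` compositions i)"
proof (intro equalityI subsetI)
  fix xs assume xs: "xs \<in> compositions (Suc m)"
  then obtain b ys where [simp]: "xs = b # ys" by (cases xs) (auto simp: compositions_def)
  from xs have "0 < b" "b + sum_list ys = Suc m" "ys \<in> compositions (sum_list ys)"
    by (auto simp: compositions_def)
  moreover from this have "b = Suc m - sum_list ys" "sum_list ys \<in> {..m}" by auto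
  ultimately show "xs \<in> (\<Union>i\<le>m. (#) (Suc m - i) ` compositions i)"
    unfolding \<open>xs = b # ys\<close> by blast
qed (auto simp: compositions_def)

lemma card_filtered_compositions_Suc:
  "card {xs \<in> compositions (Suc m). P xs} =
     (\<Sum>i\<le>m. card {ys \<in> compositions i. P ((Suc m - i) # ys)})"
proof -
  have "{xs \<in> compositions (Suc m). P xs} =
      (\<Union>i\<le>m. (#) (Suc m - i) ` {ys \<in> compositions i. P ((Suc m - i) # ys)})"
    by (auto simp: compositions_Suc)
  also have "card \<dots> = (\<Sum>i\<le>m. card ((#) (Suc m - i) ` {ys \<in> compositions i. P ((Suc m - i) # ys)}))"
    by (rule card_UN_disjoint) (auto simp: finite_compositions)
  also have "\<dots> = (\<Sum>i\<le>m. card {ys \<in> compositions i. P ((Suc m - i) # ys)})"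
    by (intro sum.cong refl card_image) auto
  finally show ?thesis .
qed

lemma sum_card_compositions: "(\<Sum>i\<le>m. card (compositions i)) = 2 ^ m"
  and card_compositions_Suc: "card (compositions (Suc m)) = 2 ^ m"
proof -
  have rec: "card (compositions (Suc m)) = (\<Sum>i\<le>m. card (compositions i))" for m
    using card_filtered_compositions_Suc[of m "\<lambda>_. True"] by simp
  show *: "(\<Sum>i\<le>m. card (compositions i)) = 2 ^ m"
    by (induction m) (simp_all add: rec)
  show "card (compositions (Suc m)) = 2 ^ m"
    by (simp add: rec *)
qed

lemma card_compositions_le: "card (compositions n) \<le> 2 ^ n"
  by (cases n) (simp_all add: card_compositions_Suc)

text \<open>
  A union bound over the position of the block: the parts before it form a composition of some
  \<open>i \<le> n - k * a\<close>, those after it one of \<open>n - k * a - i\<close>, and for each \<open>i\<close> there are at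
  most \<open>2 ^ i * 2 ^ (n - k * a - i)\<close> such pairs.
\<close>

lemma card_compositions_containing_block_le:
  "card {xs \<in> compositions n. sublist (replicate k a) xs}
     \<le> (if k * a \<le> n then (n + 1 - k * a) * 2 ^ (n - k * a) else 0)"
proof (cases "k * a \<le> n")
  case False
  have "{xs \<in> compositions n. sublist (replicate k a) xs} = {}"
    using False by (auto simp: compositions_def sublist_def sum_list_replicate)
  then have "card {xs \<in> compositions n. sublist (replicate k a) xs} = 0" by (simp only: card.empty)
  then show ?thesis by linarith
next
  case True
  let ?r = "n - k * a"
  let ?f = "\<lambda>(us, vs). us @ replicate k a @ vs"
  have sub: "{xs \<in> compositions n. sublist (replicate k a) xs} \<subseteq>
      (\<Union>i\<le>?r. ?f ` (compositions i \<times> compositions (?r - i)))"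
  proof (intro subsetI)
    fix xs assume "xs \<in> {xs \<in> compositions n. sublist (replicate k a) xs}"
    then have "sublist (replicate k a) xs" and c: "xs \<in> compositions n" by simp_all
    then obtain us vs where xs: "xs = us @ replicate k a @ vs"
      unfolding sublist_def by (elim exE)
    have sum: "sum_list us + (k * a + sum_list vs) = n"
      using c by (simp add: xs compositions_def sum_list_replicate)
    then have "?r - sum_list us = sum_list vs" "sum_list us \<le> ?r" by linarith+
    moreover have "us \<in> compositions (sum_list us)" "vs \<in> compositions (sum_list vs)"
    proof -
      have "\<forall>x\<in>set xs. 0 < x" using c unfolding compositions_def by blast
      then have "\<forall>x\<in>set us. 0 < x" "\<forall>x\<in>set vs. 0 < x"
        unfolding xs set_append ball_Un by blast+
      then show "us \<in> compositions (sum_list us)" "vs \<in> compositions (sum_list vs)"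
        unfolding compositions_def mem_Collect_eq by blast+
    qed
    ultimately have "(us, vs) \<in> compositions (sum_list us) \<times> compositions (?r - sum_list us)"
      and le: "sum_list us \<in> {..?r}" by auto
    from imageI[OF this(1), of ?f]
    have "xs \<in> ?f ` (compositions (sum_list us) \<times> compositions (?r - sum_list us))"
      by (simp only: split xs)
    with le show "xs \<in> (\<Union>i\<le>?r. ?f ` (compositions i \<times> compositions (?r - i)))"
      by (rule UN_I)
  qed
  have "card {xs \<in> compositions n. sublist (replicate k a) xs}
      \<le> card (\<Union>i\<le>?r. ?f ` (compositions i \<times> compositions (?r - i)))"
    by (rule card_mono[OF _ sub]) (auto simp: finite_compositions)
  also have "\<dots> \<le> (\<Sum>i\<le>?r. card (?f ` (compositions i \<times> compositions (?r - i))))"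
    by (rule card_UN_le) simp
  also have "\<dots> \<le> (\<Sum>i\<le>?r. 2 ^ ?r)"
  proof (rule sum_mono)
    fix i assume i: "i \<in> {..?r}"
    have "card (?f ` (compositions i \<times> compositions (?r - i)))
        \<le> card (compositions i \<times> compositions (?r - i))"
      by (rule card_image_le) (auto simp: finite_compositions)
    also have "\<dots> \<le> 2 ^ i * 2 ^ (?r - i)"
      unfolding card_cartesian_product by (rule mult_mono[OF card_compositions_le card_compositions_le]) auto
    also have "\<dots> = 2 ^ ?r" using i by (simp flip: power_add)
    finally show "card (?f ` (compositions i \<times> compositions (?r - i))) \<le> 2 ^ ?r" .
  qed
  finally show ?thesis using True by (simp add: Suc_diff_le)
qed

section \<open>Compositions without a block of ones\<close>

text \<open>
  The argument \<open>j\<close> is the number of ones that immediately precede the composition. It acts as the state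
  of an automaton that reads the parts from left to right, which makes a recurrence in the first part
  possible; the count of interest has \<open>j = 0\<close>.
\<close>

definition ones_free_count :: "nat \<Rightarrow> nat \<Rightarrow> nat \<Rightarrow> nat" where
  "ones_free_count k j m =
     card {xs \<in> compositions m. \<not> sublist (replicate k 1) (replicate j 1 @ xs)}"

lemma prefix_replicate_append_other:
  assumes "j < k" "b \<noteq> a"
  shows "\<not> prefix (replicate k a) (replicate j a @ b # xs)"
proof
  assume "prefix (replicate k a) (replicate j a @ b # xs)"
  then obtain ys where "replicate j a @ b # xs = replicate k a @ ys" by (auto simp: prefix_def)
  then have "(replicate j a @ b # xs) ! j = (replicate k a @ ys) ! j" by simp
  then show False using assms by (simp add: nth_append)
qed

text \<open>
  A part different from \<open>a\<close> separates what is on its two sides, so a short block of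
  \<open>a\<close> in front of it can be dropped.
\<close>

lemma sublist_replicate_append_other:
  assumes "j < k" "b \<noteq> a"
  shows "sublist (replicate k a) (replicate j a @ b # xs) \<longleftrightarrow> sublist (replicate k a) xs"
  using assms(1)
proof (induction j)
  case 0
  then show ?case using prefix_replicate_append_other[OF 0 assms(2), of xs]
    by (simp add: sublist_Cons_right)
next
  case (Suc j)
  then show ?case using prefix_replicate_append_other[OF Suc.prems assms(2), of xs]
    by (simp add: sublist_Cons_right)
qed

lemma ones_free_count_full: "ones_free_count k k m = 0"
proof -
  have "sublist (replicate k 1) (replicate k (1::nat) @ xs)" for xs
    by (simp add: sublist_append)
  then show ?thesis by (simp add: ones_free_count_def)
qed

text \<open>
  The first part is either a one, which lengthens the preceding block, or larger, which resets the state
  to 0; in the second case the rest is any block-free composition of a number below \<open>m\<close>.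
\<close>

lemma ones_free_count_Suc:
  assumes "j < k"
  shows "ones_free_count k j (Suc m) = ones_free_count k (Suc j) m + (\<Sum>i<m. ones_free_count k 0 i)"
proof -
  have "ones_free_count k j (Suc m) = (\<Sum>i\<le>m. card {ys \<in> compositions i.
           \<not> sublist (replicate k 1) (replicate j 1 @ (Suc m - i) # ys)})"
    unfolding ones_free_count_def by (rule card_filtered_compositions_Suc)
  also have "\<dots> = card {ys \<in> compositions m. \<not> sublist (replicate k 1) (replicate j 1 @ 1 # ys)}
      + (\<Sum>i<m. card {ys \<in> compositions i. \<not> sublist (replicate k 1) (replicate j 1 @ (Suc m - i) # ys)})"
    by (simp add: lessThan_Suc_atMost[symmetric] Suc_diff_le)
  also have "(\<lambda>ys::nat list. replicate j 1 @ 1 # ys) = (\<lambda>ys. replicate (Suc j) 1 @ ys)"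
    by (auto simp: replicate_app_Cons_same)
  also have "(\<Sum>i<m. card {ys \<in> compositions i. \<not> sublist (replicate k 1) (replicate j 1 @ (Suc m - i) # ys)})
      = (\<Sum>i<m. ones_free_count k 0 i)"
    unfolding ones_free_count_def
  proof (intro sum.cong refl arg_cong[where f = card] Collect_cong conj_cong)
    fix i ys assume "i \<in> {..<m}"
    then have "Suc m - i \<noteq> 1" by auto
    from sublist_replicate_append_other[OF assms this]
    show "(\<not> sublist (replicate k 1) (replicate j 1 @ (Suc m - i) # ys)) =
        (\<not> sublist (replicate k 1) (replicate 0 1 @ ys))" by simp
  qed
  finally show ?thesis unfolding ones_free_count_def by (simp add: fun_eq_iff)
qed

text \<open>
  Iterating the previous recurrence until the state reaches \<open>k\<close>, where the count vanishes, leaves a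
  sum over a window of consecutive partial sums.
\<close>

lemma ones_free_count_unroll:
  assumes "j \<le> k" "k \<le> n + 1 + j"
  shows "ones_free_count k j (n + 1) = (\<Sum>i=n+1+j-k..<n+1. \<Sum>l<i. ones_free_count k 0 l)"
  using assms
proof (induction "k - j" arbitrary: j n)
  case 0
  then show ?case by (simp add: ones_free_count_full)
next
  case (Suc d)
  then have j: "j < k" by simp
  show ?case
  proof (cases n)
    case 0
    with Suc.prems j have k: "k = Suc j" by simp
    show ?thesis unfolding 0 using ones_free_count_Suc[OF j, of 0] by (simp add: k ones_free_count_full)
  next
    case (Suc n')
    have IH: "ones_free_count k (Suc j) (n' + 1) = (\<Sum>i=n'+1+Suc j-k..<n'+1. \<Sum>l<i. ones_free_count k 0 l)"
      by (rule Suc.hyps) (use \<open>Suc d = k - j\<close> Suc.prems Suc in auto)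
    have "(\<Sum>i=n+1+j-k..<n+1. \<Sum>l<i. ones_free_count k 0 l) =
        (\<Sum>i=n+1+j-k..<n. \<Sum>l<i. ones_free_count k 0 l) + (\<Sum>l<n. ones_free_count k 0 l)"
      using j by (simp add: sum.atLeastLessThan_Suc)
    then show ?thesis using IH ones_free_count_Suc[OF j, of n] by (simp add: Suc)
  qed
qed

text \<open>
  The count is a sum over a moving window of \<open>k\<close> partial sums. One difference leaves two
  partial sums, a second one leaves two values of the count itself.
\<close>

lemma ones_free_count_recurrence:
  assumes "1 \<le> k" "k \<le> n"
  shows "ones_free_count k 0 (n + 2) + ones_free_count k 0 (n - k) = 2 * ones_free_count k 0 (n + 1)"
proof -
  define S where "S = (\<lambda>i. \<Sum>l<i. ones_free_count k 0 l)"
  have S: "S (Suc i) = S i + ones_free_count k 0 i" for i by (simp add: S_def)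
  have win: "ones_free_count k 0 m = (\<Sum>i=m-k..<m. S i)" if "k \<le> m" for m
    using ones_free_count_unroll[of 0 k "m - 1"] that assms by (simp add: S_def)
  have step: "ones_free_count k 0 (Suc m) + S (m - k) = ones_free_count k 0 m + S m" if "k \<le> m" for m
    using win[of m] win[of "Suc m"] that assms sum.atLeast_Suc_lessThan[of "m - k" m S]
    by (simp add: Suc_diff_le sum.atLeastLessThan_Suc)
  show ?thesis
    using step[of n] step[of "Suc n"] S[of n] S[of "n - k"] assms
    by (simp add: Suc_diff_le)
qed

text \<open>
  Normalised by \<open>2 ^ (n - 1)\<close>, written so that the exponent needs no subtraction. At \<open>n = 0\<close> the
  value is 2 rather than a probability, which is what the recurrence requires there.
\<close>

definition ones_free_prob :: "nat \<Rightarrow> nat \<Rightarrow> real" where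
  "ones_free_prob k n = 2 * real (ones_free_count k 0 n) / 2 ^ n"

lemma ones_free_prob_eq_prob:
  assumes "0 < n"
  shows "ones_free_prob k n =
    measure_pmf.prob (random_composition n) {xs. \<not> sublist (replicate k 1) xs}"
proof -
  have "compositions n \<inter> {xs. \<not> sublist (replicate k 1) xs}
      = {xs \<in> compositions n. \<not> sublist (replicate k 1) xs}" by auto
  moreover obtain m where "n = Suc m" using assms gr0_implies_Suc by blast
  ultimately show ?thesis
    by (simp add: random_composition_def measure_pmf_of_set[OF compositions_nonempty finite_compositions]
      ones_free_prob_def ones_free_count_def card_compositions_Suc)
qed

lemma ones_free_prob_nonneg: "0 \<le> ones_free_prob k n"
  by (simp add: ones_free_prob_def)

lemma ones_free_prob_le_1: "0 < n \<Longrightarrow> ones_free_prob k n \<le> 1"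
  by (simp add: ones_free_prob_eq_prob)

lemma ones_free_prob_rec:
  assumes "1 \<le> k" "k + 1 \<le> n"
  shows "ones_free_prob k (n + 1) = ones_free_prob k n - ones_free_prob k (n - k - 1) / 2 ^ (k + 2)"
proof -
  define d where "d = n - k - 1"
  have n: "n = d + k + 1" using assms by (simp add: d_def)
  have "real (ones_free_count k 0 (d + k + 2)) + real (ones_free_count k 0 d) = 2 * real (ones_free_count k 0 (d + k + 1))"
    using ones_free_count_recurrence[of k "d + k"] assms by simp
  then have "real (ones_free_count k 0 (d + k + 2)) = 2 * real (ones_free_count k 0 (d + k + 1)) - real (ones_free_count k 0 d)"
    by simp
  then show ?thesis
    by (simp add: n ones_free_prob_def power_add field_simps)
qed

text \<open>
  The union bound is sharp enough when \<open>n\<close> hardly exceeds \<open>k\<close>; this provides the initial values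
  for the recurrence.
\<close>

lemma ones_free_prob_ge:
  assumes "0 < n" "n \<le> k + 2"
  shows "ones_free_prob k n \<ge> 1 - 24 / 2 ^ (k + 2)"
proof -
  let ?B = "{xs \<in> compositions n. sublist (replicate k 1) xs}"
  have "{xs \<in> compositions n. \<not> sublist (replicate k 1) xs} = compositions n - ?B" by auto
  then have "ones_free_count k 0 n = card (compositions n - ?B)"
    unfolding ones_free_count_def by (simp only: replicate_0 append_Nil)
  also have "\<dots> = card (compositions n) - card ?B"
    by (rule card_Diff_subset) (auto intro: finite_subset[OF _ finite_compositions])
  finally have 1: "real (ones_free_count k 0 n) \<ge> real (card (compositions n)) - real (card ?B)" by simp
  have "card ?B \<le> (if k \<le> n then (n + 1 - k) * 2 ^ (n - k) else 0)"
    using card_compositions_containing_block_le[of n k 1] by (simp only: mult_1_right)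
  also have "\<dots> \<le> 3 * 2 ^ (n - k)"
    using assms by auto
  finally have "real (card ?B) \<le> real (3 * 2 ^ (n - k))" by (rule of_nat_mono)
  moreover have "k \<le> n \<or> card ?B = 0"
    using card_compositions_containing_block_le[of n k 1] by (cases "k \<le> n") simp_all
  ultimately have 2: "real (card ?B) \<le> 3 * 2 ^ n / 2 ^ k"
    by (auto simp: power_diff)
  obtain m where m: "n = Suc m" using assms gr0_implies_Suc by blast
  have "(2 ^ m - 6 * 2 ^ m / 2 ^ k) / 2 ^ m \<le> real (ones_free_count k 0 n) / 2 ^ m"
    using 1 2 by (intro divide_right_mono) (simp_all add: m card_compositions_Suc)
  then show ?thesis
    unfolding ones_free_prob_def by (simp add: m diff_divide_distrib power_add)
qed

section \<open>From blocks of ones to the longest run\<close>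

lemma longest_run_less_iff: "longest_run xs < k \<longleftrightarrow> (\<forall>a. \<not> sublist (replicate k a) xs)"
proof -
  have "sublist (replicate k a) xs" if "sublist (replicate l a) xs" "k \<le> l" for l a
  proof -
    have "replicate l a = replicate k a @ replicate (l - k) a"
      using that(2) by (simp flip: replicate_add)
    then have "sublist (replicate k a) (replicate l a)" by simp
    with that(1) show ?thesis by (rule sublist_order.order_trans[rotated])
  qed
  note shorter = this
  show ?thesis
    unfolding longest_run_def Max_less_iff[OF finite_run_lengths run_lengths_nonempty]
  proof
    assume "\<forall>l\<in>{l. \<exists>a. sublist (replicate l a) xs}. l < k"
    then show "\<forall>a. \<not> sublist (replicate k a) xs" by blast
  next
    assume *: "\<forall>a. \<not> sublist (replicate k a) xs"
    show "\<forall>l\<in>{l. \<exists>a. sublist (replicate l a) xs}. l < k"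
    proof
      fix l assume "l \<in> {l. \<exists>a. sublist (replicate l a) xs}"
      then obtain a where "sublist (replicate l a) xs" by blast
      from shorter[OF this] * show "l < k" using not_le by blast
    qed
  qed
qed

lemma prob_longest_run_less_le:
  assumes "0 < n"
  shows "measure_pmf.prob (random_composition n) {xs. longest_run xs < k} \<le> ones_free_prob k n"
  unfolding ones_free_prob_eq_prob[OF assms]
  by (rule measure_pmf.finite_measure_mono) (auto simp: longest_run_less_iff)

lemma sum_power_from_2_le:
  assumes "0 \<le> r" "r \<le> 1 / 2"
  shows "(\<Sum>a=2..n. r ^ a) \<le> 2 * (r::real)\<^sup>2"
proof -
  have "(\<Sum>a=2..<m+2. r ^ a) \<le> 2 * r\<^sup>2 - 2 * r ^ (m + 2)" for m
  proof (induction m)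
    case (Suc m)
    have "r ^ (m + 2) * r \<le> r ^ (m + 2) * (1 / 2)"
      using assms by (intro mult_left_mono) auto
    with Suc show ?case by (simp add: mult_ac power2_eq_square)
  qed (simp add: power2_eq_square)
  from this[of "n - 1"] have "(\<Sum>a=2..<n-1+2. r ^ a) \<le> 2 * r\<^sup>2"
    using assms zero_le_power[of r "n - 1 + 2"] by linarith
  moreover have "{2..<n-1+2} = {2..n}" by auto
  ultimately show ?thesis by (simp only:)
qed

text \<open>
  A composition without \<open>k\<close> consecutive ones whose longest run still has length at least \<open>k\<close>
  contains a block of some \<open>a \<ge> 2\<close>. The bounds for the individual \<open>a\<close> form a geometric series
  of ratio \<open>1 / 2 ^ k\<close>, dominated by \<open>a = 2\<close>.
\<close>

lemma ones_free_prob_le_prob_longest_run_less: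
  assumes "0 < n" "1 \<le> k"
  shows "ones_free_prob k n \<le>
    measure_pmf.prob (random_composition n) {xs. longest_run xs < k} + 4 * real (n + 1) / 4 ^ k"
proof -
  let ?C = "compositions n"
  let ?G = "{xs \<in> ?C. \<not> sublist (replicate k 1) xs}"
  let ?S = "{xs \<in> ?C. longest_run xs < k}"
  let ?B = "\<lambda>a. {xs \<in> ?C. sublist (replicate k a) xs}"
  have "?G \<subseteq> ?S \<union> (\<Union>a\<in>{2..n}. ?B a)"
  proof
    fix xs assume xs: "xs \<in> ?G"
    show "xs \<in> ?S \<union> (\<Union>a\<in>{2..n}. ?B a)"
    proof (cases "longest_run xs < k")
      case False
      then obtain a where a: "sublist (replicate k a) xs" by (auto simp: longest_run_less_iff)
      then have "set (replicate k a) \<subseteq> set xs" by (rule set_mono_sublist)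
      then have "a \<in> set xs" using assms by auto
      then have "0 < a" "a \<le> n" using xs member_le_sum_list by (auto simp: compositions_def)
      moreover have "a \<noteq> 1" using xs a by auto
      ultimately show ?thesis using xs a by auto
    qed (use xs in auto)
  qed
  then have "card ?G \<le> card (?S \<union> (\<Union>a\<in>{2..n}. ?B a))"
    by (rule card_mono[rotated]) (auto simp: finite_compositions)
  also have "\<dots> \<le> card ?S + card (\<Union>a\<in>{2..n}. ?B a)" by (rule card_Un_le)
  also have "card (\<Union>a\<in>{2..n}. ?B a) \<le> (\<Sum>a=2..n. card (?B a))" by (rule card_UN_le) simp
  finally have "real (card ?G) \<le> real (card ?S + (\<Sum>a=2..n. card (?B a)))"
    by (simp only: of_nat_le_iff add_le_mono)
  also have "\<dots> = real (card ?S) + (\<Sum>a=2..n. real (card (?B a)))" by simp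
  also have "(\<Sum>a=2..n. real (card (?B a))) \<le> (\<Sum>a=2..n. real (n + 1) * 2 ^ n * (1 / 2 ^ k) ^ a)"
  proof (rule sum_mono)
    fix a
    show "real (card (?B a)) \<le> real (n + 1) * 2 ^ n * (1 / 2 ^ k) ^ a"
    proof (cases "k * a \<le> n")
      case True
      have "real (card (?B a)) \<le> real ((n + 1 - k * a) * 2 ^ (n - k * a))"
        using card_compositions_containing_block_le[of n k a] True by (simp only: of_nat_le_iff if_True)
      also have "\<dots> \<le> real ((n + 1) * 2 ^ (n - k * a))"
        by (intro of_nat_mono mult_right_mono) auto
      also have "\<dots> = real (n + 1) * 2 ^ n * (1 / 2 ^ k) ^ a"
      proof -
        have "(2::real) ^ (n - k * a) = 2 ^ n * (1 / 2 ^ k) ^ a"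
          using True by (simp add: power_diff power_mult power_divide)
        then show ?thesis by (simp add: algebra_simps)
      qed
      finally show ?thesis .
    next
      case False
      then have "card (?B a) = 0" using card_compositions_containing_block_le[of n k a] by simp
      then show ?thesis by simp
    qed
  qed
  also have "\<dots> = real (n + 1) * 2 ^ n * (\<Sum>a=2..n. (1 / 2 ^ k) ^ a)"
    by (simp only: sum_distrib_left)
  also have "\<dots> \<le> real (n + 1) * 2 ^ n * (2 * (1 / 2 ^ k)\<^sup>2)"
  proof (intro mult_left_mono sum_power_from_2_le)
    have "(2::real) ^ 1 \<le> 2 ^ k" using assms by (intro power_increasing) auto
    then show "1 / 2 ^ k \<le> (1 / 2 :: real)" by (simp add: field_simps)
  qed auto
  also have "(1 / 2 ^ k :: real)\<^sup>2 = 1 / 4 ^ k"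
    by (simp add: power_divide flip: power_mult) (simp add: power_mult mult.commute[of k])
  finally have *: "real (card ?G) \<le> real (card ?S) + real (n + 1) * 2 ^ n * (2 * (1 / 4 ^ k))"
    by simp
  obtain m where m: "n = Suc m" using assms gr0_implies_Suc by blast
  have "measure_pmf.prob (random_composition n) {xs. longest_run xs < k} = real (card ?S) / 2 ^ m"
  proof -
    have "?C \<inter> {xs. longest_run xs < k} = ?S" by auto
    then show ?thesis
      by (simp add: random_composition_def measure_pmf_of_set[OF compositions_nonempty finite_compositions]
         m card_compositions_Suc)
  qed
  moreover have "ones_free_prob k n = real (card ?G) / 2 ^ m"
    by (simp add: ones_free_prob_def ones_free_count_def m)
  moreover have "real (card ?G) / 2 ^ m \<le> (real (card ?S) + real (n + 1) * 2 ^ n * (2 * (1 / 4 ^ k))) / 2 ^ m"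
    using * by (rule divide_right_mono) simp
  moreover have "\<dots> = real (card ?S) / 2 ^ m + 4 * real (n + 1) / 4 ^ k"
    by (simp add: m add_divide_distrib)
  ultimately show ?thesis by simp
qed

lemma ones_free_prob_antimono:
  assumes "k \<le> k'" "0 < n"
  shows "ones_free_prob k n \<le> ones_free_prob k' n"
proof -
  have "sublist (replicate k 1) xs" if "sublist (replicate k' 1) xs" for xs :: "nat list"
  proof -
    have "replicate k' (1::nat) = replicate k 1 @ replicate (k' - k) 1"
      using assms by (simp flip: replicate_add)
    then have "sublist (replicate k 1) (replicate k' (1::nat))" by simp
    with that show ?thesis by (rule sublist_order.order_trans[rotated])
  qed
  then show ?thesis unfolding ones_free_prob_eq_prob[OF assms(2)]
    by (intro measure_pmf.finite_measure_mono) auto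
qed

section \<open>The exponential approximation\<close>

text \<open>
  From \<open>k + 1\<close> on the sequence decreases by the recurrence. Hence once \<open>n - k - 1\<close> is in that range,
  the subtracted term is at least \<open>q * p n\<close>, and each step multiplies by at most \<open>1 - q\<close>. Starting
  the decrease any earlier is impossible: \<open>p k < p (k + 1)\<close>.
\<close>

lemma ones_free_prob_le_exp:
  assumes "1 \<le> k" "0 < n"
  shows "ones_free_prob k n \<le> exp (- (real n - real (2 * k + 2)) / 2 ^ (k + 2))"
proof (cases "2 * k + 2 \<le> n")
  case False
  then have "0 \<le> - (real n - real (2 * k + 2)) / 2 ^ (k + 2)" by (intro divide_nonneg_pos) auto
  then have "1 \<le> exp (- (real n - real (2 * k + 2)) / 2 ^ (k + 2))" by simp
  with ones_free_prob_le_1[OF assms(2), of k] show ?thesis by linarith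
next
  case True
  define q where "q = 1 / (2::real) ^ (k + 2)"
  have q: "0 \<le> q" "q \<le> 1" using one_le_power[of "2::real" "k + 2"] by (simp_all add: q_def)
  have rec: "ones_free_prob k (m + 1) = ones_free_prob k m - q * ones_free_prob k (m - k - 1)" if "k + 1 \<le> m" for m
    using ones_free_prob_rec[OF assms(1) that] by (simp add: q_def)
  have dec: "ones_free_prob k m \<le> ones_free_prob k l" if "l \<le> m" "k + 1 \<le> l" for l m
    using that
  proof (induction rule: dec_induct)
    case (step m)
    then show ?case using rec[of m] q mult_nonneg_nonneg[OF q(1) ones_free_prob_nonneg[of k "m - k - 1"]] by simp
  qed simp
  have "ones_free_prob k m \<le> (1 - q) ^ (m - (2 * k + 2))" if "2 * k + 2 \<le> m" for m
    using that
  proof (induction rule: dec_induct)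
    case base
    show ?case using ones_free_prob_le_1[of "2 * k + 2" k] by simp
  next
    case (step m)
    have "ones_free_prob k (Suc m) = ones_free_prob k m - q * ones_free_prob k (m - k - 1)"
      using rec[of m] step by simp
    also have "\<dots> \<le> ones_free_prob k m - q * ones_free_prob k m"
      using dec[of "m - k - 1" m] step q by (simp add: mult_left_mono)
    also have "\<dots> = ones_free_prob k m * (1 - q)" by (simp add: algebra_simps)
    also have "\<dots> \<le> (1 - q) ^ (m - (2 * k + 2)) * (1 - q)"
      using step q by (intro mult_right_mono) auto
    also have "\<dots> = (1 - q) ^ (Suc m - (2 * k + 2))"
      using step Suc_diff_le[of "2 * k + 2" m] by (simp only: power_Suc2)
    finally show ?case .
  qed
  from this[OF True] have "ones_free_prob k n \<le> (1 - q) ^ (n - (2 * k + 2))" .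
  also have "\<dots> \<le> exp (- q) ^ (n - (2 * k + 2))"
    using exp_ge_add_one_self[of "-q"] q by (intro power_mono) auto
  also have "\<dots> = exp (- (real n - real (2 * k + 2)) / 2 ^ (k + 2))"
    using True by (simp add: exp_of_nat_mult[symmetric] q_def of_nat_diff field_simps)
  finally show ?thesis .
qed

text \<open>
  In the other direction a lower bound \<open>1 - \<beta>\<close> on the successive ratios reproduces itself. If the ratios up
  to \<open>m\<close> are at least \<open>1 - \<beta>\<close>, then \<open>p (m - k - 1)\<close> exceeds \<open>p m\<close> by a factor of at most
  \<open>(1 - \<beta>) ^ - (k + 1)\<close>, so the next ratio is at least \<open>1 - q / (1 - \<beta>) ^ (k + 1)\<close>. It suffices that
  \<open>q \<le> \<beta> * (1 - \<beta>) ^ (k + 1)\<close>, which \<open>\<beta> = q + O(k * q\<^sup>2)\<close> achieves. The first few values carry an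
  extra loss, paid for by 48 further factors.
\<close>

lemma ones_free_prob_ge_exp:
  assumes k: "6 \<le> k" and n: "k + 2 \<le> n"
  shows "ones_free_prob k n \<ge> exp (- (real n / 2 ^ (k + 2))) - (real k + 60) / 2 ^ k"
proof -
  define q where "q = 1 / (2::real) ^ (k + 2)"
  define d where "d = 4 * (real k + 49) * q"
  define \<beta> where "\<beta> = q * (1 + d)"
  have pow: "k + 49 \<le> 2 ^ k" using k
  proof (induction rule: dec_induct)
    case (step m) then show ?case by simp
  qed simp
  then have "real (k + 49) \<le> real (2 ^ k)" by (rule of_nat_mono)
  then have d: "0 \<le> d" "d \<le> 1" by (simp_all add: d_def q_def field_simps)
  have "real (48 + 7) \<le> real (2 ^ k)" using pow k by (intro of_nat_mono) simp
  then have q: "0 < q" "q \<le> 1 / 192" by (simp_all add: q_def field_simps)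
  have b: "0 < \<beta>" "q \<le> \<beta>" "\<beta> \<le> 2 * q"
    using q d by (auto simp: \<beta>_def mult_pos_pos)
  have b1: "0 \<le> 1 - \<beta>" "1 - \<beta> \<le> 1" using b q by auto
  \<comment> \<open>By the Bernoulli inequality, since \<open>(1 + d) * (1 - d / 4 * (1 + d)) \<ge> 1\<close> for \<open>d\<close> in the unit interval.\<close>
  have key: "q \<le> \<beta> * (1 - \<beta>) ^ (k + 49)"
  proof -
    have "1 + real (k + 49) * (- \<beta>) \<le> (1 + (- \<beta>)) ^ (k + 49)"
      by (rule Bernoulli_inequality) (use b1 in auto)
    moreover have "real (k + 49) * \<beta> = d / 4 * (1 + d)"
      by (simp add: \<beta>_def d_def field_simps)
    ultimately have "1 - d / 4 * (1 + d) \<le> (1 - \<beta>) ^ (k + 49)" by simp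
    then have "\<beta> * (1 - d / 4 * (1 + d)) \<le> \<beta> * (1 - \<beta>) ^ (k + 49)"
      using b by (intro mult_left_mono) auto
    moreover have "(1 + d) * (1 - d / 4 * (1 + d)) \<ge> 1"
    proof -
      have "(1 + d)\<^sup>2 \<le> 2\<^sup>2" using d by (intro power_mono) auto
      then have "d * (1 + d)\<^sup>2 \<le> d * 4" using d by (intro mult_left_mono) auto
      then show ?thesis by (simp add: power2_eq_square field_simps)
    qed
    then have "q * 1 \<le> q * ((1 + d) * (1 - d / 4 * (1 + d)))"
      using q by (intro mult_left_mono) auto
    ultimately show ?thesis by (simp add: \<beta>_def mult.assoc)
  qed
  \<comment> \<open>The initial loss \<open>1 - 24 * q\<close> is worth at most twice 24 factors \<open>1 - q\<close>, as \<open>q \<le> 1 / 48\<close>.\<close>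
  have start: "(1 - \<beta>) ^ 48 \<le> ones_free_prob k (k + 2)"
  proof -
    have "(1 - q) ^ 48 * (1 + 48 * q) \<le> (1 - q) ^ 48 * (1 + q) ^ 48"
      using Bernoulli_inequality[of q 48] q by (intro mult_left_mono) auto
    also have "\<dots> = (1 - q\<^sup>2) ^ 48"
      by (simp add: power_mult_distrib[symmetric] power2_eq_square algebra_simps)
    also have "\<dots> \<le> 1" using q by (intro power_le_one) (auto simp: power_le_one)
    also have "1 \<le> (1 - 24 * q) * (1 + 48 * q)"
    proof -
      have "q * (1152 * q) \<le> q * 24" using q by (intro mult_left_mono) auto
      then show ?thesis by (simp add: algebra_simps)
    qed
    finally have "(1 - q) ^ 48 \<le> 1 - 24 * q" using q by simp
    moreover have "(1 - \<beta>) ^ 48 \<le> (1 - q) ^ 48" using b b1 by (intro power_mono) auto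
    ultimately show ?thesis using ones_free_prob_ge[of "k + 2" k] by (simp add: q_def)
  qed
  have ratio: "(1 - \<beta>) * ones_free_prob k m \<le> ones_free_prob k (Suc m)" if "k + 2 \<le> m" for m
    using that
  proof (induction m rule: less_induct)
    case (less m)
    have chain: "(1 - \<beta>) ^ (m - l) * ones_free_prob k l \<le> ones_free_prob k m" if "k + 2 \<le> l" "l \<le> m" for l
      using that(2,1)
    proof (induction rule: inc_induct)
      case (step i)
      have "(1 - \<beta>) ^ (m - i) * ones_free_prob k i = (1 - \<beta>) ^ (m - Suc i) * ((1 - \<beta>) * ones_free_prob k i)"
        using step.hyps by (simp add: Suc_diff_Suc[symmetric] mult_ac)
      also have "\<dots> \<le> (1 - \<beta>) ^ (m - Suc i) * ones_free_prob k (Suc i)"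
        using less.IH[of i] step b1 by (intro mult_left_mono) auto
      also have "\<dots> \<le> ones_free_prob k m" using step by simp
      finally show ?case .
    qed simp
    have "(1 - \<beta>) ^ (k + 49) * ones_free_prob k (m - k - 1) \<le> ones_free_prob k m"
    proof (cases "k + 2 \<le> m - k - 1")
      case True
      have "(1 - \<beta>) ^ (k + 49) * ones_free_prob k (m - k - 1)
          \<le> (1 - \<beta>) ^ (m - (m - k - 1)) * ones_free_prob k (m - k - 1)"
        using b1 ones_free_prob_nonneg True by (intro mult_right_mono power_decreasing) auto
      also have "\<dots> \<le> ones_free_prob k m" using chain[OF True] by simp
      finally show ?thesis .
    next
      case False
      have "(1 - \<beta>) ^ (k + 49) * ones_free_prob k (m - k - 1) \<le> (1 - \<beta>) ^ (k + 49) * 1"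
        using b1 less.prems by (intro mult_left_mono ones_free_prob_le_1) auto
      also have "\<dots> \<le> (1 - \<beta>) ^ (m - (k + 2)) * (1 - \<beta>) ^ 48"
        unfolding power_add[symmetric] mult_1_right using b1 False by (intro power_decreasing) auto
      also have "\<dots> \<le> (1 - \<beta>) ^ (m - (k + 2)) * ones_free_prob k (k + 2)"
        using start b1 by (intro mult_left_mono) auto
      also have "\<dots> \<le> ones_free_prob k m" using chain[of "k + 2"] less.prems by simp
      finally show ?thesis .
    qed
    then have "\<beta> * ((1 - \<beta>) ^ (k + 49) * ones_free_prob k (m - k - 1)) \<le> \<beta> * ones_free_prob k m"
      using b by (intro mult_left_mono) auto
    moreover have "q * ones_free_prob k (m - k - 1) \<le> \<beta> * (1 - \<beta>) ^ (k + 49) * ones_free_prob k (m - k - 1)"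
      using key ones_free_prob_nonneg by (intro mult_right_mono) auto
    moreover have "ones_free_prob k (Suc m) = ones_free_prob k m - q * ones_free_prob k (m - k - 1)"
      using ones_free_prob_rec[of k m] k less.prems by (simp add: q_def)
    ultimately show ?case by (simp add: algebra_simps)
  qed
  have "(1 - \<beta>) ^ (m - (k + 2)) * (1 - 24 * q) \<le> ones_free_prob k m" if "k + 2 \<le> m" for m
    using that
  proof (induction rule: dec_induct)
    case base
    show ?case using ones_free_prob_ge[of "k + 2" k] by (simp add: q_def)
  next
    case (step m)
    have "(1 - \<beta>) ^ (Suc m - (k + 2)) * (1 - 24 * q) = (1 - \<beta>) * ((1 - \<beta>) ^ (m - (k + 2)) * (1 - 24 * q))"
      using step Suc_diff_le[of "k + 2" m] by (simp only: power_Suc mult.assoc)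
    also have "\<dots> \<le> (1 - \<beta>) * ones_free_prob k m" using step b1 by (intro mult_left_mono) auto
    also have "\<dots> \<le> ones_free_prob k (Suc m)" using ratio step by simp
    finally show ?case .
  qed
  from this[OF n] have lower: "(1 - \<beta>) ^ (n - (k + 2)) * (1 - 24 * q) \<le> ones_free_prob k n" .
  have "exp (- real n * q) * (1 - real n * (4 * (real k + 49) + 8) * q\<^sup>2) \<le> (1 - \<beta>) ^ n"
  proof -
    have "- \<beta> - 2 * \<beta>\<^sup>2 \<le> ln (1 - \<beta>)"
      using b q by (intro ln_one_minus_pos_lower_bound) auto
    moreover have "\<beta>\<^sup>2 \<le> (2 * q)\<^sup>2" using b by (intro power_mono) auto
    moreover have "\<beta> = q + 4 * (real k + 49) * q\<^sup>2"
      by (simp add: \<beta>_def d_def power2_eq_square algebra_simps)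
    ultimately have ln: "- q - (4 * (real k + 49) + 8) * q\<^sup>2 \<le> ln (1 - \<beta>)"
      by (simp add: power_mult_distrib algebra_simps)
    have "1 + (- (real n * (4 * (real k + 49) + 8) * q\<^sup>2)) \<le> exp (- (real n * (4 * (real k + 49) + 8) * q\<^sup>2))"
      by (rule exp_ge_add_one_self)
    then have "exp (- real n * q) * (1 - real n * (4 * (real k + 49) + 8) * q\<^sup>2)
        \<le> exp (- real n * q) * exp (- (real n * (4 * (real k + 49) + 8) * q\<^sup>2))"
      by (intro mult_left_mono) auto
    also have "\<dots> = exp (real n * (- q - (4 * (real k + 49) + 8) * q\<^sup>2))"
      by (simp add: exp_add[symmetric] algebra_simps)
    also have "\<dots> \<le> exp (real n * ln (1 - \<beta>))"
      using ln by (simp add: mult_left_mono)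
    also have "\<dots> = (1 - \<beta>) ^ n"
      using b q by (simp add: exp_of_nat_mult)
    finally show ?thesis .
  qed
  moreover have "exp (- real n * q) * (real n * (4 * (real k + 49) + 8) * q\<^sup>2) \<le> (4 * (real k + 49) + 8) * q"
  proof -
    have "real n * q \<le> exp (real n * q)" using exp_ge_add_one_self[of "real n * q"] by linarith
    then have "exp (- real n * q) * (real n * q) \<le> exp (- real n * q) * exp (real n * q)"
      by (intro mult_left_mono) auto
    then have "exp (- real n * q) * (real n * q) \<le> 1" by (simp add: exp_minus)
    then have "((4 * (real k + 49) + 8) * q) * (exp (- real n * q) * (real n * q)) \<le> ((4 * (real k + 49) + 8) * q) * 1"
      using q by (intro mult_left_mono) auto
    then show ?thesis by (simp add: power2_eq_square mult_ac)
  qed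
  ultimately have "exp (- real n * q) - (4 * (real k + 49) + 8) * q \<le> (1 - \<beta>) ^ n"
    by (simp add: algebra_simps)
  also have "\<dots> \<le> (1 - \<beta>) ^ (n - (k + 2))" using b1 by (intro power_decreasing) auto
  finally have "exp (- real n * q) - (4 * (real k + 49) + 8) * q \<le> (1 - \<beta>) ^ (n - (k + 2))" .
  moreover have "(1 - \<beta>) ^ (n - (k + 2)) * (24 * q) \<le> 1 * (24 * q)"
    using b1 q by (intro mult_right_mono power_le_one) auto
  ultimately have "exp (- real n * q) - (4 * (real k + 49) + 8) * q - 24 * q \<le> ones_free_prob k n"
    using lower by (simp add: algebra_simps)
  moreover have "(real k + 60) / 2 ^ k = (4 * real k + 240) * q"
    by (simp add: q_def field_simps)
  ultimately have "exp (- real n * q) - (real k + 60) / 2 ^ k \<le> ones_free_prob k n"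
    using q by (simp add: algebra_simps)
  then show ?thesis by (simp add: q_def)
qed

lemma ones_free_prob_approx:
  assumes k: "6 \<le> k" and n: "0 < n"
  shows "\<bar>ones_free_prob k n - exp (- (real n / 2 ^ (k + 2)))\<bar> \<le> (real k + 60) / 2 ^ k"
proof -
  define q where "q = 1 / (2::real) ^ (k + 2)"
  have q: "0 < q" by (simp add: q_def)
  have eq: "(real k + 60) / 2 ^ k = (4 * real k + 240) * q"
    by (simp add: q_def field_simps)
  have "exp (- real n * q) - (4 * real k + 240) * q \<le> ones_free_prob k n"
  proof (cases "k + 2 \<le> n")
    case True
    then show ?thesis using ones_free_prob_ge_exp[OF k True] unfolding eq by (simp add: q_def)
  next
    case False
    then have "1 - 24 * q \<le> ones_free_prob k n" using ones_free_prob_ge[of n k] n by (simp add: q_def)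
    moreover have "exp (- real n * q) \<le> 1" using q by simp
    moreover have "24 * q \<le> (4 * real k + 240) * q" using q by (intro mult_right_mono) auto
    ultimately show ?thesis by linarith
  qed
  moreover have "ones_free_prob k n \<le> exp (- real n * q) + (4 * real k + 240) * q"
  proof -
    have pow: "k + 49 \<le> 2 ^ k" using k
    proof (induction rule: dec_induct)
      case (step m) then show ?case by simp
    qed simp
    then have "real (2 * k + 2) \<le> real (2 ^ (k + 2))" by (intro of_nat_mono) simp
    then have qk: "q * real (2 * k + 2) \<le> 1" by (simp add: q_def field_simps)
    have ineq: "exp x - 1 \<le> 2 * x" if "0 \<le> x" "x \<le> 1" for x :: real
      using exp_bound[of x] that mult_left_mono[of x 1 x] by (simp add: power2_eq_square)
    show ?thesis
    proof (cases "0 \<le> real n - real (2 * k + 2)")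
      case True
      have "ones_free_prob k n \<le> exp (- (real n - real (2 * k + 2)) / 2 ^ (k + 2))"
        using ones_free_prob_le_exp[of k n] k n by simp
      also have "\<dots> = exp (- real n * q) * exp (q * real (2 * k + 2))"
        by (simp add: q_def exp_add[symmetric] field_simps)
      also have "\<dots> = exp (- real n * q) + exp (- real n * q) * (exp (q * real (2 * k + 2)) - 1)"
        by (simp add: algebra_simps)
      also have "exp (- real n * q) * (exp (q * real (2 * k + 2)) - 1) \<le> 1 * (2 * (q * real (2 * k + 2)))"
        using q qk by (intro mult_mono ineq) auto
      also have "1 * (2 * (q * real (2 * k + 2))) \<le> (4 * real k + 240) * q" using q by (simp add: algebra_simps)
      finally show ?thesis by simp
    next
      case False
      have "ones_free_prob k n \<le> 1" using n by (rule ones_free_prob_le_1)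
      moreover have "1 + (- real n * q) \<le> exp (- real n * q)" by (rule exp_ge_add_one_self)
      moreover have "real n * q \<le> real (2 * k + 2) * q" using False q by (intro mult_right_mono) auto
      moreover have "real (2 * k + 2) * q \<le> (4 * real k + 240) * q" using q by (intro mult_right_mono) auto
      ultimately show ?thesis by simp
    qed
  qed
  ultimately show ?thesis unfolding eq by (simp add: q_def abs_le_iff)
qed


section \<open>Fourier coefficients and the Fejer kernel\<close>

lemma borel_measurable_cis [measurable]: "cis \<in> borel_measurable borel"
  by (intro borel_measurable_continuous_onI continuous_intros)

text \<open>
  This is \<open>sin\<^sup>2 (pi * N * t) / (N * sin\<^sup>2 (pi * t))\<close>; the squared modulus avoids the removable
  singularities at the integers and shows positivity.
\<close>

definition fejer :: "nat \<Rightarrow> real \<Rightarrow> real" where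
  "fejer N t = (1 / real N) * (norm (\<Sum>j<N. cis (2 * pi * real j * t)))\<^sup>2"

lemma norm_sum_cis_sq:
  "(norm (\<Sum>j<N. cis (real j * t)))\<^sup>2 = real N + 2 * (\<Sum>m=1..<N. real (N - m) * cos (real m * t))"
proof (induction N)
  case (Suc N)
  let ?S = "\<Sum>j<N. cis (real j * t)"
  have "(norm (?S + cis (real N * t)))\<^sup>2 = (norm ?S)\<^sup>2 + 1 + 2 * Re (cis (real N * t) * cnj ?S)"
  proof -
    have "(norm (?S + cis (real N * t)))\<^sup>2
        = (norm ?S)\<^sup>2 + (norm (cis (real N * t)))\<^sup>2 + 2 * Re (cis (real N * t) * cnj ?S)"
    proof -
      have "(norm (s + u))\<^sup>2 = (norm s)\<^sup>2 + (norm u)\<^sup>2 + 2 * Re (u * cnj s)" for s u :: complex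
        unfolding cmod_power2 by (simp add: power2_eq_square algebra_simps)
      then show ?thesis .
    qed
    then show ?thesis by simp
  qed
  also have "Re (cis (real N * t) * cnj ?S) = (\<Sum>j<N. cos (real (N - j) * t))"
    by (simp add: sum_distrib_left cis_cnj cis_mult of_nat_diff algebra_simps)
  also have "(\<Sum>j<N. cos (real (N - j) * t)) = (\<Sum>m=1..<Suc N. cos (real m * t))"
    by (rule sum.reindex_bij_witness[of _ "\<lambda>m. N - m" "\<lambda>j. N - j"]) auto
  finally have "(norm (?S + cis (real N * t)))\<^sup>2
      = (norm ?S)\<^sup>2 + 1 + 2 * (\<Sum>m=1..<Suc N. cos (real m * t))" .
  moreover have "(\<Sum>m=1..<Suc N. real (Suc N - m) * cos (real m * t))
     = (\<Sum>m=1..<N. real (N - m) * cos (real m * t)) + (\<Sum>m=1..<Suc N. cos (real m * t))"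
  proof -
    have "(\<Sum>m=1..<N. real (N - m) * cos (real m * t)) = (\<Sum>m=1..<Suc N. real (N - m) * cos (real m * t))"
      by (cases N) auto
    then show ?thesis
      by (simp only: sum.distrib[symmetric]) (auto intro!: sum.cong simp: of_nat_diff algebra_simps)
  qed
  ultimately show ?case using Suc by (simp add: algebra_simps)
qed simp

lemma fejer_eq:
  assumes "0 < N"
  shows "fejer N t = 1 + 2 * (\<Sum>m=1..<N. (1 - real m / real N) * cos (2 * pi * real m * t))"
proof -
  have "fejer N t = (1 / real N) * (norm (\<Sum>j<N. cis (real j * (2 * pi * t))))\<^sup>2"
    by (simp add: fejer_def mult_ac)
  also have "\<dots> = (1 / real N) * (real N + 2 * (\<Sum>m=1..<N. real (N - m) * cos (real m * (2 * pi * t))))"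
    by (simp only: norm_sum_cis_sq)
  also have "\<dots> = 1 + 2 * (\<Sum>m=1..<N. real (N - m) / real N * cos (2 * pi * real m * t))"
    using assms by (simp add: distrib_left sum_distrib_left mult_ac)
  also have "(\<Sum>m=1..<N. real (N - m) / real N * cos (2 * pi * real m * t))
      = (\<Sum>m=1..<N. (1 - real m / real N) * cos (2 * pi * real m * t))"
    using assms by (intro sum.cong refl) (auto simp: of_nat_diff diff_divide_distrib)
  finally show ?thesis .
qed

lemma fejer_nonneg: "0 \<le> fejer N t"
  by (simp add: fejer_def)

text \<open>
  Away from the integers the geometric sum stays bounded, so the kernel tends to 0 like \<open>1 / N\<close>. The
  distance from the integers is measured by the cosine.
\<close>

lemma fejer_le:
  assumes "0 < N" "cos (2 * pi * t) \<le> c" "c < 1"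
  shows "fejer N t \<le> 2 / (real N * (1 - c))"
proof -
  let ?z = "cis (2 * pi * t)"
  have z: "(norm (1 - ?z))\<^sup>2 = 2 - 2 * cos (2 * pi * t)"
    using sin_cos_squared_add[of "2 * pi * t"] unfolding cmod_power2
    by (simp only: minus_complex.sel cis.sel one_complex.sel) (simp add: power2_eq_square algebra_simps)
  then have z1: "2 * (1 - c) \<le> (norm (1 - ?z))\<^sup>2" using assms by simp
  have ne: "?z \<noteq> 1" using assms by (auto simp: complex_eq_iff)
  have "(\<Sum>j<N. cis (2 * pi * real j * t)) = (\<Sum>j<N. ?z ^ j)"
    by (intro sum.cong refl) (subst Complex.DeMoivre, rule arg_cong[where f = cis], simp)
  also have "\<dots> = (1 - ?z ^ N) / (1 - ?z)" using ne by (simp add: sum_gp_strict)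
  finally have "norm (\<Sum>j<N. cis (2 * pi * real j * t)) = norm (1 - ?z ^ N) / norm (1 - ?z)"
    by (simp add: norm_divide)
  moreover have "norm (1 - ?z ^ N) \<le> 2"
    by (rule order.trans[OF norm_triangle_ineq4]) (simp add: norm_power)
  ultimately have "norm (\<Sum>j<N. cis (2 * pi * real j * t)) \<le> 2 / norm (1 - ?z)"
    by (simp add: divide_right_mono)
  then have "(norm (\<Sum>j<N. cis (2 * pi * real j * t)))\<^sup>2 \<le> (2 / norm (1 - ?z))\<^sup>2"
    by (intro power_mono) auto
  also have "\<dots> = 4 / (norm (1 - ?z))\<^sup>2" by (simp add: power_divide)
  also have "\<dots> \<le> 4 / (2 * (1 - c))" using z1 assms by (intro divide_left_mono) (auto intro!: mult_pos_pos)
  finally have "fejer N t \<le> (1 / real N) * (4 / (2 * (1 - c)))"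
    unfolding fejer_def by (intro mult_left_mono) auto
  then show ?thesis using assms by (simp add: field_simps)
qed

definition unit_measure :: "real measure" where
  "unit_measure = restrict_space lborel {0..1}"

lemma space_unit_measure [simp]: "space unit_measure = {0..1}"
  by (simp add: unit_measure_def space_restrict_space)

lemma borel_measurable_unit_measure:
  "f \<in> borel_measurable borel \<Longrightarrow> f \<in> borel_measurable unit_measure"
  by (simp add: unit_measure_def measurable_restrict_space1)

interpretation unit: prob_space unit_measure
  by (rule prob_spaceI) (simp add: unit_measure_def emeasure_restrict_space space_restrict_space)

lemma unit_integral_FTC:
  fixes f F :: "real \<Rightarrow> 'a::euclidean_space"
  assumes "0 \<le> a" "a \<le> b" "b \<le> 1"
    and "\<And>y. a \<le> y \<Longrightarrow> y \<le> b \<Longrightarrow> (F has_vector_derivative f y) (at y within {a..b})"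
    and "continuous_on {a..b} f"
  shows "has_bochner_integral unit_measure (\<lambda>y. indicator {a..b} y *\<^sub>R f y) (F b - F a)"
proof -
  have "has_bochner_integral lborel (\<lambda>y. indicator {a..b} y *\<^sub>R f y) (F b - F a)"
    using assms by (intro has_bochner_integral_FTC_Icc)
  moreover have "(\<lambda>y. indicator {0..1} y *\<^sub>R (indicator {a..b} y *\<^sub>R f y))
      = (\<lambda>y. indicator {a..b} y *\<^sub>R f y)"
    using assms by (auto simp: indicator_def)
  ultimately show ?thesis
    unfolding unit_measure_def
    by (subst has_bochner_integral_restrict_space) (simp_all only: space_lborel, simp_all)
qed

lemma unit_integral_cos:
  assumes "0 < m"
  shows "(\<integral>y. cos (2 * pi * real m * (x - y)) \<partial>unit_measure) = 0"
proof -
  let ?F = "\<lambda>y. - sin (2 * pi * real m * (x - y)) / (2 * pi * real m)"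
  have "has_bochner_integral unit_measure (\<lambda>y. indicator {0..1} y *\<^sub>R cos (2 * pi * real m * (x - y))) (?F 1 - ?F 0)"
    by (rule unit_integral_FTC)
       (use assms in \<open>auto intro!: derivative_eq_intros continuous_intros
          simp: has_real_derivative_iff_has_vector_derivative[symmetric]\<close>)
  moreover have "sin (2 * pi * real m * (x - 1)) = sin (2 * pi * real m * x)"
  proof -
    have "sin (2 * pi * real m * (x - 1)) = sin (2 * pi * real m * x - 2 * real m * pi)"
      by (simp add: algebra_simps)
    also have "\<dots> = sin (2 * pi * real m * x)" by (simp only: sin_diff sin_2npi cos_2npi)
    finally show ?thesis .
  qed
  ultimately have "(\<integral>y. indicator {0..1} y *\<^sub>R cos (2 * pi * real m * (x - y)) \<partial>unit_measure) = 0"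
    by (simp add: has_bochner_integral_integral_eq)
  moreover have "(\<integral>y. indicator {0..1} y *\<^sub>R cos (2 * pi * real m * (x - y)) \<partial>unit_measure)
     = (\<integral>y. cos (2 * pi * real m * (x - y)) \<partial>unit_measure)"
    by (rule Bochner_Integration.integral_cong) auto
  ultimately show ?thesis by simp
qed

text \<open>
  Convolution with the Fejer kernel damps every Fourier coefficient by a factor at most 1 and leaves the mean
  unchanged, so every Fejer mean differs from the mean by at most \<open>2 * A\<close>, the factor 2 standing for
  \<open>m\<close> and \<open>- m\<close>. As the kernel is nonnegative with total mass 1 and concentrates at the integers, the Fejer
  means converge to the function. For \<open>x\<close> inside the unit interval the only integer that
  \<open>x - y\<close> comes close to is 0, so continuity at \<open>x\<close> controls the limit.
\<close>

lemma abs_diff_mean_le_interior: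
  fixes \<phi> :: "real \<Rightarrow> real"
  assumes cont: "continuous_on UNIV \<phi>" and x: "0 < x" "x < 1"
    and coeff: "\<And>m. 0 < m \<Longrightarrow>
       norm (\<integral>y. of_real (\<phi> y) * cis (- (2 * pi * real m * y)) \<partial>unit_measure) \<le> b m"
    and b: "\<And>N. (\<Sum>m=1..<N. b m) \<le> A"
  shows "\<bar>\<phi> x - (\<integral>y. \<phi> y \<partial>unit_measure)\<bar> \<le> 2 * A"
proof (rule field_le_epsilon)
  fix e :: real assume e: "0 < e"
  have meas [measurable]: "\<phi> \<in> borel_measurable borel"
    using cont by (rule borel_measurable_continuous_onI)
  note bm = borel_measurable_unit_measure
  have "bounded (\<phi> ` {0..1})"
    using cont by (intro compact_imp_bounded compact_continuous_image) (auto intro: continuous_on_subset)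
  then obtain B0 where B0: "\<And>y. y \<in> {0..1} \<Longrightarrow> \<bar>\<phi> y\<bar> \<le> B0"
    unfolding bounded_iff by fastforce
  define B where "B = \<bar>B0\<bar> + 1"
  have B: "0 < B" "\<And>y. y \<in> {0..1} \<Longrightarrow> \<bar>\<phi> y\<bar> \<le> B" using B0 by (force simp: B_def)+
  have int: "integrable unit_measure (\<lambda>y. \<phi> y * g y)"
    if "g \<in> borel_measurable borel" "\<And>y. \<bar>g y\<bar> \<le> C" for g C
  proof (rule unit.integrable_const_bound[of _ "B * C"])
    show "AE y in unit_measure. norm (\<phi> y * g y) \<le> B * C"
    proof (rule AE_I2)
      fix y assume "y \<in> space unit_measure"
      then have "\<bar>\<phi> y\<bar> \<le> B" using B by simp
      then show "norm (\<phi> y * g y) \<le> B * C"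
        using that(2)[of y] B by (simp add: abs_mult mult_mono)
    qed
    show "(\<lambda>y. \<phi> y * g y) \<in> borel_measurable unit_measure"
      using that by (intro bm) auto
  qed
  have Fbound: "\<bar>fejer N t\<bar> \<le> real N" for N t
  proof -
    have "norm (\<Sum>j<N. cis (2 * pi * real j * t)) \<le> real N"
      by (rule order.trans[OF norm_sum]) simp
    then have "(norm (\<Sum>j<N. cis (2 * pi * real j * t)))\<^sup>2 \<le> (real N)\<^sup>2" by (intro power_mono) auto
    then have "(1 / real N) * (norm (\<Sum>j<N. cis (2 * pi * real j * t)))\<^sup>2 \<le> (1 / real N) * (real N)\<^sup>2"
      by (intro mult_left_mono) auto
    also have "\<dots> = real N" by (cases "N = 0") (simp_all add: power2_eq_square)
    finally show ?thesis using fejer_nonneg[of N t] by (simp add: fejer_def)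
  qed
  have [measurable]: "fejer N \<in> borel_measurable borel" for N
    unfolding fejer_def by (intro borel_measurable_continuous_onI continuous_intros) 
  have intF: "integrable unit_measure (\<lambda>y. fejer N (x - y))" for N
    by (rule unit.integrable_const_bound[of _ "real N"]) (auto intro!: bm AE_I2 simp: Fbound)
  have intFp: "integrable unit_measure (\<lambda>y. \<phi> y * fejer N (x - y))" for N
    by (rule int[of _ "real N"]) (auto simp: Fbound)
  have intc: "integrable unit_measure (\<lambda>y. \<phi> y * cos (2 * pi * real m * (x - y)))" for m
    by (rule int[of _ 1]) auto
  have intp: "integrable unit_measure \<phi>"
    using int[of "\<lambda>_. 1" 1] by simp
  define mean where "mean = (\<integral>y. \<phi> y \<partial>unit_measure)"
  have coeff': "\<bar>\<integral>y. \<phi> y * cos (2 * pi * real m * (x - y)) \<partial>unit_measure\<bar> \<le> b m" if "0 < m" for m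
  proof -
    have "integrable unit_measure (\<lambda>y. of_real (\<phi> y) * cis (- (2 * pi * real m * y)))"
      by (rule Bochner_Integration.integrable_bound[OF intp]) (auto intro!: bm simp: norm_mult)
    then have "(\<integral>y. Re (cis (2 * pi * real m * x) * (of_real (\<phi> y) * cis (- (2 * pi * real m * y)))) \<partial>unit_measure)
       = Re (cis (2 * pi * real m * x) * (\<integral>y. of_real (\<phi> y) * cis (- (2 * pi * real m * y)) \<partial>unit_measure))"
      by (subst integral_Re) (auto intro: integrable_mult_right)
    also have "(\<lambda>y. Re (cis (2 * pi * real m * x) * (of_real (\<phi> y) * cis (- (2 * pi * real m * y)))))
        = (\<lambda>y. \<phi> y * cos (2 * pi * real m * (x - y)))"
      by (simp add: fun_eq_iff right_diff_distrib cos_diff algebra_simps)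
    finally have "\<bar>\<integral>y. \<phi> y * cos (2 * pi * real m * (x - y)) \<partial>unit_measure\<bar>
       \<le> norm (cis (2 * pi * real m * x) * (\<integral>y. of_real (\<phi> y) * cis (- (2 * pi * real m * y)) \<partial>unit_measure))"
      by (simp only: abs_Re_le_cmod)
    also have "\<dots> \<le> b m" using coeff[OF that] by (simp add: norm_mult)
    finally show ?thesis .
  qed
  have smooth: "\<bar>(\<integral>y. \<phi> y * fejer N (x - y) \<partial>unit_measure) - mean\<bar> \<le> 2 * A" if N: "0 < N" for N
  proof -
    have "(\<integral>y. \<phi> y * fejer N (x - y) \<partial>unit_measure) =
        (\<integral>y. \<phi> y + 2 * (\<Sum>m=1..<N. (1 - real m / real N) * (\<phi> y * cos (2 * pi * real m * (x - y)))) \<partial>unit_measure)"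
      by (rule Bochner_Integration.integral_cong)
         (simp_all add: fejer_eq[OF N] distrib_left sum_distrib_left mult_ac)
    also have "\<dots> = mean + 2 * (\<Sum>m=1..<N. (1 - real m / real N) * (\<integral>y. \<phi> y * cos (2 * pi * real m * (x - y)) \<partial>unit_measure))"
      unfolding mean_def using intp intc
      by (subst Bochner_Integration.integral_add)
         (auto simp: Bochner_Integration.integral_sum
            intro!: Bochner_Integration.integrable_sum integrable_mult_right)
    finally have "\<bar>(\<integral>y. \<phi> y * fejer N (x - y) \<partial>unit_measure) - mean\<bar>
       = 2 * \<bar>\<Sum>m=1..<N. (1 - real m / real N) * (\<integral>y. \<phi> y * cos (2 * pi * real m * (x - y)) \<partial>unit_measure)\<bar>"
      by (simp add: abs_mult)
    also have "\<dots> \<le> 2 * (\<Sum>m=1..<N. \<bar>(1 - real m / real N) * (\<integral>y. \<phi> y * cos (2 * pi * real m * (x - y)) \<partial>unit_measure)\<bar>)"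
      by (intro mult_left_mono sum_abs) auto
    also have "\<dots> \<le> 2 * (\<Sum>m=1..<N. b m)"
    proof (intro mult_left_mono sum_mono)
      fix m assume m: "m \<in> {1..<N}"
      then have "\<bar>1 - real m / real N\<bar> \<le> 1" by (simp add: field_simps)
      then have "\<bar>1 - real m / real N\<bar> * \<bar>\<integral>y. \<phi> y * cos (2 * pi * real m * (x - y)) \<partial>unit_measure\<bar> \<le> 1 * b m"
        using coeff'[of m] m by (intro mult_mono) auto
      then show "\<bar>(1 - real m / real N) * (\<integral>y. \<phi> y * cos (2 * pi * real m * (x - y)) \<partial>unit_measure)\<bar> \<le> b m"
        by (simp add: abs_mult)
    qed auto
    also have "\<dots> \<le> 2 * A" using b[of N] by simp
    finally show ?thesis .
  qed
  have "isCont \<phi> x" using cont by (simp add: continuous_on_eq_continuous_at)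
  then have "\<forall>\<epsilon>>0. \<exists>\<delta>>0. \<forall>y. \<bar>y - x\<bar> < \<delta> \<longrightarrow> \<bar>\<phi> y - \<phi> x\<bar> < \<epsilon>"
    unfolding continuous_at_eps_delta dist_real_def by simp
  moreover have "0 < e / 2" using e by simp
  ultimately obtain d0 where d0: "0 < d0" "\<And>y. \<bar>y - x\<bar> < d0 \<Longrightarrow> \<bar>\<phi> y - \<phi> x\<bar> < e / 2"
    by blast
  define d where "d = min (min d0 x) (min (1 - x) (1 / 2))"
  have d: "0 < d" "d \<le> d0" "d \<le> x" "d \<le> 1 - x" "d \<le> 1 / 2" using d0(1) x unfolding d_def by linarith+
  define c where "c = cos (2 * pi * d)"
  have "cos (2 * pi * d) < cos 0"
    using d pi_gt_zero by (intro cos_monotone_0_pi) (auto intro!: mult_pos_pos simp: field_simps)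
  then have c: "c < 1" by (simp add: c_def)
  obtain N where N: "0 < N" "8 * B / ((1 - c) * e) < real N"
  proof -
    obtain M where "8 * B / ((1 - c) * e) < real M" using reals_Archimedean2 by blast
    then show ?thesis by (intro that[of "Suc M"]) auto
  qed
  have far: "fejer N (x - y) \<le> 2 / (real N * (1 - c))" if "y \<in> {0..1}" "d \<le> \<bar>x - y\<bar>" for y
  proof (rule fejer_le[OF N(1) _ c])
    have le: "\<bar>x - y\<bar> \<le> 1 - d" using that d by auto
    have ev: "cos (2 * pi * (x - y)) = cos (2 * pi * \<bar>x - y\<bar>)"
    proof -
      have "2 * pi * \<bar>x - y\<bar> = \<bar>2 * pi * (x - y)\<bar>" by (simp add: abs_mult)
      then show ?thesis by simp
    qed
    show "cos (2 * pi * (x - y)) \<le> c"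
    proof (cases "\<bar>x - y\<bar> \<le> 1 / 2")
      case True
      then show ?thesis unfolding ev c_def
        using that d pi_gt_zero by (intro cos_monotone_0_pi_le) (auto simp: field_simps)
    next
      case False
      have "cos (2 * pi * \<bar>x - y\<bar>) = cos (2 * pi * (1 - \<bar>x - y\<bar>))"
        by (simp add: right_diff_distrib cos_diff)
      also have "\<dots> \<le> c" unfolding c_def
      proof (rule cos_monotone_0_pi_le)
        show "2 * pi * d \<le> 2 * pi * (1 - \<bar>x - y\<bar>)" using le by (intro mult_left_mono) auto
        have "2 * pi * (1 - \<bar>x - y\<bar>) \<le> 2 * pi * (1 / 2)" using False by (intro mult_left_mono) auto
        then show "2 * pi * (1 - \<bar>x - y\<bar>) \<le> pi" by simp
      qed (use d in auto)
      finally show ?thesis unfolding ev .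
    qed
  qed
  have mass: "(\<integral>y. fejer N (x - y) \<partial>unit_measure) = 1"
  proof -
    have ic: "integrable unit_measure (\<lambda>y. cos (2 * pi * real m * (x - y)))" for m
      by (rule unit.integrable_const_bound[of _ 1]) (auto intro!: bm AE_I2)
    have "(\<integral>y. fejer N (x - y) \<partial>unit_measure) = 1 + 2 * (\<Sum>m=1..<N. (1 - real m / real N) *
        (\<integral>y. cos (2 * pi * real m * (x - y)) \<partial>unit_measure))"
      unfolding fejer_eq[OF N(1)] using ic
      by (subst Bochner_Integration.integral_add)
         (auto simp: Bochner_Integration.integral_sum unit.prob_space[simplified]
            intro!: Bochner_Integration.integrable_sum integrable_mult_right)
    also have "\<dots> = 1" by (simp add: unit_integral_cos)
    finally show ?thesis .
  qed
  have "\<phi> x - (\<integral>y. \<phi> y * fejer N (x - y) \<partial>unit_measure)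
      = (\<integral>y. \<phi> x * fejer N (x - y) - \<phi> y * fejer N (x - y) \<partial>unit_measure)"
    using intF intFp by (subst Bochner_Integration.integral_diff) (auto simp: mass)
  then have "\<bar>\<phi> x - (\<integral>y. \<phi> y * fejer N (x - y) \<partial>unit_measure)\<bar>
      \<le> (\<integral>y. \<bar>\<phi> x * fejer N (x - y) - \<phi> y * fejer N (x - y)\<bar> \<partial>unit_measure)"
    by (simp only: integral_abs_bound)
  also have "\<dots> \<le> (\<integral>y. e / 2 * fejer N (x - y) + 2 * B * (2 / (real N * (1 - c))) \<partial>unit_measure)"
  proof (rule integral_mono)
    show "integrable unit_measure (\<lambda>y. \<bar>\<phi> x * fejer N (x - y) - \<phi> y * fejer N (x - y)\<bar>)"
      using intF intFp by (intro integrable_abs Bochner_Integration.integrable_diff integrable_mult_right)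
    show "integrable unit_measure (\<lambda>y. e / 2 * fejer N (x - y) + 2 * B * (2 / (real N * (1 - c))))"
      using intF by (intro Bochner_Integration.integrable_add integrable_mult_right) auto
    fix y assume "y \<in> space unit_measure"
    then have y: "y \<in> {0..1}" by simp
    have eq: "\<bar>\<phi> x * fejer N (x - y) - \<phi> y * fejer N (x - y)\<bar> = \<bar>\<phi> y - \<phi> x\<bar> * fejer N (x - y)"
      using fejer_nonneg[of N "x - y"] by (simp add: left_diff_distrib[symmetric] abs_mult abs_minus_commute)
    have nn: "0 \<le> 2 * B * (2 / (real N * (1 - c)))" "0 \<le> e / 2 * fejer N (x - y)"
      using B c e fejer_nonneg[of N "x - y"] by auto
    show "\<bar>\<phi> x * fejer N (x - y) - \<phi> y * fejer N (x - y)\<bar>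
        \<le> e / 2 * fejer N (x - y) + 2 * B * (2 / (real N * (1 - c)))"
    proof (cases "\<bar>x - y\<bar> < d")
      case True
      then have "\<bar>\<phi> y - \<phi> x\<bar> \<le> e / 2" using d0(2)[of y] d by (simp add: abs_minus_commute)
      then have "\<bar>\<phi> y - \<phi> x\<bar> * fejer N (x - y) \<le> e / 2 * fejer N (x - y)"
        using fejer_nonneg by (intro mult_right_mono)
      then show ?thesis using nn unfolding eq by simp
    next
      case False
      have "\<bar>\<phi> y - \<phi> x\<bar> \<le> 2 * B" using B(2)[OF y] B(2)[of x] x by auto
      then have "\<bar>\<phi> y - \<phi> x\<bar> * fejer N (x - y) \<le> 2 * B * (2 / (real N * (1 - c)))"
        using far[OF y] False fejer_nonneg B by (intro mult_mono) auto
      then show ?thesis using nn unfolding eq by simp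
    qed
  qed
  also have "\<dots> = e / 2 + 2 * B * (2 / (real N * (1 - c)))"
    using intF by (subst Bochner_Integration.integral_add) (auto simp: mass unit.prob_space[simplified])
  also have "\<dots> \<le> e"
    using N c e B by (simp add: field_simps)
  finally show "\<bar>\<phi> x - (\<integral>y. \<phi> y \<partial>unit_measure)\<bar> \<le> 2 * A + e"
    using smooth[OF N(1)] unfolding mean_def by linarith
qed


section \<open>Logarithmic moments of the exponential law\<close>

definition exp1 :: "real measure" where
  "exp1 = density lborel (exponential_density 1)"

interpretation exp1: prob_space exp1
  unfolding exp1_def by (rule prob_space_exponential_density) simp

lemma sets_exp1 [measurable_cong, simp]: "sets exp1 = sets borel"
  by (simp add: exp1_def)

lemma space_exp1 [simp]: "space exp1 = UNIV"
  by (simp add: exp1_def)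

lemma AE_exp1_pos: "AE v in exp1. 0 < v"
proof -
  have "AE v in lborel. v \<noteq> (0::real)" by (rule AE_lborel_singleton)
  then show ?thesis unfolding exp1_def
    by (subst AE_density) (auto simp: exponential_density_def)
qed

text \<open>
  The Euler integral of the Gamma function, read as an expectation: \<open>v powr (z - 1)\<close> is written as an
  exponential of \<open>ln v\<close>, in which form it can be differentiated in \<open>z\<close>.
\<close>

lemma exp1_integral_ln_exp:
  assumes "0 < Re z"
  shows "integrable exp1 (\<lambda>v. exp ((z - 1) * of_real (ln v)))"
    and "(\<integral>v. exp ((z - 1) * of_real (ln v)) \<partial>exp1) = Gamma z"
proof -
  let ?f = "\<lambda>t. of_real t powr (z - 1) / of_real (exp t) :: complex"
  let ?g = "\<lambda>v. exp ((z - 1) * of_real (ln v)) :: complex"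
  have eq: "exponential_density 1 v *\<^sub>R ?g v = indicator {0<..} v *\<^sub>R ?f v" if "v \<noteq> 0" for v
    using that by (auto simp: exponential_density_def indicator_def powr_def Ln_of_real
      exp_minus scaleR_conv_of_real exp_of_real[symmetric] field_simps)
  have ae: "AE v in lborel. exponential_density 1 v *\<^sub>R ?g v = indicator {0<..} v *\<^sub>R ?f v"
    using AE_lborel_singleton[of 0] by eventually_elim (rule eq)
  have meas [measurable]: "(\<lambda>v. indicator {0<..} v *\<^sub>R ?f v) \<in> borel_measurable borel"
  proof -
    have "(\<lambda>v. indicator {0<..} v *\<^sub>R ?f v) = (\<lambda>v. indicator {0<..} v *\<^sub>R (?g v / of_real (exp v)))"
      by (auto simp: fun_eq_iff indicator_def powr_def Ln_of_real)
    also have "\<dots> \<in> borel_measurable borel" by measurable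
    finally show ?thesis .
  qed
  have abs: "set_integrable lebesgue {0<..} ?f"
    using absolutely_integrable_Gamma_integral'[OF assms] .
  then have int: "integrable lborel (\<lambda>v. indicator {0<..} v *\<^sub>R ?f v)"
    unfolding set_integrable_def by (subst (asm) integrable_completion) auto
  have "(\<integral>v. indicator {0<..} v *\<^sub>R ?f v \<partial>lborel) = (LINT v:{0<..}|lebesgue. ?f v)"
    unfolding set_lebesgue_integral_def by (subst integral_completion) auto
  also have "\<dots> = integral {0<..} ?f"
    using abs by (rule set_lebesgue_integral_eq_integral)
  also have "\<dots> = Gamma z"
    using Gamma_integral_complex'[OF assms] by (rule integral_unique)
  finally have val: "(\<integral>v. indicator {0<..} v *\<^sub>R ?f v \<partial>lborel) = Gamma z" .
  have int': "integrable lborel (\<lambda>v. exponential_density 1 v *\<^sub>R ?g v)"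
    using int by (subst integrable_cong_AE[OF _ _ ae]) auto
  show "integrable exp1 ?g"
    unfolding exp1_def using int' by (subst integrable_density) (auto simp: exponential_density_nonneg)
  have "(\<integral>v. ?g v \<partial>exp1) = (\<integral>v. exponential_density 1 v *\<^sub>R ?g v \<partial>lborel)"
    unfolding exp1_def by (subst integral_density) (auto simp: exponential_density_nonneg)
  also have "\<dots> = (\<integral>v. indicator {0<..} v *\<^sub>R ?f v \<partial>lborel)"
    using ae by (intro integral_cong_AE) auto
  finally show "(\<integral>v. ?g v \<partial>exp1) = Gamma z" using val by simp
qed

lemma power_le_exp:
  assumes "0 < e" "0 \<le> (x::real)" "0 < j"
  shows "x ^ j \<le> (real j / e) ^ j * exp (e * x)"
proof -
  have "0 \<le> e * x / real j" using assms by simp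
  moreover have "e * x / real j \<le> exp (e * x / real j)"
    using exp_ge_add_one_self[of "e * x / real j"] by linarith
  ultimately have "(e * x / real j) ^ j \<le> exp (e * x / real j) ^ j"
    by (intro power_mono)
  also have "\<dots> = exp (e * x)" using assms by (simp add: exp_of_nat_mult[symmetric])
  finally have "(real j / e) ^ j * (e * x / real j) ^ j \<le> (real j / e) ^ j * exp (e * x)"
    using assms by (intro mult_left_mono) auto
  moreover have "(real j / e) ^ j * (e * x / real j) ^ j = x ^ j"
    using assms by (simp add: power_mult_distrib[symmetric])
  ultimately show ?thesis by simp
qed

text \<open>
  Powers of the logarithm cost only an arbitrarily small exponent: \<open>\<bar>ln v\<bar> ^ j\<close> is at most a constant times
  \<open>exp (d * \<bar>ln v\<bar>)\<close>, and the assumption leaves room for some \<open>d > 0\<close>.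
\<close>

lemma integrable_exp1_ln_moment:
  assumes "0 \<le> e" "e < 1 + s"
  shows "integrable exp1 (\<lambda>v. \<bar>ln v\<bar> ^ j * exp (s * ln v + e * \<bar>ln v\<bar>))"
proof -
  define d where "d = (1 + s - e) / 2"
  have d: "0 < d" "e + d < 1 + s" using assms by (simp_all add: d_def field_simps)
  define C where "C = (if j = 0 then 1 else (real j / d) ^ j)"
  have C: "\<bar>x\<bar> ^ j \<le> C * exp (d * \<bar>x\<bar>)" for x :: real
    using power_le_exp[of d "\<bar>x\<bar>" j] d by (auto simp: C_def)
  have C0: "0 \<le> C" using d by (simp add: C_def)
  have base: "integrable exp1 (\<lambda>v. exp (r * ln v))" if "-1 < r" for r :: real
  proof -
    have "integrable exp1 (\<lambda>v. norm (exp ((of_real (r + 1) - 1) * of_real (ln v)) :: complex))"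
      using that by (intro integrable_norm exp1_integral_ln_exp) simp
    then show ?thesis by simp
  qed
  have "integrable exp1 (\<lambda>v. C * (exp ((s + (e + d)) * ln v) + exp ((s - (e + d)) * ln v)))"
    using assms d by (intro integrable_mult_right Bochner_Integration.integrable_add base) auto
  then show ?thesis
  proof (rule Bochner_Integration.integrable_bound)
    show "AE v in exp1. norm (\<bar>ln v\<bar> ^ j * exp (s * ln v + e * \<bar>ln v\<bar>))
      \<le> norm (C * (exp ((s + (e + d)) * ln v) + exp ((s - (e + d)) * ln v)))"
    proof (rule AE_I2)
      fix v :: real
      have "\<bar>ln v\<bar> ^ j * exp (s * ln v + e * \<bar>ln v\<bar>)
          \<le> C * exp (d * \<bar>ln v\<bar>) * exp (s * ln v + e * \<bar>ln v\<bar>)"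
        by (intro mult_right_mono C) auto
      also have "\<dots> = C * exp (s * ln v + (e + d) * \<bar>ln v\<bar>)"
        by (simp add: exp_add algebra_simps)
      also have "exp (s * ln v + (e + d) * \<bar>ln v\<bar>) \<le> exp ((s + (e + d)) * ln v) + exp ((s - (e + d)) * ln v)"
        by (cases "0 \<le> ln v") (simp_all add: algebra_simps)
      finally have "\<bar>ln v\<bar> ^ j * exp (s * ln v + e * \<bar>ln v\<bar>)
        \<le> C * (exp ((s + (e + d)) * ln v) + exp ((s - (e + d)) * ln v))"
        using C0 by (simp add: mult_left_mono)
      then show "norm (\<bar>ln v\<bar> ^ j * exp (s * ln v + e * \<bar>ln v\<bar>))
        \<le> norm (C * (exp ((s + (e + d)) * ln v) + exp ((s - (e + d)) * ln v)))"
        using C0 by simp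
    qed
  qed measurable
qed

lemma integrable_exp1_ln_power_exp:
  assumes "-1 < Re s"
  shows "integrable exp1 (\<lambda>v. of_real (ln v) ^ j * exp (s * of_real (ln v)) :: complex)"
  using integrable_exp1_ln_moment[of 0 "Re s" j] assms
  by (intro Bochner_Integration.integrable_bound[OF integrable_exp1_ln_moment[of 0 "Re s" j]])
     (auto simp: norm_mult norm_power)

text \<open>
  Differentiation under the integral sign. The Taylor remainder of the exponential is quadratic in
  the increment \<open>h\<close>, with an integrable coefficient as long as \<open>\<bar>h\<bar> < e\<close>; here \<open>e\<close> is half the
  distance from the line where integrability ends.
\<close>

lemma exp1_ln_power_integral_deriv:
  assumes s: "-1 < Re s"
  shows "((\<lambda>s. \<integral>v. of_real (ln v) ^ j * exp (s * of_real (ln v)) \<partial>exp1) has_field_derivative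
      (\<integral>v. of_real (ln v) ^ Suc j * exp (s * of_real (ln v)) \<partial>exp1)) (at (s::complex))"
proof -
  define e where "e = (1 + Re s) / 2"
  have e: "0 < e" "e < 1 + Re s" using s by (simp_all add: e_def field_simps)
  let ?I = "\<lambda>j s. \<integral>v. of_real (ln v) ^ j * exp (s * of_real (ln v)) \<partial>exp1"
  define C where "C = (\<integral>v. \<bar>ln v\<bar> ^ (j + 2) * exp (Re s * ln v + e * \<bar>ln v\<bar>) \<partial>exp1)"
  have bound: "norm (?I j (s + h) - ?I j s - h * ?I (Suc j) s) \<le> (norm h)\<^sup>2 * C" if h: "norm h < e" for h
  proof -
    have "\<bar>Re h\<bar> \<le> norm h" by (rule abs_Re_le_cmod)
    then have sh: "-1 < Re (s + h)" using h e by auto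
    note int = integrable_exp1_ln_power_exp
    have "?I j (s + h) - ?I j s - h * ?I (Suc j) s =
      (\<integral>v. of_real (ln v) ^ j * exp ((s + h) * of_real (ln v)) - of_real (ln v) ^ j * exp (s * of_real (ln v))
        - h * (of_real (ln v) ^ Suc j * exp (s * of_real (ln v))) \<partial>exp1)"
      using int[OF s] int[OF sh]
      by (subst Bochner_Integration.integral_diff, (intro Bochner_Integration.integrable_diff integrable_mult_right; blast)+)
         (subst Bochner_Integration.integral_diff, simp_all del: power_Suc)
    also have "norm \<dots> \<le> (\<integral>v. (norm h)\<^sup>2 * (\<bar>ln v\<bar> ^ (j + 2) * exp (Re s * ln v + e * \<bar>ln v\<bar>)) \<partial>exp1)"
    proof (rule order.trans[OF integral_norm_bound], rule integral_mono)
      show "integrable exp1 (\<lambda>v. norm (of_real (ln v) ^ j * exp ((s + h) * of_real (ln v)) - of_real (ln v) ^ j * exp (s * of_real (ln v))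
        - h * (of_real (ln v) ^ Suc j * exp (s * of_real (ln v)))))"
        using int[OF s] int[OF sh]
        by (intro integrable_norm Bochner_Integration.integrable_diff integrable_mult_right)
      show "integrable exp1 (\<lambda>v. (norm h)\<^sup>2 * (\<bar>ln v\<bar> ^ (j + 2) * exp (Re s * ln v + e * \<bar>ln v\<bar>)))"
        using e by (intro integrable_mult_right integrable_exp1_ln_moment) auto
      fix v :: real
      let ?w = "ln v"
      have "norm (exp (h * of_real ?w) - 1 - h * of_real ?w) \<le> exp \<bar>Re (h * of_real ?w)\<bar> * (norm (h * of_real ?w))\<^sup>2"
        using Taylor_exp[of "h * of_real ?w" 1] by (simp add: power2_eq_square algebra_simps)
      also have "\<dots> \<le> exp (e * \<bar>?w\<bar>) * (norm h * \<bar>?w\<bar>)\<^sup>2"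
      proof -
        have "\<bar>Re h\<bar> * \<bar>?w\<bar> \<le> e * \<bar>?w\<bar>"
          using abs_Re_le_cmod[of h] h by (intro mult_right_mono) auto
        then show ?thesis by (intro mult_mono) (simp_all add: abs_mult norm_mult)
      qed
      finally have T: "norm (exp (h * of_real ?w) - 1 - h * of_real ?w) \<le> exp (e * \<bar>?w\<bar>) * (norm h * \<bar>?w\<bar>)\<^sup>2" .
      have "of_real ?w ^ j * exp ((s + h) * of_real ?w) - of_real ?w ^ j * exp (s * of_real ?w)
          - h * (of_real ?w ^ Suc j * exp (s * of_real ?w))
        = of_real ?w ^ j * exp (s * of_real ?w) * (exp (h * of_real ?w) - 1 - h * of_real ?w)"
        by (simp add: algebra_simps exp_add)
      then have "norm (of_real ?w ^ j * exp ((s + h) * of_real ?w) - of_real ?w ^ j * exp (s * of_real ?w)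
          - h * (of_real ?w ^ Suc j * exp (s * of_real ?w)))
        = \<bar>?w\<bar> ^ j * exp (Re s * ?w) * norm (exp (h * of_real ?w) - 1 - h * of_real ?w)"
        by (simp only: norm_mult norm_power norm_of_real norm_exp_eq_Re times_complex.sel Re_complex_of_real Im_complex_of_real) simp
      also have "\<dots> \<le> \<bar>?w\<bar> ^ j * exp (Re s * ?w) * (exp (e * \<bar>?w\<bar>) * (norm h * \<bar>?w\<bar>)\<^sup>2)"
        using T by (intro mult_left_mono) auto
      also have "\<dots> = (norm h)\<^sup>2 * (\<bar>?w\<bar> ^ (j + 2) * exp (Re s * ?w + e * \<bar>?w\<bar>))"
        by (simp add: power_mult_distrib power_add exp_add power2_eq_square mult_ac)
      finally show "norm (of_real ?w ^ j * exp ((s + h) * of_real ?w) - of_real ?w ^ j * exp (s * of_real ?w)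
          - h * (of_real ?w ^ Suc j * exp (s * of_real ?w)))
        \<le> (norm h)\<^sup>2 * (\<bar>?w\<bar> ^ (j + 2) * exp (Re s * ?w + e * \<bar>?w\<bar>))" .
    qed
    finally show ?thesis by (simp add: C_def)
  qed
  show ?thesis unfolding DERIV_def
  proof (rule LIM_zero_cancel, rule Lim_null_comparison)
    show "\<forall>\<^sub>F h in at 0. norm ((?I j (s + h) - ?I j s) / h - ?I (Suc j) s) \<le> norm h * C"
    proof -
      have "\<forall>\<^sub>F h in at (0::complex). norm h < e"
        using e(1) by (auto simp: eventually_at dist_norm intro!: exI[of _ e])
      moreover have "\<forall>\<^sub>F h in at (0::complex). h \<noteq> 0" by (auto simp: eventually_at_filter)
      ultimately show ?thesis
      proof eventually_elim
        fix h :: complex assume h: "norm h < e" "h \<noteq> 0"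
        have "norm ((?I j (s + h) - ?I j s) / h - ?I (Suc j) s)
            = norm (?I j (s + h) - ?I j s - h * ?I (Suc j) s) / norm h"
          using h(2) by (simp add: norm_divide[symmetric] diff_divide_distrib)
        also have "\<dots> \<le> (norm h)\<^sup>2 * C / norm h"
          using bound[OF h(1)] by (intro divide_right_mono) auto
        also have "\<dots> = norm h * C" using h(2) by (simp add: power2_eq_square)
        finally show "norm ((?I j (s + h) - ?I j s) / h - ?I (Suc j) s) \<le> norm h * C" .
      qed
    qed
    have "((\<lambda>h::complex. norm h * C) \<longlongrightarrow> norm (0::complex) * C) (at 0)"
      by (intro tendsto_intros)
    then show "((\<lambda>h::complex. norm h * C) \<longlongrightarrow> 0) (at 0)" by simp
  qed
qed

lemma exp1_integral_ln_exp':
  assumes "-1 < Re s"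
  shows "(\<integral>v. exp (s * of_real (ln v)) \<partial>exp1) = Gamma (1 + s)"
  using exp1_integral_ln_exp(2)[of "1 + s"] assms by simp

lemma not_nonpos_Int_1_plus: "-1 < Re s \<Longrightarrow> 1 + s \<notin> \<int>\<^sub>\<le>\<^sub>0"
  by (auto elim!: nonpos_Ints_cases simp: complex_eq_iff)

lemma exp1_integral_ln_mult_exp:
  assumes "-1 < Re s"
  shows "(\<integral>v. of_real (ln v) * exp (s * of_real (ln v)) \<partial>exp1) = Gamma (1 + s) * Digamma (1 + s)"
proof -
  have "((\<lambda>s. Gamma (1 + s)) has_field_derivative Gamma (1 + s) * Digamma (1 + s)) (at s)"
    using not_nonpos_Int_1_plus[OF assms] by (auto intro!: derivative_eq_intros)
  moreover have "\<forall>\<^sub>F u in nhds s. Gamma (1 + u) = (\<integral>v. of_real (ln v) ^ 0 * exp (u * of_real (ln v)) \<partial>exp1)"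
  proof -
    have "\<forall>\<^sub>F u in nhds s. u \<in> {u. -1 < Re u}"
      using assms by (intro eventually_nhds_in_open open_halfspace_Re_gt) auto
    then show ?thesis by eventually_elim (simp add: exp1_integral_ln_exp')
  qed
  ultimately have "((\<lambda>s. \<integral>v. of_real (ln v) ^ 0 * exp (s * of_real (ln v)) \<partial>exp1)
      has_field_derivative Gamma (1 + s) * Digamma (1 + s)) (at s)"
    by (subst (asm) DERIV_cong_ev[OF refl _ refl])
  from DERIV_unique[OF this exp1_ln_power_integral_deriv[OF assms]] show ?thesis by simp
qed

lemma exp1_integral_ln: "(\<integral>v. ln v \<partial>exp1) = - euler_mascheroni"
proof -
  have "complex_of_real (\<integral>v. ln v \<partial>exp1) = - euler_mascheroni"
    using exp1_integral_ln_mult_exp[of 0] by simp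
  also have "\<dots> = complex_of_real (- euler_mascheroni)" by simp
  finally show ?thesis by (simp only: of_real_eq_iff)
qed

lemma Polygamma_1_1: "Polygamma 1 (1::complex) = of_real (pi\<^sup>2 / 6)"
proof -
  have "(\<lambda>k. complex_of_real (1 / (real k + 1)\<^sup>2)) sums complex_of_real (pi\<^sup>2 / 6)"
    unfolding sums_of_real_iff using inverse_squares_sums by (simp add: add.commute)
  moreover have "(\<lambda>k. complex_of_real (1 / (real k + 1)\<^sup>2)) = (\<lambda>k. inverse ((1 + of_nat k) ^ Suc 1))"
    by (simp add: fun_eq_iff power2_eq_square field_simps)
  moreover have "(\<lambda>k. inverse ((1 + of_nat k :: complex) ^ Suc 1)) sums ((-1) ^ Suc 1 * Polygamma 1 1 / fact 1)"
    by (rule Polygamma_LIMSEQ) auto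
  ultimately show ?thesis using sums_unique2 by fastforce
qed

lemma exp1_integral_ln_sq: "(\<integral>v. (ln v)\<^sup>2 \<partial>exp1) = euler_mascheroni\<^sup>2 + pi\<^sup>2 / 6"
proof -
  have "((\<lambda>s. Gamma (1 + s) * Digamma (1 + s)) has_field_derivative
      (euler_mascheroni\<^sup>2 + of_real (pi\<^sup>2 / 6) :: complex)) (at 0)"
    using not_nonpos_Int_1_plus[of 0] Polygamma_1_1
    by (auto intro!: derivative_eq_intros simp: power2_eq_square)
  moreover have "\<forall>\<^sub>F u in nhds (0::complex). Gamma (1 + u) * Digamma (1 + u)
      = (\<integral>v. of_real (ln v) ^ 1 * exp (u * of_real (ln v)) \<partial>exp1)"
  proof -
    have "\<forall>\<^sub>F u in nhds (0::complex). u \<in> {u. -1 < Re u}"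
      by (intro eventually_nhds_in_open open_halfspace_Re_gt) auto
    then show ?thesis by eventually_elim (simp add: exp1_integral_ln_mult_exp)
  qed
  ultimately have "((\<lambda>s. \<integral>v. of_real (ln v) ^ 1 * exp (s * of_real (ln v)) \<partial>exp1)
      has_field_derivative (euler_mascheroni\<^sup>2 + of_real (pi\<^sup>2 / 6) :: complex)) (at 0)"
    by (subst (asm) DERIV_cong_ev[OF refl _ refl])
  from DERIV_unique[OF this exp1_ln_power_integral_deriv]
  have "(\<integral>v. complex_of_real ((ln v)\<^sup>2) \<partial>exp1) = of_real (euler_mascheroni\<^sup>2 + pi\<^sup>2 / 6)"
    by (simp add: power2_eq_square)
  then show ?thesis by (simp only: integral_complex_of_real of_real_eq_iff)
qed


section \<open>Fourier integrals of the sawtooth\<close>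

text \<open>
  On the unit interval \<open>\<lfloor>t + y\<rfloor>\<close> jumps once, from \<open>\<lfloor>t\<rfloor>\<close> to \<open>\<lfloor>t\<rfloor> + 1\<close> at
  \<open>y = \<lfloor>t\<rfloor> + 1 - t\<close>. If the antiderivatives match at the ends of the interval, which expresses
  periodicity, only the values at the jump survive.
\<close>

lemma unit_integral_floor_split:
  fixes g G :: "real \<Rightarrow> real \<Rightarrow> 'a::euclidean_space"
  assumes meas: "(\<lambda>y. g (real_of_int \<lfloor>t + y\<rfloor>) y) \<in> borel_measurable borel"
    and deriv: "\<And>n y. (G n has_vector_derivative g n y) (at y)"
    and cont: "\<And>n. continuous_on UNIV (g n)"
    and period: "\<And>n. G (n + 1) 1 = G n 0"
  defines "n \<equiv> real_of_int \<lfloor>t\<rfloor>"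
  shows "(\<integral>y. g (real_of_int \<lfloor>t + y\<rfloor>) y \<partial>unit_measure) = G n (n + 1 - t) - G (n + 1) (n + 1 - t)"
proof -
  let ?b = "n + 1 - t"
  have b: "0 < ?b" "?b \<le> 1" unfolding n_def by linarith+
  have 1: "has_bochner_integral unit_measure (\<lambda>y. indicator {0..?b} y *\<^sub>R g n y) (G n ?b - G n 0)"
    using b by (intro unit_integral_FTC)
      (auto intro: has_vector_derivative_at_within[OF deriv] continuous_on_subset[OF cont])
  have 2: "has_bochner_integral unit_measure (\<lambda>y. indicator {?b..1} y *\<^sub>R g (n + 1) y) (G (n + 1) 1 - G (n + 1) ?b)"
    using b by (intro unit_integral_FTC)
      (auto intro: has_vector_derivative_at_within[OF deriv] continuous_on_subset[OF cont])
  have "AE y in unit_measure. y \<noteq> ?b"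
    unfolding unit_measure_def using AE_lborel_singleton[of ?b]
    by (subst AE_restrict_space_iff) auto
  then have "AE y in unit_measure. indicator {0..?b} y *\<^sub>R g n y + indicator {?b..1} y *\<^sub>R g (n + 1) y
      = g (real_of_int \<lfloor>t + y\<rfloor>) y"
    using AE_space
  proof eventually_elim
    case (elim y)
    then have y: "0 \<le> y" "y \<le> 1" by auto
    show ?case
    proof (cases "y < ?b")
      case True
      then have "\<lfloor>t + y\<rfloor> = \<lfloor>t\<rfloor>" using y unfolding n_def by linarith
      then show ?thesis using True y by (simp add: n_def indicator_def)
    next
      case False
      then have "\<lfloor>t + y\<rfloor> = \<lfloor>t\<rfloor> + 1" using y elim(1) b unfolding n_def by linarith
      then show ?thesis using False y elim(1) by (simp add: n_def indicator_def)
    qed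
  qed
  note ae = this
  have "has_bochner_integral unit_measure (\<lambda>y. g (real_of_int \<lfloor>t + y\<rfloor>) y)
      ((G n ?b - G n 0) + (G (n + 1) 1 - G (n + 1) ?b))"
    by (rule has_bochner_integralI_AE[OF has_bochner_integral_add[OF 1 2]
          borel_measurable_unit_measure[OF meas] ae])
  then show ?thesis using period by (simp add: has_bochner_integral_integral_eq)
qed

lemma unit_integral_saw: "(\<integral>y. real_of_int \<lfloor>t + y\<rfloor> - y \<partial>unit_measure) = t - 1 / 2"
proof -
  have "(\<integral>y. real_of_int \<lfloor>t + y\<rfloor> - y \<partial>unit_measure) =
     - (real_of_int \<lfloor>t\<rfloor> - (real_of_int \<lfloor>t\<rfloor> + 1 - t))\<^sup>2 / 2
     - (- (real_of_int \<lfloor>t\<rfloor> + 1 - (real_of_int \<lfloor>t\<rfloor> + 1 - t))\<^sup>2 / 2)"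
    by (rule unit_integral_floor_split[where g = "\<lambda>n y. n - y" and G = "\<lambda>n y. - (n - y)\<^sup>2 / 2"])
       (auto intro!: derivative_eq_intros continuous_intros
          simp: has_real_derivative_iff_has_vector_derivative[symmetric] field_simps)
  then show ?thesis by (simp add: power2_eq_square field_simps)
qed

lemma unit_integral_saw_sq: "(\<integral>y. (real_of_int \<lfloor>t + y\<rfloor> - y)\<^sup>2 \<partial>unit_measure) = t\<^sup>2 - t + 1 / 3"
proof -
  have "(\<integral>y. (real_of_int \<lfloor>t + y\<rfloor> - y)\<^sup>2 \<partial>unit_measure) =
     - ((real_of_int \<lfloor>t\<rfloor> - (real_of_int \<lfloor>t\<rfloor> + 1 - t)) ^ 3 / 3)
     - (- ((real_of_int \<lfloor>t\<rfloor> + 1 - (real_of_int \<lfloor>t\<rfloor> + 1 - t)) ^ 3 / 3))"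
    by (rule unit_integral_floor_split[where g = "\<lambda>n y. (n - y)\<^sup>2" and G = "\<lambda>n y. - ((n - y) ^ 3 / 3)"])
       (auto intro!: derivative_eq_intros continuous_intros
          simp: has_real_derivative_iff_has_vector_derivative[symmetric] field_simps)
  then show ?thesis by (simp add: power2_eq_square power3_eq_cube field_simps)
qed

lemma has_vector_derivative_cis [derivative_intros]:
  "((\<lambda>y. cis (r * y)) has_vector_derivative (\<i> * of_real r * cis (r * y))) (at y within S)"
proof -
  have "((\<lambda>y. of_real (cos (r * y)) + \<i> * of_real (sin (r * y))) has_vector_derivative
      (of_real (- r * sin (r * y)) + \<i> * of_real (r * cos (r * y)))) (at y within S)"
    by (intro derivative_intros has_vector_derivative_of_real)
       (auto intro!: derivative_eq_intros simp: has_real_derivative_iff_has_vector_derivative[symmetric])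
  moreover have "(\<lambda>y. of_real (cos (r * y)) + \<i> * of_real (sin (r * y))) = (\<lambda>y. cis (r * y))"
    by (simp add: fun_eq_iff complex_eq_iff)
  moreover have "of_real (- r * sin (r * y)) + \<i> * of_real (r * cos (r * y)) = \<i> * of_real r * cis (r * y)"
    by (simp add: complex_eq_iff)
  ultimately show ?thesis by simp
qed

text \<open>
  The coefficient of \<open>t\<close> in the exponent of the \<open>m\<close>-th harmonic, by which integration divides.
\<close>

definition harmonic_freq :: "nat \<Rightarrow> complex" where
  "harmonic_freq m = 2 * of_real pi * of_nat m * \<i>"

lemma harmonic_freq_nonzero: "0 < m \<Longrightarrow> harmonic_freq m \<noteq> 0"
  by (simp add: harmonic_freq_def)

lemma norm_harmonic_freq: "norm (harmonic_freq m) = 2 * pi * real m"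
  by (simp add: harmonic_freq_def norm_mult)

lemma cis_period_shift: "cis (- (2 * pi * real m * (real_of_int k + 1 - t))) = cis (2 * pi * real m * t)"
proof -
  have "cis (- (2 * pi * real m * (real_of_int k + 1 - t)))
      = cis (2 * pi * real m * t) * cis (2 * pi * real_of_int (- (int m * (k + 1))))"
    by (simp add: cis_mult algebra_simps)
  then show ?thesis by (simp only: cis_multiple_2pi Ints_of_int mult_1_right)
qed

lemma unit_integral_saw_cis:
  assumes m: "0 < m"
  shows "(\<integral>y. of_real (real_of_int \<lfloor>t + y\<rfloor> - y) * cis (- (2 * pi * real m * y)) \<partial>unit_measure)
    = cis (2 * pi * real m * t) / harmonic_freq m"
proof -
  let ?e = "\<lambda>y. cis ((- (2 * pi * real m)) * y)" and ?c = "harmonic_freq m"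
  let ?n = "real_of_int \<lfloor>t\<rfloor>"
  let ?G = "\<lambda>n y. - (of_real (n - y) * ?e y / ?c) + ?e y / ?c\<^sup>2 :: complex"
  have c: "\<i> * of_real (- (2 * pi * real m)) = - ?c" by (simp add: harmonic_freq_def)
  have ne: "?c \<noteq> 0" using m by (rule harmonic_freq_nonzero)
  have e1: "cis (- (2 * pi * real m)) = 1"
    using cis_period_shift[of m 0 0] by simp
  have "(\<integral>y. of_real (real_of_int \<lfloor>t + y\<rfloor> - y) * ?e y \<partial>unit_measure)
      = ?G ?n (?n + 1 - t) - ?G (?n + 1) (?n + 1 - t)"
  proof (rule unit_integral_floor_split[where g = "\<lambda>n y. of_real (n - y) * ?e y" and G = ?G])
    fix n y :: real
    have "(?G n has_vector_derivative
        - ((of_real (n - y) * (\<i> * of_real (- (2 * pi * real m)) * ?e y) + of_real (-1) * ?e y) / ?c)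
        + (\<i> * of_real (- (2 * pi * real m)) * ?e y) / ?c\<^sup>2) (at y)"
      by (intro derivative_intros) (auto intro!: derivative_eq_intros)
    also have "- ((of_real (n - y) * (\<i> * of_real (- (2 * pi * real m)) * ?e y) + of_real (-1) * ?e y) / ?c)
        + (\<i> * of_real (- (2 * pi * real m)) * ?e y) / ?c\<^sup>2 = of_real (n - y) * ?e y"
      unfolding c using ne by (simp add: field_simps power2_eq_square)
    finally show "(?G n has_vector_derivative of_real (n - y) * ?e y) (at y)" .
  qed (auto intro!: continuous_intros simp: e1)
  also have "\<dots> = ?e (?n + 1 - t) / ?c"
  proof -
    have "- (of_real (n - y) * E / ?c) + E / ?c\<^sup>2 - (- (of_real (n + 1 - y) * E / ?c) + E / ?c\<^sup>2) = E / ?c"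
      for n y :: real and E :: complex
      using ne by (simp add: divide_simps) (simp add: algebra_simps)
    then show ?thesis .
  qed
  also have "?e (?n + 1 - t) = cis (2 * pi * real m * t)"
    using cis_period_shift[of m "\<lfloor>t\<rfloor>" t] by simp
  finally show ?thesis by simp
qed

lemma unit_integral_saw_sq_cis:
  assumes m: "0 < m"
  shows "(\<integral>y. of_real ((real_of_int \<lfloor>t + y\<rfloor> - y)\<^sup>2) * cis (- (2 * pi * real m * y)) \<partial>unit_measure)
    = cis (2 * pi * real m * t) * ((2 * of_real t - 1) / harmonic_freq m - 2 / (harmonic_freq m)\<^sup>2)"
proof -
  let ?e = "\<lambda>y. cis ((- (2 * pi * real m)) * y)" and ?c = "harmonic_freq m"
  let ?n = "real_of_int \<lfloor>t\<rfloor>"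
  let ?G = "\<lambda>n y. - (of_real ((n - y)\<^sup>2) * ?e y / ?c) + 2 * of_real (n - y) * ?e y / ?c\<^sup>2 - 2 * ?e y / ?c ^ 3 :: complex"
  have c: "\<i> * of_real (- (2 * pi * real m)) = - ?c" by (simp add: harmonic_freq_def)
  have ne: "?c \<noteq> 0" using m by (rule harmonic_freq_nonzero)
  have e1: "cis (- (2 * pi * real m)) = 1"
    using cis_period_shift[of m 0 0] by simp
  have "(\<integral>y. of_real ((real_of_int \<lfloor>t + y\<rfloor> - y)\<^sup>2) * ?e y \<partial>unit_measure)
      = ?G ?n (?n + 1 - t) - ?G (?n + 1) (?n + 1 - t)"
  proof (rule unit_integral_floor_split[where g = "\<lambda>n y. of_real ((n - y)\<^sup>2) * ?e y" and G = ?G])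
    fix n y :: real
    have "(?G n has_vector_derivative
        - ((of_real ((n - y)\<^sup>2) * (\<i> * of_real (- (2 * pi * real m)) * ?e y) + of_real (- 2 * (n - y)) * ?e y) / ?c)
        + (2 * of_real (n - y) * (\<i> * of_real (- (2 * pi * real m)) * ?e y) + 2 * of_real (- 1) * ?e y) / ?c\<^sup>2
        - 2 * (\<i> * of_real (- (2 * pi * real m)) * ?e y) / ?c ^ 3) (at y)"
      by (intro derivative_intros) (auto intro!: derivative_eq_intros)
    also have "- ((of_real ((n - y)\<^sup>2) * (\<i> * of_real (- (2 * pi * real m)) * ?e y) + of_real (- 2 * (n - y)) * ?e y) / ?c)
        + (2 * of_real (n - y) * (\<i> * of_real (- (2 * pi * real m)) * ?e y) + 2 * of_real (- 1) * ?e y) / ?c\<^sup>2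
        - 2 * (\<i> * of_real (- (2 * pi * real m)) * ?e y) / ?c ^ 3
        = of_real ((n - y)\<^sup>2) * ?e y"
      unfolding c using ne by (simp add: field_simps power2_eq_square power3_eq_cube)
    finally show "(?G n has_vector_derivative of_real ((n - y)\<^sup>2) * ?e y) (at y)" .
  qed (auto intro!: continuous_intros simp: e1)
  also have "\<dots> = ?e (?n + 1 - t) * ((2 * of_real t - 1) / ?c - 2 / ?c\<^sup>2)"
  proof -
    have "(- (of_real ((n - y)\<^sup>2) * E / ?c) + 2 * of_real (n - y) * E / ?c\<^sup>2 - 2 * E / ?c ^ 3)
        - (- (of_real ((n + 1 - y)\<^sup>2) * E / ?c) + 2 * of_real (n + 1 - y) * E / ?c\<^sup>2 - 2 * E / ?c ^ 3)
      = E * ((2 * of_real (n + 1 - y) - 1) / ?c - 2 / ?c\<^sup>2)"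
      for n y :: real and E :: complex
      using ne by (simp add: field_simps power2_eq_square power3_eq_cube)
    from this[of ?n "?n + 1 - t"] show ?thesis by simp
  qed
  also have "?e (?n + 1 - t) = cis (2 * pi * real m * t)"
    using cis_period_shift[of m "\<lfloor>t\<rfloor>" t] by simp
  finally show ?thesis by simp
qed


section \<open>Moments of a rounded Gumbel variable\<close>

text \<open>
  For an exponential variable \<open>v\<close> this is a Gumbel variable in binary units.
\<close>

definition neg_log2 :: "real \<Rightarrow> real" where
  "neg_log2 v = - ln v / ln 2"

text \<open>
  With \<open>T = neg_log2 v\<close>, subtracting \<open>y\<close> from \<open>\<lfloor>T + y\<rfloor>\<close> makes the moment periodic in
  \<open>y\<close> and does not affect the variance.
\<close>

definition saw_moment :: "nat \<Rightarrow> real \<Rightarrow> real" where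
  "saw_moment j y = (\<integral>v. (real_of_int \<lfloor>neg_log2 v + y\<rfloor> - y) ^ j \<partial>exp1)"

lemma borel_measurable_neg_log2 [measurable]: "neg_log2 \<in> borel_measurable borel"
  unfolding neg_log2_def by measurable

lemma abs_saw_le: "\<bar>real_of_int \<lfloor>t + y\<rfloor> - y\<bar> \<le> \<bar>t\<bar> + 1"
  by linarith

lemma abs_saw_power_le: "\<bar>(real_of_int \<lfloor>t + y\<rfloor> - y) ^ j\<bar> \<le> (\<bar>t\<bar> + 1) ^ j"
  by (simp add: power_abs power_mono abs_saw_le)

lemma integrable_neg_log2_power: "integrable exp1 (\<lambda>v. (\<bar>neg_log2 v\<bar> + 1) ^ j)"
proof (cases "j = 0")
  case False
  have "integrable exp1 (\<lambda>v. \<bar>ln v\<bar> ^ 0 * exp (0 * ln v + (1 / 2) * \<bar>ln v\<bar>))"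
    by (rule integrable_exp1_ln_moment) auto
  then have "integrable exp1 (\<lambda>v. (real j / (ln 2 / 2)) ^ j * exp (ln 2 / 2) * exp ((1 / 2) * \<bar>ln v\<bar>))"
    by (intro integrable_mult_right) simp
  then show ?thesis
  proof (rule Bochner_Integration.integrable_bound)
    show "AE v in exp1. norm ((\<bar>neg_log2 v\<bar> + 1) ^ j)
      \<le> norm ((real j / (ln 2 / 2)) ^ j * exp (ln 2 / 2) * exp ((1 / 2) * \<bar>ln v\<bar>))"
    proof (rule AE_I2)
      fix v :: real
      have "(\<bar>neg_log2 v\<bar> + 1) ^ j \<le> (real j / (ln 2 / 2)) ^ j * exp (ln 2 / 2 * (\<bar>neg_log2 v\<bar> + 1))"
        using False by (intro power_le_exp) auto
      also have "ln 2 / 2 * (\<bar>neg_log2 v\<bar> + 1) = ln 2 / 2 + (1 / 2) * \<bar>ln v\<bar>"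
        by (simp add: neg_log2_def abs_divide field_simps)
      finally show "norm ((\<bar>neg_log2 v\<bar> + 1) ^ j)
          \<le> norm ((real j / (ln 2 / 2)) ^ j * exp (ln 2 / 2) * exp ((1 / 2) * \<bar>ln v\<bar>))"
        by (simp add: exp_add mult_ac)
    qed
  qed measurable
qed simp

lemma exp1_unit_Fubini:
  fixes F :: "real \<Rightarrow> real \<Rightarrow> 'b::{banach, second_countable_topology}"
  assumes meas: "case_prod F \<in> borel_measurable (borel \<Otimes>\<^sub>M borel)"
    and bound: "\<And>v y. norm (F v y) \<le> B v" and B: "integrable exp1 B"
  shows "(\<integral>y. (\<integral>v. F v y \<partial>exp1) \<partial>unit_measure) = (\<integral>v. (\<integral>y. F v y \<partial>unit_measure) \<partial>exp1)"
proof -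
  interpret P: pair_prob_space exp1 unit_measure ..
  have [measurable]: "(\<lambda>p. snd p) \<in> borel_measurable (exp1 \<Otimes>\<^sub>M unit_measure)"
    using measurable_compose[OF measurable_snd borel_measurable_unit_measure[of "\<lambda>y. y"]] by simp
  have [measurable]: "(\<lambda>p. fst p) \<in> borel_measurable (exp1 \<Otimes>\<^sub>M unit_measure)"
    using measurable_fst[of exp1 unit_measure] by (simp cong: measurable_cong_sets)
  have "(\<lambda>p. case_prod F (fst p, snd p)) \<in> borel_measurable (exp1 \<Otimes>\<^sub>M unit_measure)"
    by (rule measurable_compose[OF _ meas]) measurable
  then have m: "case_prod F \<in> borel_measurable (exp1 \<Otimes>\<^sub>M unit_measure)" by simp
  have m1: "F v \<in> borel_measurable unit_measure" for v
    using measurable_compose[OF _ meas, of "\<lambda>y. (v, y)" borel]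
    by (intro borel_measurable_unit_measure) simp
  have int1: "integrable unit_measure (F v)" for v
    by (rule unit.integrable_const_bound[of _ "B v"]) (auto intro!: AE_I2 bound m1)
  have "integrable exp1 (\<lambda>v. \<integral>y. norm (F v y) \<partial>unit_measure)"
  proof (rule Bochner_Integration.integrable_bound[OF B])
    show "(\<lambda>v. \<integral>y. norm (F v y) \<partial>unit_measure) \<in> borel_measurable exp1"
      using m by (intro unit.borel_measurable_lebesgue_integral) simp
    show "AE v in exp1. norm (\<integral>y. norm (F v y) \<partial>unit_measure) \<le> norm (B v)"
    proof (rule AE_I2)
      fix v
      have "(\<integral>y. norm (F v y) \<partial>unit_measure) \<le> (\<integral>y. B v \<partial>unit_measure)"
        using bound int1 by (intro integral_mono) auto
      then show "norm (\<integral>y. norm (F v y) \<partial>unit_measure) \<le> norm (B v)"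
        by (simp add: unit.prob_space[simplified])
    qed
  qed
  then have "integrable (exp1 \<Otimes>\<^sub>M unit_measure) (case_prod F)"
    using m int1 by (intro P.Fubini_integrable) auto
  then show ?thesis by (rule P.Fubini_integral)
qed

lemma saw_moment_periodic: "saw_moment j (y + 1) = saw_moment j y"
  by (simp add: saw_moment_def add.assoc[symmetric] flip: floor_add_int)

text \<open>
  The integrand jumps in \<open>y\<close> only where \<open>neg_log2 v + y\<close> is an integer, which for fixed \<open>y\<close> excludes
  countably many \<open>v\<close>; dominated convergence does the rest.
\<close>

lemma saw_moment_continuous: "continuous_on UNIV (saw_moment j)"
proof -
  have "isCont (saw_moment j) y" for y
    unfolding continuous_at_sequentially
  proof (intro allI impI)
    fix Y :: "nat \<Rightarrow> real" assume Y: "Y \<longlonglongrightarrow> y"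
    have "(\<lambda>n. saw_moment j (Y n)) \<longlonglongrightarrow> saw_moment j y"
      unfolding saw_moment_def
    proof (rule integral_dominated_convergence[OF _ _ integrable_neg_log2_power[of j]])
      show "AE v in exp1. (\<lambda>n. (real_of_int \<lfloor>neg_log2 v + Y n\<rfloor> - Y n) ^ j)
          \<longlonglongrightarrow> (real_of_int \<lfloor>neg_log2 v + y\<rfloor> - y) ^ j"
      proof -
        let ?A = "(\<lambda>k::int. exp (- ln 2 * (real_of_int k - y))) ` UNIV"
        have "AE v in lborel. v \<notin> ?A"
          by (intro AE_not_in countable_imp_null_set_lborel countable_image) simp
        then have "AE v in exp1. v \<notin> ?A"
          unfolding exp1_def by (subst AE_density) auto
        with AE_exp1_pos show ?thesis
        proof eventually_elim
          case (elim v)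
          have "neg_log2 v + y \<notin> \<int>"
          proof
            assume "neg_log2 v + y \<in> \<int>"
            then obtain k where "neg_log2 v + y = real_of_int k" by (auto elim: Ints_cases)
            then have "- ln 2 * (real_of_int k - y) = ln v" by (simp add: neg_log2_def field_simps)
            then have "exp (- ln 2 * (real_of_int k - y)) = v" using elim by simp
            then have "v \<in> ?A" by blast
            with elim show False by blast
          qed
          moreover have lim: "(\<lambda>n. neg_log2 v + Y n) \<longlonglongrightarrow> neg_log2 v + y"
            using Y by (intro tendsto_intros)
          ultimately have "\<forall>\<^sub>F n in sequentially. \<lfloor>neg_log2 v + Y n\<rfloor> = \<lfloor>neg_log2 v + y\<rfloor>"
            by (intro eventually_floor_eq)
          then have "\<forall>\<^sub>F n in sequentially. (real_of_int \<lfloor>neg_log2 v + y\<rfloor> - Y n) ^ j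
              = (real_of_int \<lfloor>neg_log2 v + Y n\<rfloor> - Y n) ^ j"
            by eventually_elim simp
          moreover have "(\<lambda>n. (real_of_int \<lfloor>neg_log2 v + y\<rfloor> - Y n) ^ j)
              \<longlonglongrightarrow> (real_of_int \<lfloor>neg_log2 v + y\<rfloor> - y) ^ j"
            using Y by (intro tendsto_intros)
          ultimately show ?case by (rule Lim_transform_eventually[rotated])
        qed
      qed
      show "AE v in exp1. norm ((real_of_int \<lfloor>neg_log2 v + Y n\<rfloor> - Y n) ^ j) \<le> (\<bar>neg_log2 v\<bar> + 1) ^ j" for n
        by (rule AE_I2) (auto simp: abs_saw_power_le)
    qed measurable
    then show "(saw_moment j \<circ> Y) \<longlonglongrightarrow> saw_moment j y" by (simp add: o_def)
  qed
  then show ?thesis by (simp add: continuous_on_eq_continuous_at)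
qed

lemma saw_moment_mean:
  "(\<integral>y. saw_moment j y \<partial>unit_measure) =
    (\<integral>v. (\<integral>y. (real_of_int \<lfloor>neg_log2 v + y\<rfloor> - y) ^ j \<partial>unit_measure) \<partial>exp1)"
  unfolding saw_moment_def
  by (rule exp1_unit_Fubini[OF _ _ integrable_neg_log2_power[of j]])
     (auto simp: abs_saw_power_le)

lemma saw_moment_coeff:
  "(\<integral>y. of_real (saw_moment j y) * cis (- (2 * pi * real m * y)) \<partial>unit_measure) =
    (\<integral>v. (\<integral>y. of_real ((real_of_int \<lfloor>neg_log2 v + y\<rfloor> - y) ^ j) * cis (- (2 * pi * real m * y)) \<partial>unit_measure) \<partial>exp1)"
proof -
  have "(\<integral>y. of_real (saw_moment j y) * cis (- (2 * pi * real m * y)) \<partial>unit_measure) =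
    (\<integral>y. (\<integral>v. of_real ((real_of_int \<lfloor>neg_log2 v + y\<rfloor> - y) ^ j) * cis (- (2 * pi * real m * y)) \<partial>exp1) \<partial>unit_measure)"
    unfolding saw_moment_def by (simp only: integral_mult_left_zero integral_complex_of_real)
  also have "\<dots> = (\<integral>v. (\<integral>y. of_real ((real_of_int \<lfloor>neg_log2 v + y\<rfloor> - y) ^ j) * cis (- (2 * pi * real m * y)) \<partial>unit_measure) \<partial>exp1)"
    by (rule exp1_unit_Fubini[OF _ _ integrable_neg_log2_power[of j]])
       (auto simp: norm_mult abs_saw_power_le simp del: of_real_power)
  finally show ?thesis .
qed

lemma integrable_neg_log2: "integrable exp1 neg_log2"
  and integrable_neg_log2_sq: "integrable exp1 (\<lambda>v. (neg_log2 v)\<^sup>2)"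
proof -
  show "integrable exp1 neg_log2"
    by (rule Bochner_Integration.integrable_bound[OF integrable_neg_log2_power[of 1]]) auto
  show "integrable exp1 (\<lambda>v. (neg_log2 v)\<^sup>2)"
  proof (rule Bochner_Integration.integrable_bound[OF integrable_neg_log2_power[of 2]])
    have "\<bar>neg_log2 v\<bar>\<^sup>2 \<le> (\<bar>neg_log2 v\<bar> + 1)\<^sup>2" for v by (intro power_mono) auto
    then show "AE v in exp1. norm ((neg_log2 v)\<^sup>2) \<le> norm ((\<bar>neg_log2 v\<bar> + 1)\<^sup>2)" by simp
  qed measurable
qed

lemma exp1_integral_neg_log2: "(\<integral>v. neg_log2 v \<partial>exp1) = euler_mascheroni / ln 2"
  unfolding neg_log2_def by (simp add: exp1_integral_ln)

lemma exp1_integral_neg_log2_sq: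
  "(\<integral>v. (neg_log2 v)\<^sup>2 \<partial>exp1) = (euler_mascheroni\<^sup>2 + pi\<^sup>2 / 6) / (ln 2)\<^sup>2"
  unfolding neg_log2_def by (simp add: exp1_integral_ln_sq power_divide)

lemma saw_moment_1_mean:
  "(\<integral>y. saw_moment 1 y \<partial>unit_measure) = euler_mascheroni / ln 2 - 1 / 2"
  unfolding saw_moment_mean power_one_right unit_integral_saw
  using integrable_neg_log2 by (simp add: exp1_integral_neg_log2 exp1.prob_space[simplified])

lemma saw_moment_2_mean:
  "(\<integral>y. saw_moment 2 y \<partial>unit_measure)
     = (euler_mascheroni\<^sup>2 + pi\<^sup>2 / 6) / (ln 2)\<^sup>2 - euler_mascheroni / ln 2 + 1 / 3"
  unfolding saw_moment_mean unit_integral_saw_sq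
  using integrable_neg_log2 integrable_neg_log2_sq
  by (simp add: exp1_integral_neg_log2 exp1_integral_neg_log2_sq exp1.prob_space[simplified])

text \<open>
  The point of the line \<open>Re z = 1\<close> at which the Gamma function is the characteristic function of
  \<open>neg_log2 v\<close> at \<open>2 * pi * m\<close>.
\<close>

definition harmonic_arg :: "nat \<Rightarrow> complex" where
  "harmonic_arg m = 1 - \<i> * of_real (2 * pi * real m / ln 2)"

lemma cis_neg_log2: "cis (2 * pi * real m * neg_log2 v) = exp ((harmonic_arg m - 1) * of_real (ln v))"
  by (simp add: harmonic_arg_def neg_log2_def cis_conv_exp mult_ac)

lemma Re_harmonic_arg [simp]: "Re (harmonic_arg m) = 1"
  by (simp add: harmonic_arg_def)

lemma integrable_cis_neg_log2: "integrable exp1 (\<lambda>v. cis (2 * pi * real m * neg_log2 v))"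
  unfolding cis_neg_log2 by (rule exp1_integral_ln_exp) simp

lemma integrable_neg_log2_cis:
  "integrable exp1 (\<lambda>v. of_real (neg_log2 v) * cis (2 * pi * real m * neg_log2 v))"
  by (rule Bochner_Integration.integrable_bound[OF integrable_neg_log2]) (auto simp: norm_mult)

lemma exp1_integral_cis: "(\<integral>v. cis (2 * pi * real m * neg_log2 v) \<partial>exp1) = Gamma (harmonic_arg m)"
  unfolding cis_neg_log2 by (rule exp1_integral_ln_exp) simp

lemma exp1_integral_neg_log2_cis:
  "(\<integral>v. of_real (neg_log2 v) * cis (2 * pi * real m * neg_log2 v) \<partial>exp1)
     = - Gamma (harmonic_arg m) * Digamma (harmonic_arg m) / of_real (ln 2)"
proof -
  have "(\<integral>v. of_real (neg_log2 v) * cis (2 * pi * real m * neg_log2 v) \<partial>exp1)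
      = (\<integral>v. (- 1 / of_real (ln 2)) * (of_real (ln v) * exp ((harmonic_arg m - 1) * of_real (ln v))) \<partial>exp1)"
    unfolding cis_neg_log2 by (simp add: neg_log2_def)
  also have "\<dots> = (- 1 / of_real (ln 2)) * (Gamma (harmonic_arg m) * Digamma (harmonic_arg m))"
    unfolding integral_mult_right_zero by (subst exp1_integral_ln_mult_exp) simp_all
  finally show ?thesis by simp
qed

lemma saw_moment_1_coeff:
  assumes "0 < m"
  shows "(\<integral>y. of_real (saw_moment 1 y) * cis (- (2 * pi * real m * y)) \<partial>unit_measure)
      = Gamma (harmonic_arg m) / harmonic_freq m"
  unfolding saw_moment_coeff power_one_right unit_integral_saw_cis[OF assms]
  by (simp add: exp1_integral_cis)

lemma saw_moment_2_coeff:
  assumes "0 < m"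
  shows "(\<integral>y. of_real (saw_moment 2 y) * cis (- (2 * pi * real m * y)) \<partial>unit_measure)
      = Gamma (harmonic_arg m) / harmonic_freq m * (- 2 * Digamma (harmonic_arg m) / of_real (ln 2) - 1 - 2 / harmonic_freq m)"
proof -
  let ?e = "\<lambda>v. cis (2 * pi * real m * neg_log2 v)"
  have "(\<integral>v. ?e v * ((2 * of_real (neg_log2 v) - 1) / harmonic_freq m - 2 / (harmonic_freq m)\<^sup>2) \<partial>exp1)
      = (\<integral>v. (2 / harmonic_freq m) * (of_real (neg_log2 v) * ?e v) - (1 / harmonic_freq m + 2 / (harmonic_freq m)\<^sup>2) * ?e v \<partial>exp1)"
    by (rule Bochner_Integration.integral_cong) (simp_all add: algebra_simps diff_divide_distrib)
  also have "\<dots> = (2 / harmonic_freq m) * (\<integral>v. of_real (neg_log2 v) * ?e v \<partial>exp1)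
      - (1 / harmonic_freq m + 2 / (harmonic_freq m)\<^sup>2) * (\<integral>v. ?e v \<partial>exp1)"
    using integrable_cis_neg_log2 integrable_neg_log2_cis
    by (subst Bochner_Integration.integral_diff) auto
  finally show ?thesis
    unfolding saw_moment_coeff unit_integral_saw_sq_cis[OF assms]
    unfolding exp1_integral_cis exp1_integral_neg_log2_cis
    using harmonic_freq_nonzero[OF assms] by (simp add: field_simps power2_eq_square)
qed

text \<open>
  Periodicity moves \<open>x\<close> into the unit interval, and continuity adds its left end point.
\<close>

lemma abs_diff_mean_le_periodic:
  fixes \<phi> :: "real \<Rightarrow> real"
  assumes cont: "continuous_on UNIV \<phi>" and period: "\<And>y. \<phi> (y + 1) = \<phi> y"
    and coeff: "\<And>m. 0 < m \<Longrightarrow>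
       norm (\<integral>y. of_real (\<phi> y) * cis (- (2 * pi * real m * y)) \<partial>unit_measure) \<le> b m"
    and b: "\<And>N. (\<Sum>m=1..<N. b m) \<le> A"
  shows "\<bar>\<phi> x - (\<integral>y. \<phi> y \<partial>unit_measure)\<bar> \<le> 2 * A"
proof -
  let ?g = "\<lambda>x. \<bar>\<phi> x - (\<integral>y. \<phi> y \<partial>unit_measure)\<bar>"
  have shift: "\<phi> (y + real n) = \<phi> y" for y n
  proof (induction n)
    case (Suc n)
    then show ?case using period[of "y + real n"] by (simp add: add_ac)
  qed simp
  have frac: "\<phi> x = \<phi> (frac x)"
  proof (cases "0 \<le> \<lfloor>x\<rfloor>")
    case True
    then show ?thesis using shift[of "frac x" "nat \<lfloor>x\<rfloor>"] by (simp add: frac_def)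
  next
    case False
    then show ?thesis using shift[of x "nat (- \<lfloor>x\<rfloor>)"] by (simp add: frac_def)
  qed
  have "?g (frac x) \<le> 2 * A"
  proof (rule continuous_le_on_closure[where S = "{0<..<1}" and f = ?g and x = "frac x"])
    show "continuous_on (closure {0<..<1}) ?g"
      using cont by (intro continuous_intros) (auto intro: continuous_on_subset)
    show "frac x \<in> closure {0<..<1}"
      using frac_ge_0[of x] frac_lt_1[of x] by simp
    show "?g y \<le> 2 * A" if "y \<in> {0<..<1}" for y
      using that by (intro abs_diff_mean_le_interior[OF cont _ _ coeff b]) auto
  qed
  then show ?thesis by (simp only: frac)
qed


section \<open>The size of the oscillation\<close>

lemma norm_sin_i_times:
  assumes "0 < x"
  shows "norm (sin (\<i> * of_real x)) = sinh x"
proof -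
  have "sin (\<i> * of_real x) = (exp (- of_real x) - exp (of_real x)) / (2 * \<i>)"
    by (simp add: sin_exp_eq mult.assoc[symmetric])
  also have "\<dots> = of_real (exp (- x) - exp x) / (2 * \<i>)"
    by (simp flip: exp_of_real)
  also have "norm \<dots> = \<bar>exp (- x) - exp x\<bar> / 2"
    by (simp only: norm_divide norm_of_real norm_mult norm_ii) simp
  also have "\<dots> = sinh x" using assms by (simp add: sinh_field_def)
  finally show ?thesis .
qed

text \<open>
  Complex conjugation turns \<open>Gamma (1 - z)\<close> into \<open>Gamma (1 + z) = z * Gamma z\<close> for imaginary \<open>z\<close>, so
  that the squared modulus is given by the reflection formula.
\<close>

lemma norm_Gamma_1_minus_i_sq:
  assumes y: "0 < y"
  shows "(norm (Gamma (1 - \<i> * of_real y)))\<^sup>2 = pi * y / sinh (pi * y)"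
proof -
  let ?z = "\<i> * of_real y"
  have z: "?z \<notin> \<int>\<^sub>\<le>\<^sub>0" using y by (auto elim!: nonpos_Ints_cases simp: complex_eq_iff)
  have "norm (Gamma (1 - ?z)) = norm (cnj (Gamma (1 - ?z)))" by simp
  also have "cnj (Gamma (1 - ?z)) = ?z * Gamma ?z"
    using Gamma_plus1[OF z] by (simp add: cnj_Gamma add.commute)
  finally have "(norm (Gamma (1 - ?z)))\<^sup>2 = norm (?z * (Gamma ?z * Gamma (1 - ?z)))"
    by (simp add: power2_eq_square norm_mult)
  also have "\<dots> = y * (pi / norm (sin (of_real pi * ?z)))"
    using y unfolding Gamma_reflection_complex by (simp add: norm_mult norm_divide)
  also have "of_real pi * ?z = \<i> * of_real (pi * y)" by simp
  also have "norm (sin \<dots>) = sinh (pi * y)"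
    using y by (intro norm_sin_i_times) simp
  finally show ?thesis by simp
qed

text \<open>
  Termwise in the series of the Digamma function, estimating \<open>\<bar>k + 1 - \<i> * y\<bar> \<ge> k + 1\<close>. The true
  growth is logarithmic in \<open>y\<close>, but the Gamma factor is so small that a linear bound is enough.
\<close>

lemma norm_Digamma_1_minus_i_le:
  "norm (Digamma (1 - \<i> * of_real y)) \<le> euler_mascheroni + \<bar>y\<bar> * (pi\<^sup>2 / 6)"
proof -
  let ?z = "1 - \<i> * of_real y"
  let ?f = "\<lambda>k. inverse (of_nat (Suc k)) - inverse (?z + of_nat k)"
  have sums: "(\<lambda>k. \<bar>y\<bar> * (1 / (real k + 1)\<^sup>2)) sums (\<bar>y\<bar> * (pi\<^sup>2 / 6))"
    using sums_mult[OF inverse_squares_sums, of "\<bar>y\<bar>"] by (simp add: add.commute)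
  have bound: "norm (?f k) \<le> \<bar>y\<bar> * (1 / (real k + 1)\<^sup>2)" for k
  proof -
    have w: "?z + of_nat k = of_nat (Suc k) - \<i> * of_real y" by simp
    have "real k + 1 = \<bar>Re (?z + of_nat k)\<bar>" by simp
    also have "\<dots> \<le> norm (?z + of_nat k)" by (rule abs_Re_le_cmod)
    finally have ge: "real k + 1 \<le> norm (?z + of_nat k)" .
    then have ne: "?z + of_nat k \<noteq> 0" using of_nat_0_le_iff[of k] by (auto simp del: of_nat_0_le_iff)
    have ne': "(of_nat (Suc k) :: complex) \<noteq> 0" by (rule of_nat_neq_0)
    have "?f k = ((?z + of_nat k) - of_nat (Suc k)) / (of_nat (Suc k) * (?z + of_nat k))"
      using ne ne' by (simp add: field_simps)
    also have "(?z + of_nat k) - of_nat (Suc k) = - (\<i> * of_real y)" by simp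
    also have "norm (- (\<i> * of_real y) / (of_nat (Suc k) * (?z + of_nat k)))
        = \<bar>y\<bar> / ((real k + 1) * norm (?z + of_nat k))"
      by (simp only: norm_divide norm_minus_cancel norm_mult norm_of_nat norm_of_real norm_ii) simp
    also have "\<dots> \<le> \<bar>y\<bar> / ((real k + 1) * (real k + 1))"
      using ge by (intro divide_left_mono mult_left_mono mult_pos_pos) auto
    finally show ?thesis by (simp add: power2_eq_square)
  qed
  have "norm (suminf ?f) \<le> (\<Sum>k. \<bar>y\<bar> * (1 / (real k + 1)\<^sup>2))"
    by (rule norm_suminf_le[OF bound sums_summable[OF sums]])
  also have "\<dots> = \<bar>y\<bar> * (pi\<^sup>2 / 6)" using sums by (rule sums_unique[symmetric])
  finally have "norm (suminf ?f) \<le> \<bar>y\<bar> * (pi\<^sup>2 / 6)" .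
  moreover have "norm (Digamma ?z) \<le> norm (suminf ?f) + norm (euler_mascheroni :: complex)"
    unfolding Digamma_def by (rule norm_triangle_ineq4)
  moreover have "norm (euler_mascheroni :: complex) = euler_mascheroni"
  proof -
    have "norm (of_real euler_mascheroni :: complex) = \<bar>euler_mascheroni\<bar>" by (rule norm_of_real)
    then show ?thesis using euler_mascheroni_pos by simp
  qed
  ultimately show ?thesis by linarith
qed

lemma pi_sq_bounds: "9.869 \<le> pi\<^sup>2" "pi\<^sup>2 \<le> 9.8697"
proof -
  have "3.1415\<^sup>2 \<le> pi\<^sup>2" using pi_approx by (intro power_mono) auto
  then show "9.869 \<le> pi\<^sup>2" by (simp add: power2_eq_square)
  have "pi\<^sup>2 \<le> 3.1416\<^sup>2" using pi_approx by (intro power_mono) auto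
  then show "pi\<^sup>2 \<le> 9.8697" by (simp add: power2_eq_square)
qed

text \<open>
  Raised to the fifth power this is a comparison with \<open>exp 1 ^ 71\<close>. The number 14.2 is half of 28.4, a
  lower bound for \<open>2 * pi\<^sup>2 / ln 2\<close>.
\<close>

lemma exp_14_2_ge: "1460000 \<le> exp (14.2 :: real)"
proof -
  have e: "2.71828 \<le> exp (1::real)" using e_approx_32 abs_ge_minus_self[of "exp 1 - 5837465777 / 2147483648 :: real"] by simp
  have "(1460000::real) ^ 5 \<le> 2.71828 ^ 71" by (simp add: power_divide)
  also have "\<dots> \<le> exp 1 ^ 71" using e by (intro power_mono) auto
  also have "\<dots> = exp 14.2 ^ 5" by (simp add: exp_of_nat_mult[symmetric])
  finally show ?thesis by (rule power_le_imp_le_base[of _ 4, unfolded eval_nat_numeral, simplified]) simp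
qed

text \<open>
  Here \<open>pi * y = P\<close> with \<open>28.4 * m \<le> P \<le> 29.61 * m\<close>, from \<open>2 / 3 \<le> ln 2 \<le> 25 / 36\<close>. So the
  squared modulus is about \<open>2 * P * exp (- P)\<close> and at most about \<open>59.22 * m * exp (- 28.4 * m)\<close>;
  the square root of 59.22 is below 7.71.
\<close>

lemma norm_Gamma_harmonic_le:
  assumes m: "0 < m"
  shows "norm (Gamma (harmonic_arg m)) \<le> 7.71 * real m * (1 / 1460000) ^ m"
proof -
  define P where "P = pi * (2 * pi * real m / ln 2)"
  have Peq: "P = 2 * pi\<^sup>2 * real m / ln 2" by (simp add: P_def power2_eq_square)
  have lower: "28.4 * real m \<le> P"
  proof -
    have "28.4 * ln 2 \<le> 28.4 * (25 / 36 :: real)" using ln2_le_25_over_36 by (intro mult_left_mono) auto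
    also have "\<dots> \<le> 2 * pi\<^sup>2" using pi_sq_bounds by simp
    finally have "28.4 * ln 2 * real m \<le> 2 * pi\<^sup>2 * real m" by (intro mult_right_mono) auto
    then show ?thesis unfolding Peq by (simp add: pos_le_divide_eq mult_ac)
  qed
  have upper: "P \<le> 29.61 * real m"
  proof -
    have "2 * pi\<^sup>2 \<le> 29.61 * (2 / 3 :: real)" using pi_sq_bounds by simp
    also have "\<dots> \<le> 29.61 * ln 2" using ln2_ge_two_thirds by (intro mult_left_mono) auto
    finally have "2 * pi\<^sup>2 * real m \<le> 29.61 * ln 2 * real m" by (intro mult_right_mono) auto
    then show ?thesis unfolding Peq by (simp add: pos_divide_le_eq mult_ac)
  qed
  define E where "E = (1460000 :: real) ^ m"
  have E: "1460000 \<le> E" using m self_le_power[of "1460000::real" m] by (simp add: E_def)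
  have "E \<le> exp 14.2 ^ m" unfolding E_def using exp_14_2_ge by (intro power_mono) auto
  then have "E\<^sup>2 \<le> (exp 14.2 ^ m)\<^sup>2" using E by (intro power_mono) auto
  also have "\<dots> = exp (28.4 * real m)" by (simp add: exp_of_nat_mult[symmetric] power2_eq_square exp_add[symmetric])
  also have "\<dots> \<le> exp P" using lower by simp
  finally have eP: "E\<^sup>2 \<le> exp P" .
  have P0: "0 < P" using m by (simp add: P_def)
  have "exp (- P) \<le> 1" using P0 by simp
  then have "E\<^sup>2 - 1 \<le> exp P - exp (- P)" using eP by linarith
  then have sinh: "(E\<^sup>2 - 1) / 2 \<le> sinh P" by (simp add: sinh_field_def)
  have E2: "1460000\<^sup>2 \<le> E\<^sup>2" using E by (intro power_mono) auto
  have "(norm (Gamma (harmonic_arg m)))\<^sup>2 = P / sinh P"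
    using norm_Gamma_1_minus_i_sq[of "2 * pi * real m / ln 2"] m
    by (simp add: harmonic_arg_def P_def)
  also have "\<dots> \<le> 29.61 * real m / ((E\<^sup>2 - 1) / 2)"
    using upper sinh E2 P0 by (intro frac_le) auto
  also have "\<dots> \<le> (7.71 * real m)\<^sup>2 / E\<^sup>2"
  proof -
    have "2 * 29.61 * real m * E\<^sup>2 \<le> 59.4 * real m * (E\<^sup>2 - 1)"
    proof -
      have "2 * 29.61 * E\<^sup>2 \<le> 59.4 * (E\<^sup>2 - 1)" using E2 by simp
      then have "real m * (2 * 29.61 * E\<^sup>2) \<le> real m * (59.4 * (E\<^sup>2 - 1))" by (intro mult_left_mono) auto
      then show ?thesis by (simp add: mult_ac)
    qed
    also have "59.4 * real m * (E\<^sup>2 - 1) \<le> (7.71 * real m)\<^sup>2 * (E\<^sup>2 - 1)"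
    proof (intro mult_right_mono)
      have "real m * 1 \<le> real m * real m" using m by (intro mult_left_mono) auto
      then show "59.4 * real m \<le> (7.71 * real m)\<^sup>2" by (simp add: power2_eq_square)
    qed (use E2 in simp)
    finally have le: "2 * 29.61 * real m * E\<^sup>2 \<le> (7.71 * real m)\<^sup>2 * (E\<^sup>2 - 1)" .
    have gen: "a / (c / 2) \<le> b / d" if "2 * a * d \<le> b * c" "0 < c" "0 < d" for a b c d :: real
      using that by (simp add: divide_simps mult_ac)
    show ?thesis by (rule gen) (use le E2 E in \<open>auto simp: mult_ac\<close>)
  qed
  also have "\<dots> = (7.71 * real m * (1 / 1460000) ^ m)\<^sup>2"
    by (simp add: E_def power_mult_distrib power_divide)
  finally show ?thesis by (rule power2_le_imp_le) simp
qed

lemma norm_saw_moment_1_coeff_le: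
  assumes "0 < m"
  shows "norm (\<integral>y. of_real (saw_moment 1 y) * cis (- (2 * pi * real m * y)) \<partial>unit_measure)
    \<le> 2 * (real m * (1 / 1460000) ^ m)"
proof -
  have "norm (Gamma (harmonic_arg m) / harmonic_freq m) = norm (Gamma (harmonic_arg m)) / (2 * pi * real m)"
    by (simp add: norm_divide norm_harmonic_freq)
  also have "\<dots> \<le> (7.71 * real m * (1 / 1460000) ^ m) / (2 * 3.1 * 1)"
    using norm_Gamma_harmonic_le[OF assms] pi_approx assms by (intro frac_le mult_mono) auto
  also have "\<dots> \<le> 2 * (real m * (1 / 1460000) ^ m)" by simp
  finally show ?thesis unfolding saw_moment_1_coeff[OF assms] .
qed

text \<open>
  The three summands of the coefficient contribute at most 48.33, 1 and 0.32 times \<open>m\<close>, together less than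
  49.65; the constant 61.5 exceeds \<open>7.71 * 49.65 / (2 * 3.1415)\<close>.
\<close>

lemma norm_saw_moment_2_coeff_le:
  assumes m: "0 < m"
  shows "norm (\<integral>y. of_real (saw_moment 2 y) * cis (- (2 * pi * real m * y)) \<partial>unit_measure)
    \<le> 61.5 * (real m * (1 / 1460000) ^ m)"
proof -
  define y where "y = 2 * pi * real m / ln 2"
  have pi3: "3.14 \<le> pi" using pi_approx by simp
  have y: "0 \<le> y" "y \<le> 9.4249 * real m"
  proof -
    show "0 \<le> y" by (simp add: y_def)
    have "2 * pi \<le> 9.4249 * (2 / 3 :: real)" using pi_approx by simp
    also have "\<dots> \<le> 9.4249 * ln 2" using ln2_ge_two_thirds by (intro mult_left_mono) auto
    finally have "2 * pi * real m \<le> 9.4249 * ln 2 * real m" by (intro mult_right_mono) auto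
    then show "y \<le> 9.4249 * real m" unfolding y_def by (simp add: pos_divide_le_eq mult_ac)
  qed
  have m1: "1 \<le> real m" using m by simp
  have psi: "norm (Digamma (harmonic_arg m)) \<le> 16.11 * real m"
  proof -
    have "norm (Digamma (harmonic_arg m)) \<le> euler_mascheroni + \<bar>y\<bar> * (pi\<^sup>2 / 6)"
      using norm_Digamma_1_minus_i_le[of y] by (simp add: harmonic_arg_def y_def)
    also have "\<bar>y\<bar> * (pi\<^sup>2 / 6) \<le> 9.4249 * real m * (9.8697 / 6)"
      using y pi_sq_bounds by (intro mult_mono) auto
    also have "euler_mascheroni \<le> (13 / 22 :: real)" using euler_mascheroni_less_13_over_22 by simp
    finally have "norm (Digamma (harmonic_arg m)) \<le> 13 / 22 + 9.4249 * real m * (9.8697 / 6)" by simp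
    then show ?thesis using m1 by simp
  qed
  have "norm (- 2 * Digamma (harmonic_arg m) / of_real (ln 2) - 1 - 2 / harmonic_freq m)
      \<le> norm (- 2 * Digamma (harmonic_arg m) / of_real (ln 2)) + 1 + norm (2 / harmonic_freq m)"
    using norm_triangle_ineq4[of "- 2 * Digamma (harmonic_arg m) / of_real (ln 2) - 1" "2 / harmonic_freq m"]
      norm_triangle_ineq4[of "- 2 * Digamma (harmonic_arg m) / of_real (ln 2)" 1] by simp
  also have "norm (- 2 * Digamma (harmonic_arg m) / of_real (ln 2)) = 2 * norm (Digamma (harmonic_arg m)) / ln 2"
    by (simp add: norm_divide norm_mult)
  also have "\<dots> \<le> 2 * (16.11 * real m) / (2 / 3)"
    using psi ln2_ge_two_thirds by (intro frac_le) auto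
  also have "norm (2 / harmonic_freq m) \<le> 1 / 3.14"
  proof -
    have "3.14 * 1 \<le> pi * real m" using pi3 m1 by (intro mult_mono) auto
    then have "1 / (pi * real m) \<le> 1 / 3.14" by (intro divide_left_mono) auto
    moreover have "norm (2 / harmonic_freq m) = 1 / (pi * real m)" by (simp add: norm_divide norm_harmonic_freq)
    ultimately show ?thesis by simp
  qed
  finally have "norm (- 2 * Digamma (harmonic_arg m) / of_real (ln 2) - 1 - 2 / harmonic_freq m) \<le> 49.65 * real m"
    using m1 by simp
  then have "norm (Gamma (harmonic_arg m) / harmonic_freq m * (- 2 * Digamma (harmonic_arg m) / of_real (ln 2) - 1 - 2 / harmonic_freq m))
      \<le> (7.71 * real m * (1 / 1460000) ^ m) / (2 * 3.1415 * real m) * (49.65 * real m)"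
    unfolding norm_mult norm_divide[of "Gamma _"] norm_harmonic_freq
    using norm_Gamma_harmonic_le[OF m] pi_approx m by (intro mult_mono frac_le) auto
  also have "\<dots> = 7.71 * 49.65 / 6.283 * (real m * (1 / 1460000) ^ m)"
    using m by (simp add: field_simps)
  also have "\<dots> \<le> 61.5 * (real m * (1 / 1460000) ^ m)"
    by (intro mult_right_mono) auto
  finally show ?thesis unfolding saw_moment_2_coeff[OF m] .
qed

text \<open>
  Replacing \<open>m\<close> by \<open>2 ^ (m - 1)\<close> makes the sum geometric; the first term carries essentially all of it.
\<close>

lemma sum_linear_geometric_le: "(\<Sum>m=1..<N. real m * (1 / 1460000) ^ m) \<le> (6.8494 / 10 ^ 7)"
proof -
  have "(\<Sum>m=1..<N. real m * (1 / 1460000) ^ m) \<le> (\<Sum>m=1..<N. (1 / 2) * (1 / 730000) ^ m)"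
  proof (rule sum_mono)
    fix m assume "m \<in> {1..<N}"
    then obtain l where l: "m = Suc l" by (cases m) auto
    have "Suc l \<le> 2 ^ l" by (induction l) auto
    then have "real (Suc l) \<le> real (2 ^ l)" by (rule of_nat_mono)
    then have "real m * (1 / 1460000) ^ m \<le> 2 ^ l * (1 / 1460000) ^ m"
      by (intro mult_right_mono) (auto simp: l)
    also have "\<dots> = (1 / 2) * (2 * (1 / 1460000)) ^ m" unfolding l power_mult_distrib by simp
    finally show "real m * (1 / 1460000) ^ m \<le> (1 / 2) * (1 / 730000) ^ m" by simp
  qed
  also have "\<dots> = (1 / 2) * (\<Sum>m=1..<N. (1 / 730000) ^ m)" by (simp only: sum_distrib_left)
  also have "(\<Sum>m=1..<N. (1 / 730000 :: real) ^ m) \<le> (1 / 730000) / (1 - 1 / 730000)"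
  proof -
    have "(\<Sum>m=1..<Suc K. (1 / 730000 :: real) ^ m) \<le> (1 / 730000) / (1 - 1 / 730000) - (1 / 730000) ^ Suc K / (1 - 1 / 730000)" for K
      by (induction K) simp_all
    from this[of "N - 1"] have "(\<Sum>m=1..<Suc (N - 1). (1 / 730000 :: real) ^ m) \<le> (1 / 730000) / (1 - 1 / 730000)"
      by (rule order.trans) simp
    moreover have "{1..<Suc (N - 1)} = {1..<N}" by auto
    ultimately show ?thesis by (simp only:)
  qed
  finally show ?thesis by simp
qed

lemma sum_linear_geometric_scaled_le:
  "0 \<le> c \<Longrightarrow> (\<Sum>m=1..<N. c * (real m * (1 / 1460000) ^ m)) \<le> c * (6.8494 / 10 ^ 7)"
  unfolding sum_distrib_left[symmetric] by (intro mult_left_mono sum_linear_geometric_le)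

lemma saw_moment_1_fluctuation:
  "\<bar>saw_moment 1 x - (euler_mascheroni / ln 2 - 1 / 2)\<bar> \<le> 2.74 / 10 ^ 6"
proof -
  have "\<bar>saw_moment 1 x - (euler_mascheroni / ln 2 - 1 / 2)\<bar> \<le> 2 * (2 * (6.8494 / 10 ^ 7))"
    unfolding saw_moment_1_mean[symmetric]
    by (rule abs_diff_mean_le_periodic[OF saw_moment_continuous saw_moment_periodic norm_saw_moment_1_coeff_le])
       (assumption, rule sum_linear_geometric_scaled_le, simp)
  then show ?thesis by simp
qed

lemma abs_mean_saw_le: "\<bar>euler_mascheroni / ln 2 - 1 / 2 :: real\<bar> \<le> 1 / 2"
proof -
  have "euler_mascheroni / ln 2 \<le> (13 / 22) / (2 / 3 :: real)"
    using euler_mascheroni_less_13_over_22 ln2_ge_two_thirds euler_mascheroni_pos by (intro frac_le) auto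
  also have "\<dots> \<le> (1 :: real)" by simp
  finally have "euler_mascheroni / ln 2 \<le> (1 :: real)" .
  moreover have "0 \<le> euler_mascheroni / ln (2::real)" using euler_mascheroni_pos by simp
  ultimately show ?thesis unfolding abs_le_iff by linarith
qed

lemma abs_saw_moment_1_le_1: "\<bar>saw_moment 1 x\<bar> \<le> 1"
proof -
  have "2.74 / 10 ^ 6 \<le> (1 / 2 :: real)" by simp
  then have "\<bar>saw_moment 1 x - (euler_mascheroni / ln 2 - 1 / 2)\<bar> \<le> 1 / 2"
    using saw_moment_1_fluctuation[of x] by (rule order.trans[rotated])
  then show ?thesis using abs_mean_saw_le by linarith
qed

text \<open>
  The means of the two moments combine to the stated constant, the Euler constant cancelling. The deviation of
  the second moment is at most \<open>2 * 61.5 * 6.8494 / 10 ^ 7\<close>, about \<open>8.42 / 10 ^ 5\<close>, and squaring the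
  first moment adds only a few millionths.
\<close>

lemma saw_variance_fluctuation:
  "\<bar>saw_moment 2 x - (saw_moment 1 x)\<^sup>2 - (1 / 12 + pi\<^sup>2 / (6 * (ln 2)\<^sup>2))\<bar> < 1 / 10 ^ 4"
proof -
  define \<mu> where "\<mu> = euler_mascheroni / ln 2 - (1 / 2 :: real)"
  have d1: "\<bar>saw_moment 1 x - \<mu>\<bar> \<le> (2.74 / 10 ^ 6)"
    unfolding \<mu>_def by (rule saw_moment_1_fluctuation)
  have d2: "\<bar>saw_moment 2 x - ((euler_mascheroni\<^sup>2 + pi\<^sup>2 / 6) / (ln 2)\<^sup>2 - euler_mascheroni / ln 2 + 1 / 3)\<bar>
      \<le> 2 * (61.5 * (6.8494 / 10 ^ 7))"
    unfolding saw_moment_2_mean[symmetric]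
    by (rule abs_diff_mean_le_periodic[OF saw_moment_continuous saw_moment_periodic norm_saw_moment_2_coeff_le])
       (assumption, rule sum_linear_geometric_scaled_le, simp)
  have eq: "(euler_mascheroni\<^sup>2 + pi\<^sup>2 / 6) / (ln 2)\<^sup>2 - euler_mascheroni / ln 2 + 1 / 3
      = \<mu>\<^sup>2 + (1 / 12 + pi\<^sup>2 / (6 * (ln 2)\<^sup>2))"
    unfolding \<mu>_def by (simp add: power2_eq_square field_simps)
  have mu: "\<bar>\<mu>\<bar> \<le> 1 / 2" unfolding \<mu>_def by (rule abs_mean_saw_le)
  define d where "d = saw_moment 1 x - \<mu>"
  have "(saw_moment 1 x)\<^sup>2 - \<mu>\<^sup>2 = d * (2 * \<mu> + d)" by (simp add: d_def power2_eq_square algebra_simps)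
  moreover have "\<bar>d * (2 * \<mu> + d)\<bar> \<le> (2.74 / 10 ^ 6) * 1.1"
  proof -
    have "2.74 / 10 ^ 6 \<le> (1 / 10 :: real)" by simp
    with d1 have "\<bar>d\<bar> \<le> 1 / 10" unfolding d_def by (rule order.trans)
    with mu have "\<bar>2 * \<mu> + d\<bar> \<le> 11 / 10" by linarith
    then show ?thesis unfolding abs_mult using d1 by (intro mult_mono) (auto simp: d_def)
  qed
  ultimately have m1: "\<bar>(saw_moment 1 x)\<^sup>2 - \<mu>\<^sup>2\<bar> \<le> 2.74 / 10 ^ 6 * 1.1" by simp
  have triangle: "\<bar>p - q - v\<bar> \<le> \<bar>p - (r + v)\<bar> + \<bar>q - r\<bar>" for p q r v :: real by linarith
  have "\<bar>saw_moment 2 x - (saw_moment 1 x)\<^sup>2 - (1 / 12 + pi\<^sup>2 / (6 * (ln 2)\<^sup>2))\<bar>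
      \<le> 2 * (61.5 * (6.8494 / 10 ^ 7)) + 2.74 / 10 ^ 6 * 1.1"
    using triangle add_mono[OF d2[unfolded eq] m1] by (rule order.trans)
  also have "\<dots> < 1 / 10 ^ 4" by simp
  finally show ?thesis .
qed


section \<open>Moments from tail probabilities\<close>

text \<open>
  Summation by parts for moments: \<open>\<Sum>k<Z. g k\<close> is the sum of \<open>g k\<close> over all \<open>k\<close>
  with the indicator of \<open>k < Z\<close>. The weights 1 and \<open>2 * k + 1\<close> give \<open>Z\<close> and \<open>Z\<^sup>2\<close>.
\<close>

lemma (in prob_space) expectation_sum_tail:
  fixes Z :: "'a \<Rightarrow> nat" and g :: "nat \<Rightarrow> real"
  assumes Z [measurable]: "Z \<in> M \<rightarrow>\<^sub>M count_space UNIV" and g: "\<And>k. 0 \<le> g k"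
    and summ: "summable (\<lambda>k. g k * prob {\<omega> \<in> space M. k < Z \<omega>})"
  shows "integrable M (\<lambda>\<omega>. \<Sum>k<Z \<omega>. g k)"
    and "expectation (\<lambda>\<omega>. \<Sum>k<Z \<omega>. g k) = (\<Sum>k. g k * prob {\<omega> \<in> space M. k < Z \<omega>})"
proof -
  let ?f = "\<lambda>k \<omega>. g k * indicator {\<omega> \<in> space M. k < Z \<omega>} \<omega> :: real"
  have int: "integrable M (?f k)" for k
    by (intro integrable_mult_right integrable_real_indicator) (auto simp: emeasure_eq_measure)
  have eint: "expectation (?f k) = g k * prob {\<omega> \<in> space M. k < Z \<omega>}" for k
    by simp
  have fin: "?f k \<omega> = 0" if "k \<notin> {..<Z \<omega>}" for k \<omega>
    using that by auto
  have summable: "summable (\<lambda>k. norm (?f k \<omega>))" for \<omega>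
    using fin by (intro summable_finite[of "{..<Z \<omega>}"]) auto
  have sum: "(\<Sum>k. ?f k \<omega>) = (\<Sum>k<Z \<omega>. g k)" if "\<omega> \<in> space M" for \<omega>
    using that fin by (subst suminf_finite[of "{..<Z \<omega>}"]) auto
  have "summable (\<lambda>k. expectation (\<lambda>\<omega>. norm (?f k \<omega>)))"
    using summ g by (simp add: abs_mult)
  note S = integrable_suminf[OF int AE_I2[OF summable] this] integral_suminf[OF int AE_I2[OF summable] this]
  show "integrable M (\<lambda>\<omega>. \<Sum>k<Z \<omega>. g k)"
    using S(1) by (subst (asm) Bochner_Integration.integrable_cong[OF refl sum]) auto
  have "expectation (\<lambda>\<omega>. \<Sum>k<Z \<omega>. g k) = expectation (\<lambda>\<omega>. \<Sum>k. ?f k \<omega>)"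
    by (rule Bochner_Integration.integral_cong) (simp_all add: sum)
  also have "\<dots> = (\<Sum>k. g k * prob {\<omega> \<in> space M. k < Z \<omega>})"
    unfolding S(2) eint ..
  finally show "expectation (\<lambda>\<omega>. \<Sum>k<Z \<omega>. g k) = (\<Sum>k. g k * prob {\<omega> \<in> space M. k < Z \<omega>})" .
qed

lemma sum_odd_upto: "(\<Sum>k<n. 2 * real k + 1) = (real n)\<^sup>2"
  by (induction n) (auto simp: power2_eq_square algebra_simps)

lemma (in prob_space) moments_tail:
  fixes Z :: "'a \<Rightarrow> nat"
  assumes Z: "Z \<in> M \<rightarrow>\<^sub>M count_space UNIV"
    and summ: "summable (\<lambda>k. (2 * real k + 1) * prob {\<omega> \<in> space M. k < Z \<omega>})"
  shows "summable (\<lambda>k. prob {\<omega> \<in> space M. k < Z \<omega>})"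
    and "integrable M (\<lambda>\<omega>. real (Z \<omega>))" and "integrable M (\<lambda>\<omega>. (real (Z \<omega>))\<^sup>2)"
    and "expectation (\<lambda>\<omega>. real (Z \<omega>)) = (\<Sum>k. prob {\<omega> \<in> space M. k < Z \<omega>})"
    and "expectation (\<lambda>\<omega>. (real (Z \<omega>))\<^sup>2) = (\<Sum>k. (2 * real k + 1) * prob {\<omega> \<in> space M. k < Z \<omega>})"
proof -
  show s1: "summable (\<lambda>k. prob {\<omega> \<in> space M. k < Z \<omega>})"
  proof (rule summable_comparison_test'[OF summ, of 0])
    fix k :: nat
    have "1 * prob {\<omega> \<in> space M. k < Z \<omega>} \<le> (2 * real k + 1) * prob {\<omega> \<in> space M. k < Z \<omega>}"
      by (intro mult_right_mono) auto
    then show "norm (prob {\<omega> \<in> space M. k < Z \<omega>}) \<le> (2 * real k + 1) * prob {\<omega> \<in> space M. k < Z \<omega>}" by simp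
  qed
  show "integrable M (\<lambda>\<omega>. real (Z \<omega>))"
    "expectation (\<lambda>\<omega>. real (Z \<omega>)) = (\<Sum>k. prob {\<omega> \<in> space M. k < Z \<omega>})"
    using expectation_sum_tail[OF Z, of "\<lambda>_. 1"] s1 by simp_all
  show "integrable M (\<lambda>\<omega>. (real (Z \<omega>))\<^sup>2)"
    "expectation (\<lambda>\<omega>. (real (Z \<omega>))\<^sup>2) = (\<Sum>k. (2 * real k + 1) * prob {\<omega> \<in> space M. k < Z \<omega>})"
    using expectation_sum_tail[OF Z, of "\<lambda>k. 2 * real k + 1"] summ by (simp_all add: sum_odd_upto)
qed

lemma prob_exp1_gt:
  assumes "0 \<le> c"
  shows "measure exp1 {v. c < v} = exp (- c)"
proof -
  have "distr exp1 lborel (\<lambda>v. v) = exp1"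
    by (rule distr_id2) (simp add: exp1_def)
  then have "distributed exp1 lborel (\<lambda>v. v) (exponential_density 1)"
    unfolding distributed_def by (auto simp: exp1_def[symmetric])
  from exp1.exponential_distributedD_gt[OF this assms] show ?thesis by simp
qed

definition round_log :: "real \<Rightarrow> real \<Rightarrow> int" where
  "round_log x v = \<lfloor>neg_log2 v + x\<rfloor>"

lemma measurable_round_log [measurable]: "round_log x \<in> exp1 \<rightarrow>\<^sub>M count_space UNIV"
  unfolding round_log_def by measurable

lemma prob_round_log_less:
  "measure exp1 {v. round_log x v < k} = exp (- (2 powr (x - real_of_int k)))"
proof -
  have "measure exp1 {v. round_log x v < k} = measure exp1 {v. 2 powr (x - real_of_int k) < v}"
  proof (rule exp1.finite_measure_eq_AE)
    show "AE v in exp1. v \<in> {v. round_log x v < k} \<longleftrightarrow> v \<in> {v. 2 powr (x - real_of_int k) < v}"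
      using AE_exp1_pos
    proof eventually_elim
      case (elim v)
      have "round_log x v < k \<longleftrightarrow> neg_log2 v < real_of_int k - x"
        unfolding round_log_def floor_less_iff by linarith
      also have "\<dots> \<longleftrightarrow> ln 2 * (x - real_of_int k) < ln v"
        by (simp add: neg_log2_def field_simps)
      also have "\<dots> \<longleftrightarrow> exp (ln 2 * (x - real_of_int k)) < exp (ln v)" by simp
      also have "\<dots> \<longleftrightarrow> 2 powr (x - real_of_int k) < v" using elim by (simp add: powr_def mult.commute)
      finally show ?case by simp
    qed
  qed measurable
  then show ?thesis by (simp add: prob_exp1_gt)
qed

lemma summable_odd_geometric: "summable (\<lambda>k. (2 * real k + 1) * r ^ k)" if "0 \<le> r" "r < 1" for r :: real
proof -
  have "summable (\<lambda>k. real (Suc k) * r ^ k)"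
    using that geometric_deriv_sums[of r] by (auto simp: sums_iff)
  then have "summable (\<lambda>k. 2 * (real (Suc k) * r ^ k) - r ^ k)"
    using that by (intro summable_diff summable_mult summable_geometric) auto
  then show ?thesis by (simp add: algebra_simps)
qed

text \<open>
  The rounded variable takes negative values, so its positive and negative parts are treated separately: \<open>q k\<close>
  is the probability that it exceeds \<open>k\<close>, and \<open>r k\<close> that it is less than \<open>- k\<close>. The two
  parts have disjoint supports, so their squares add up to the square.
\<close>

lemma round_log_moments:
  fixes n :: nat
  assumes n: "0 < n"
  defines "x \<equiv> log 2 (real n) - 2"
  defines "q \<equiv> \<lambda>k. 1 - exp (- (real n / 2 ^ (k + 3)))"
    and "r \<equiv> \<lambda>k. exp (- (real n / 4 * 2 ^ k))"
  shows "summable (\<lambda>k. (2 * real k + 1) * q k)" "summable q"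
    and "summable (\<lambda>k. (2 * real k + 1) * r k)" "summable r"
    and "x + saw_moment 1 x = (\<Sum>k. q k) - (\<Sum>k. r k)"
    and "saw_moment 2 x + 2 * x * saw_moment 1 x + x\<^sup>2 = (\<Sum>k. (2 * real k + 1) * q k) + (\<Sum>k. (2 * real k + 1) * r k)"
proof -
  let ?Z = "\<lambda>v. nat (round_log x v)" and ?N = "\<lambda>v. nat (- round_log x v)"
  have [measurable]: "?Z \<in> exp1 \<rightarrow>\<^sub>M count_space UNIV" "?N \<in> exp1 \<rightarrow>\<^sub>M count_space UNIV" by measurable
  have pow: "2 powr (x - real_of_int k) = real n / 4 * 2 powr (- real_of_int k)" for k
    using n by (simp add: x_def powr_diff powr_minus powr_add diff_diff_eq divide_simps)
  have pq: "measure exp1 {v \<in> space exp1. k < ?Z v} = q k" for k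
  proof -
    have "{v \<in> space exp1. k < ?Z v} = space exp1 - {v. round_log x v < int k + 1}" by auto
    then have "measure exp1 {v \<in> space exp1. k < ?Z v} = 1 - measure exp1 {v. round_log x v < int k + 1}"
      by (simp only:) (rule exp1.prob_compl, measurable)
    also have "measure exp1 {v. round_log x v < int k + 1} = exp (- (real n / 4 * 2 powr (- real_of_int (int k + 1))))"
      unfolding prob_round_log_less pow ..
    also have "2 powr (- real_of_int (int k + 1)) = 1 / 2 ^ (k + 1)"
    proof -
      have "real_of_int (int k + 1) = real (k + 1)" by simp
      then show ?thesis by (simp only: powr_minus_divide) (subst powr_realpow, simp_all)
    qed
    finally show ?thesis by (simp add: q_def power_add)
  qed
  have pr: "measure exp1 {v \<in> space exp1. k < ?N v} = r k" for k
  proof -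
    have "{v \<in> space exp1. k < ?N v} = {v. round_log x v < - int k}" by auto
    then have "measure exp1 {v \<in> space exp1. k < ?N v} = exp (- (real n / 4 * 2 powr (- real_of_int (- int k))))"
      unfolding prob_round_log_less[symmetric] pow[symmetric] by simp
    then show ?thesis by (simp add: r_def powr_realpow)
  qed
  show s2: "summable (\<lambda>k. (2 * real k + 1) * q k)"
  proof (rule summable_comparison_test'[of _ 0])
    show "summable (\<lambda>k. real n / 8 * ((2 * real k + 1) * (1 / 2) ^ k))"
      by (intro summable_mult summable_odd_geometric) auto
    fix k :: nat
    have "1 - real n / 2 ^ (k + 3) \<le> exp (- (real n / 2 ^ (k + 3)))"
      using exp_ge_add_one_self[of "- (real n / 2 ^ (k + 3))"] by simp
    then have "q k \<le> real n / 2 ^ (k + 3)" unfolding q_def by linarith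
    moreover have "0 \<le> q k" by (simp add: q_def)
    moreover have "norm ((2 * real k + 1) * q k) = (2 * real k + 1) * q k"
      using calculation(2) by simp
    ultimately have "norm ((2 * real k + 1) * q k) \<le> (2 * real k + 1) * (real n / 2 ^ (k + 3))"
      by (simp only:) (intro mult_left_mono, simp_all)
    also have "\<dots> = real n / 8 * ((2 * real k + 1) * (1 / 2) ^ k)"
      by (simp add: power_add power_divide mult_ac)
    finally show "norm ((2 * real k + 1) * q k) \<le> real n / 8 * ((2 * real k + 1) * (1 / 2) ^ k)" .
  qed
  show s3: "summable (\<lambda>k. (2 * real k + 1) * r k)"
  proof (rule summable_comparison_test'[of _ 0])
    show "summable (\<lambda>k. (2 * real k + 1) * exp (- (1 / 4)) ^ k)"
      by (intro summable_odd_geometric) auto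
    fix k :: nat
    have "k \<le> 2 ^ k" by simp
    then have "real k \<le> real (2 ^ k)" by (rule of_nat_mono)
    then have "real k * (1 / 4) \<le> 1 / 4 * 2 ^ k" by simp
    also have "\<dots> \<le> real n / 4 * 2 ^ k" using n by (intro mult_right_mono) auto
    finally have "- (real n / 4 * 2 ^ k) \<le> real k * - (1 / 4)" by linarith
    then have "r k \<le> exp (real k * - (1 / 4))" unfolding r_def by (rule exp_le_cancel_iff[THEN iffD2])
    also have "\<dots> = exp (- (1 / 4)) ^ k" by (rule exp_of_nat_mult)
    finally show "norm ((2 * real k + 1) * r k) \<le> (2 * real k + 1) * exp (- (1 / 4)) ^ k"
      by (simp add: r_def mult_left_mono)
  qed
  note Z = exp1.moments_tail[of ?Z, unfolded pq, OF _ s2]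
  note N = exp1.moments_tail[of ?N, unfolded pr, OF _ s3]
  show "summable q" "summable r" using Z(1) N(1) by simp_all
  have split: "real_of_int (round_log x v) = real (?Z v) - real (?N v)"
    "(real_of_int (round_log x v))\<^sup>2 = (real (?Z v))\<^sup>2 + (real (?N v))\<^sup>2" for v
    by (cases "0 \<le> round_log x v"; simp)+
  have iR: "integrable exp1 (\<lambda>v. real_of_int (round_log x v))"
    unfolding split using Z(2) N(2) by simp
  have iR2: "integrable exp1 (\<lambda>v. (real_of_int (round_log x v))\<^sup>2)"
    unfolding split(2) using Z(3) N(3) by simp
  have e1: "(\<integral>v. real_of_int (round_log x v) \<partial>exp1) = (\<Sum>k. q k) - (\<Sum>k. r k)"
    unfolding split using Z(2,4) N(2,4) by simp
  have e2: "(\<integral>v. (real_of_int (round_log x v))\<^sup>2 \<partial>exp1)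
      = (\<Sum>k. (2 * real k + 1) * q k) + (\<Sum>k. (2 * real k + 1) * r k)"
    unfolding split(2) using Z(3,5) N(3,5) by simp
  have m1: "saw_moment 1 x = (\<integral>v. real_of_int (round_log x v) \<partial>exp1) - x"
    unfolding saw_moment_def round_log_def[symmetric] using iR by (simp add: exp1.prob_space[simplified])
  have "saw_moment 2 x = (\<integral>v. (real_of_int (round_log x v))\<^sup>2 - 2 * x * real_of_int (round_log x v) + x\<^sup>2 \<partial>exp1)"
    unfolding saw_moment_def round_log_def[symmetric]
    by (rule Bochner_Integration.integral_cong) (simp_all add: power2_eq_square algebra_simps)
  also have "\<dots> = (\<integral>v. (real_of_int (round_log x v))\<^sup>2 \<partial>exp1) - 2 * x * (\<integral>v. real_of_int (round_log x v) \<partial>exp1) + x\<^sup>2"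
    using iR iR2 by (simp add: exp1.prob_space[simplified])
  finally have m2: "saw_moment 2 x = (\<integral>v. (real_of_int (round_log x v))\<^sup>2 \<partial>exp1)
      - 2 * x * (\<integral>v. real_of_int (round_log x v) \<partial>exp1) + x\<^sup>2" .
  show "x + saw_moment 1 x = (\<Sum>k. q k) - (\<Sum>k. r k)"
    using m1 e1 by simp
  show "saw_moment 2 x + 2 * x * saw_moment 1 x + x\<^sup>2 = (\<Sum>k. (2 * real k + 1) * q k) + (\<Sum>k. (2 * real k + 1) * r k)"
    unfolding e2[symmetric] m2 m1 by (simp add: power2_eq_square algebra_simps)
qed


section \<open>Comparison of the variances\<close>

text \<open>
  The first series compares the tails on the nonnegative integers, the second one accounts for the
  negative values of the rounded variable, whose probability is doubly exponentially small. The weights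
  are those of the second moment and dominate those of the first.
\<close>

definition run_error :: "nat \<Rightarrow> real" where
  "run_error n =
     (\<Sum>k. (2 * real k + 1) *
        \<bar>measure_pmf.prob (random_composition n) {xs. longest_run xs < k + 1} - exp (- (real n / 2 ^ (k + 3)))\<bar>)
     + (\<Sum>k. (2 * real k + 1) * exp (- (real n / 4 * 2 ^ k)))"

lemma longest_run_composition_le:
  assumes "xs \<in> compositions n"
  shows "longest_run xs < n + 1"
  unfolding longest_run_less_iff
proof (intro allI notI)
  fix a assume "sublist (replicate (n + 1) a) xs"
  then have "n + 1 \<le> length xs" using sublist_length_le by fastforce
  also have "\<dots> \<le> n" using assms length_le_sum_list_pos by (auto simp: compositions_def)
  finally show False by simp
qed

lemma prob_longest_run_gt:
  "measure_pmf.prob (random_composition n) {xs. k < longest_run xs}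
     = 1 - measure_pmf.prob (random_composition n) {xs. longest_run xs < k + 1}"
proof -
  have "{xs. k < longest_run xs} = space (measure_pmf (random_composition n)) - {xs. longest_run xs < k + 1}"
    by auto
  then show ?thesis by (simp only:) (rule measure_pmf.prob_compl, simp)
qed

lemma prob_longest_run_gt_size:
  assumes "n \<le> k"
  shows "measure_pmf.prob (random_composition n) {xs. k < longest_run xs} = 0"
proof -
  have "set_pmf (random_composition n) = compositions n"
    unfolding random_composition_def by (rule set_pmf_of_set[OF compositions_nonempty finite_compositions])
  then have "set_pmf (random_composition n) \<inter> {xs. k < longest_run xs} = {}"
    using longest_run_composition_le assms by fastforce
  then show ?thesis by (simp add: measure_pmf_zero_iff)
qed

lemma run_error_summable:
  assumes "0 < n"
  shows "summable (\<lambda>k. (2 * real k + 1) *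
        \<bar>measure_pmf.prob (random_composition n) {xs. longest_run xs < k + 1} - exp (- (real n / 2 ^ (k + 3)))\<bar>)"
proof -
  have "\<forall>\<^sub>F k in sequentially. (2 * real k + 1) * (1 - exp (- (real n / 2 ^ (k + 3))))
     = (2 * real k + 1) *
        \<bar>measure_pmf.prob (random_composition n) {xs. longest_run xs < k + 1} - exp (- (real n / 2 ^ (k + 3)))\<bar>"
    using eventually_ge_at_top[of n]
  proof eventually_elim
    case (elim k)
    then show ?case using prob_longest_run_gt_size[OF elim] prob_longest_run_gt[of n k] by simp
  qed
  from summable_cong[OF this] round_log_moments(1)[OF assms] show ?thesis by simp
qed

text \<open>
  Both first and both second moments differ by at most the error. The variance involves the square of
  the first moment, which multiplies the error by the size of the first moments, about \<open>2 * x\<close>.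
\<close>

lemma variance_longest_run_approx:
  fixes n :: nat
  assumes n: "0 < n"
  defines "x \<equiv> log 2 (real n) - 2"
  shows "\<bar>measure_pmf.variance (random_composition n) (\<lambda>xs. real (longest_run xs))
            - (saw_moment 2 x - (saw_moment 1 x)\<^sup>2)\<bar>
    \<le> run_error n + run_error n * (2 * (\<bar>x\<bar> + 1) + run_error n)"
proof -
  let ?M = "random_composition n"
  define p where "p = (\<lambda>k. measure_pmf.prob ?M {xs. k < longest_run xs})"
  define q where "q = (\<lambda>k. 1 - exp (- (real n / 2 ^ (k + 3))))"
  define r where "r = (\<lambda>k. exp (- (real n / 4 * 2 ^ k)))"
  have rl: "summable (\<lambda>k. (2 * real k + 1) * q k)" "summable q"
    "summable (\<lambda>k. (2 * real k + 1) * r k)" "summable r"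
    "x + saw_moment 1 x = (\<Sum>k. q k) - (\<Sum>k. r k)"
    "saw_moment 2 x + 2 * x * saw_moment 1 x + x\<^sup>2 = (\<Sum>k. (2 * real k + 1) * q k) + (\<Sum>k. (2 * real k + 1) * r k)"
    using round_log_moments[OF n] unfolding x_def q_def r_def by blast+
  have fin: "(2 * real k + 1) * p k = 0" if "k \<notin> {..<n}" for k
    using that prob_longest_run_gt_size[of n k] by (simp add: p_def)
  have summ: "summable (\<lambda>k. (2 * real k + 1) * p k)"
    using fin by (intro summable_finite[of "{..<n}"]) auto
  have Z: "summable p" "integrable ?M (\<lambda>xs. real (longest_run xs))" "integrable ?M (\<lambda>xs. (real (longest_run xs))\<^sup>2)"
      "measure_pmf.expectation ?M (\<lambda>xs. real (longest_run xs)) = (\<Sum>k. p k)"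
      "measure_pmf.expectation ?M (\<lambda>xs. (real (longest_run xs))\<^sup>2) = (\<Sum>k. (2 * real k + 1) * p k)"
    using measure_pmf.moments_tail[of longest_run ?M] summ by (simp_all add: p_def)
  define A1 where "A1 = measure_pmf.expectation ?M (\<lambda>xs. real (longest_run xs))"
  define A2 where "A2 = measure_pmf.expectation ?M (\<lambda>xs. (real (longest_run xs))\<^sup>2)"
  define B1 where "B1 = x + saw_moment 1 x"
  define B2 where "B2 = saw_moment 2 x + 2 * x * saw_moment 1 x + x\<^sup>2"
  have var: "measure_pmf.variance ?M (\<lambda>xs. real (longest_run xs)) = A2 - A1\<^sup>2"
    unfolding A1_def A2_def by (rule measure_pmf.variance_eq[OF Z(2,3)])
  have V: "saw_moment 2 x - (saw_moment 1 x)\<^sup>2 = B2 - B1\<^sup>2"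
    by (simp add: B1_def B2_def power2_eq_square algebra_simps)
  define E where "E = (\<lambda>k. \<bar>p k - q k\<bar>)"
  have E: "E k = \<bar>measure_pmf.prob ?M {xs. longest_run xs < k + 1} - exp (- (real n / 2 ^ (k + 3)))\<bar>" for k
    unfolding E_def p_def q_def prob_longest_run_gt by simp
  have sE: "summable (\<lambda>k. (2 * real k + 1) * E k)"
    unfolding E by (rule run_error_summable[OF n])
  have err: "run_error n = (\<Sum>k. (2 * real k + 1) * E k) + (\<Sum>k. (2 * real k + 1) * r k)"
    unfolding run_error_def E r_def ..
  have E0: "0 \<le> E k" for k by (simp add: E_def)
  have r0: "0 \<le> r k" for k by (simp add: r_def)
  have w: "y \<le> (2 * real k + 1) * y" if "0 \<le> y" for y k
    using mult_right_mono[of 1 "2 * real k + 1" y] that by simp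
  have sE1: "summable E"
    by (rule summable_comparison_test'[OF sE, of 0]) (use w E0 in auto)
  have d2: "\<bar>A2 - B2\<bar> \<le> run_error n"
  proof -
    have "A2 - B2 = (\<Sum>k. (2 * real k + 1) * p k - (2 * real k + 1) * q k) - (\<Sum>k. (2 * real k + 1) * r k)"
      unfolding A2_def B2_def Z(5) rl(6) using suminf_diff[OF summ rl(1)] by simp
    moreover have "\<bar>\<Sum>k. (2 * real k + 1) * p k - (2 * real k + 1) * q k\<bar> \<le> (\<Sum>k. (2 * real k + 1) * E k)"
      unfolding real_norm_def[symmetric]
      by (rule norm_suminf_le[OF _ sE]) (simp add: E_def right_diff_distrib[symmetric] abs_mult)
    moreover have "0 \<le> (\<Sum>k. (2 * real k + 1) * r k)"
      using r0 by (intro suminf_nonneg rl(3)) auto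
    ultimately show ?thesis unfolding err by linarith
  qed
  have d1: "\<bar>A1 - B1\<bar> \<le> run_error n"
  proof -
    have "A1 - B1 = (\<Sum>k. p k - q k) + (\<Sum>k. r k)"
      unfolding A1_def B1_def Z(4) rl(5) using suminf_diff[OF Z(1) rl(2)] by simp
    moreover have "\<bar>\<Sum>k. p k - q k\<bar> \<le> (\<Sum>k. E k)"
      unfolding real_norm_def[symmetric]
      by (rule norm_suminf_le[OF _ sE1]) (simp add: E_def)
    moreover have "(\<Sum>k. E k) \<le> (\<Sum>k. (2 * real k + 1) * E k)"
      by (rule suminf_le[OF w[OF E0] sE1 sE])
    moreover have "(\<Sum>k. r k) \<le> (\<Sum>k. (2 * real k + 1) * r k)"
      by (rule suminf_le[OF w[OF r0] rl(4) rl(3)])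
    moreover have "0 \<le> (\<Sum>k. r k)"
      using r0 by (intro suminf_nonneg rl(4)) auto
    ultimately show ?thesis unfolding err by linarith
  qed
  have "\<bar>B1\<bar> \<le> \<bar>x\<bar> + 1" unfolding B1_def using abs_saw_moment_1_le_1[of x] by linarith
  moreover have "\<bar>A1 + B1\<bar> \<le> \<bar>A1 - B1\<bar> + 2 * \<bar>B1\<bar>" by linarith
  ultimately have s: "\<bar>A1 + B1\<bar> \<le> 2 * (\<bar>x\<bar> + 1) + run_error n"
    using d1 unfolding distrib_left by linarith
  have "\<bar>(A1 - B1) * (A1 + B1)\<bar> \<le> run_error n * (2 * (\<bar>x\<bar> + 1) + run_error n)"
    unfolding abs_mult using d1 s by (intro mult_mono) auto
  moreover have "(A2 - A1\<^sup>2) - (B2 - B1\<^sup>2) = (A2 - B2) - (A1 - B1) * (A1 + B1)"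
    by (simp add: power2_eq_square algebra_simps)
  ultimately show ?thesis unfolding var V using d2 by linarith
qed

text \<open>
  Below the cut both distribution functions are at most their values at \<open>K\<close>. The factor 3 bounds \<open>exp 1\<close>
  and absorbs the shift by \<open>2 * K + 2 \<le> 2 ^ (K + 2)\<close>.
\<close>

lemma prob_longest_run_less_small:
  assumes "k < K" "1 \<le> K" "0 < n"
  shows "\<bar>measure_pmf.prob (random_composition n) {xs. longest_run xs < k + 1} - exp (- (real n / 2 ^ (k + 3)))\<bar>
     \<le> 3 * exp (- (real n / 2 ^ (K + 2)))"
proof -
  have "measure_pmf.prob (random_composition n) {xs. longest_run xs < k + 1} \<le> ones_free_prob (k + 1) n"
    using assms by (intro prob_longest_run_less_le)
  also have "\<dots> \<le> ones_free_prob K n" using assms by (intro ones_free_prob_antimono) auto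
  also have "\<dots> \<le> exp (- (real n - real (2 * K + 2)) / 2 ^ (K + 2))"
    using assms by (intro ones_free_prob_le_exp) auto
  also have "\<dots> = exp (- (real n / 2 ^ (K + 2))) * exp (real (2 * K + 2) / 2 ^ (K + 2))"
    by (simp add: exp_add[symmetric] diff_divide_distrib)
  also have "exp (real (2 * K + 2) / 2 ^ (K + 2)) \<le> 3"
  proof -
    have "2 * K + 2 \<le> 2 ^ (K + 2)" by (induction K) auto
    then have "real (2 * K + 2) \<le> real (2 ^ (K + 2))" by (rule of_nat_mono)
    then have "real (2 * K + 2) / 2 ^ (K + 2) \<le> 1" by simp
    then have "exp (real (2 * K + 2) / 2 ^ (K + 2)) \<le> exp 1" by (rule exp_le_cancel_iff[THEN iffD2])
    then show ?thesis using exp_le by (rule order.trans)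
  qed
  finally have 1: "measure_pmf.prob (random_composition n) {xs. longest_run xs < k + 1} \<le> 3 * exp (- (real n / 2 ^ (K + 2)))"
    by (simp add: mult_left_mono)
  have "(2::real) ^ (k + 3) \<le> 2 ^ (K + 2)" using assms by (intro power_increasing) auto
  then have "real n / 2 ^ (K + 2) \<le> real n / 2 ^ (k + 3)" by (intro divide_left_mono) auto
  then have 2: "exp (- (real n / 2 ^ (k + 3))) \<le> exp (- (real n / 2 ^ (K + 2)))" by simp
  have 3: "0 \<le> measure_pmf.prob (random_composition n) {xs. longest_run xs < k + 1}" by simp
  have "\<bar>u - v\<bar> \<le> 3 * e" if "0 \<le> u" "u \<le> 3 * e" "0 < v" "v \<le> e" for u v e :: real
    using that by linarith
  from this[OF 3 1 exp_gt_zero 2] show ?thesis .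
qed

lemma prob_longest_run_less_large:
  assumes "6 \<le> k" "0 < n"
  shows "\<bar>measure_pmf.prob (random_composition n) {xs. longest_run xs < k + 1} - exp (- (real n / 2 ^ (k + 3)))\<bar>
     \<le> (real k + 61) / 2 ^ (k + 1) + 4 * real (n + 1) / 4 ^ (k + 1)"
proof -
  have "\<bar>ones_free_prob (k + 1) n - exp (- (real n / 2 ^ (k + 3)))\<bar> \<le> (real k + 61) / 2 ^ (k + 1)"
  proof -
    have e: "k + 1 + 2 = k + 3" "real (k + 1) + 60 = real k + 61" by simp_all
    show ?thesis using ones_free_prob_approx[of "k + 1" n] assms unfolding e by simp
  qed
  moreover have "measure_pmf.prob (random_composition n) {xs. longest_run xs < k + 1} \<le> ones_free_prob (k + 1) n"
    using assms by (intro prob_longest_run_less_le)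
  moreover have "ones_free_prob (k + 1) n \<le> measure_pmf.prob (random_composition n) {xs. longest_run xs < k + 1}
      + 4 * real (n + 1) / 4 ^ (k + 1)"
    using assms by (intro ones_free_prob_le_prob_longest_run_less) auto
  ultimately show ?thesis by linarith
qed

lemma summable_square_geometric: "summable (\<lambda>j. (real j + 1)\<^sup>2 * (1 / 2) ^ j)"
proof (rule summable_comparison_test'[of _ 0])
  \<comment> \<open>The square is dominated by a power of \<open>3 / 2\<close>, which leaves the ratio \<open>3 / 4\<close>.\<close>
  show "summable (\<lambda>j. (2 / ln (3 / 2)) ^ 2 * exp (ln (3 / 2)) * (3 / 4 :: real) ^ j)"
    by (intro summable_mult summable_geometric) simp
  fix j :: nat
  have "(real j + 1)\<^sup>2 \<le> (real 2 / ln (3 / 2)) ^ 2 * exp (ln (3 / 2) * (real j + 1))"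
    by (rule power_le_exp) auto
  also have "exp (ln (3 / 2) * (real j + 1)) = exp (ln (3 / 2)) * (3 / 2 :: real) ^ j"
    by (simp add: distrib_left exp_add exp_of_nat2_mult)
  finally have "(real j + 1)\<^sup>2 * (1 / 2) ^ j
      \<le> (2 / ln (3 / 2)) ^ 2 * (exp (ln (3 / 2)) * (3 / 2) ^ j) * (1 / 2) ^ j"
    by (intro mult_right_mono) auto
  also have "\<dots> = (2 / ln (3 / 2)) ^ 2 * exp (ln (3 / 2)) * (3 / 4) ^ j"
    by (simp only: mult.assoc power_mult_distrib[symmetric]) simp
  finally show "norm ((real j + 1)\<^sup>2 * (1 / 2) ^ j) \<le> (2 / ln (3 / 2)) ^ 2 * exp (ln (3 / 2)) * (3 / 4 :: real) ^ j"
    by simp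
qed

text \<open>
  The sum is cut at \<open>K\<close>. In the upper part \<open>k = K + j\<close>, and every factor linear in \<open>k\<close> is bounded by a
  multiple of \<open>(K + 1) * (j + 1)\<close>, which splits off a convergent series in \<open>j\<close>.
\<close>

lemma run_error_le:
  assumes K: "6 \<le> K" and n: "0 < n"
  defines "S \<equiv> (\<Sum>j. (real j + 1)\<^sup>2 * (1 / 2) ^ j)"
    and "R \<equiv> (\<Sum>k. (2 * real k + 1) * exp (- (1 / 4)) ^ k)"
  shows "run_error n \<le> 3 * (real K)\<^sup>2 * exp (- (real n / 2 ^ (K + 2)))
     + S * (62 * (real K + 1)\<^sup>2 / 2 ^ K + 4 * real n * (real K + 1) / 4 ^ K) + exp (- (real n / 4)) * R"
proof -
  define E where "E = (\<lambda>k. \<bar>measure_pmf.prob (random_composition n) {xs. longest_run xs < k + 1} - exp (- (real n / 2 ^ (k + 3)))\<bar>)"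
  have sE: "summable (\<lambda>k. (2 * real k + 1) * E k)"
    unfolding E_def by (rule run_error_summable[OF n])
  have "(\<Sum>k. (2 * real k + 1) * E k) = (\<Sum>j. (2 * real (j + K) + 1) * E (j + K)) + (\<Sum>k<K. (2 * real k + 1) * E k)"
    by (rule suminf_split_initial_segment[OF sE])
  also have "(\<Sum>k<K. (2 * real k + 1) * E k) \<le> (\<Sum>k<K. (2 * real k + 1) * (3 * exp (- (real n / 2 ^ (K + 2)))))"
    using prob_longest_run_less_small[of _ K n] K n
    by (intro sum_mono mult_left_mono) (auto simp: E_def)
  also have "\<dots> = 3 * (real K)\<^sup>2 * exp (- (real n / 2 ^ (K + 2)))"
    by (subst sum_distrib_right[symmetric]) (simp add: sum_odd_upto)
  also have "(\<Sum>j. (2 * real (j + K) + 1) * E (j + K))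
      \<le> (\<Sum>j. (real j + 1)\<^sup>2 * (1 / 2) ^ j * (62 * (real K + 1)\<^sup>2 / 2 ^ K + 4 * real n * (real K + 1) / 4 ^ K))"
  proof (rule suminf_le)
    show "summable (\<lambda>j. (2 * real (j + K) + 1) * E (j + K))"
      using sE by (rule summable_ignore_initial_segment)
    show "summable (\<lambda>j. (real j + 1)\<^sup>2 * (1 / 2) ^ j * (62 * (real K + 1)\<^sup>2 / 2 ^ K + 4 * real n * (real K + 1) / 4 ^ K))"
      by (intro summable_mult2 summable_square_geometric)
    fix j :: nat
    let ?J = "real j + 1" and ?K = "real K + 1"
    have JK: "1 * 1 \<le> ?J * ?K" by (intro mult_mono) auto
    have a: "2 * real (j + K) + 1 \<le> 2 * (?K * ?J)"
      by (simp add: algebra_simps)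
    have b: "real (j + K) + 61 \<le> 62 * (?K * ?J)"
    proof -
      have "0 \<le> real K * real j" by simp
      then show ?thesis by (simp add: algebra_simps)
    qed
    have "E (j + K) \<le> (real (j + K) + 61) / 2 ^ (j + K + 1) + 4 * real (n + 1) / 4 ^ (j + K + 1)"
      unfolding E_def using K n by (intro prob_longest_run_less_large) auto
    also have "(real (j + K) + 61) / 2 ^ (j + K + 1) \<le> 62 * (?K * ?J) / 2 ^ (j + K + 1)"
      using b by (intro divide_right_mono) auto
    also have "62 * (?K * ?J) / 2 ^ (j + K + 1) = 31 * (?K * ?J) / (2 ^ j * 2 ^ K)"
      by (simp add: power_add)
    also have "4 * real (n + 1) / 4 ^ (j + K + 1) \<le> 4 * (2 * real n) / 4 ^ (j + K + 1)"
      using n by (intro divide_right_mono) auto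
    also have "4 * (2 * real n) / 4 ^ (j + K + 1) = 2 * real n / (4 ^ j * 4 ^ K)"
      by (simp add: power_add)
    also have "2 * real n / (4 ^ j * 4 ^ K) \<le> 2 * real n * ?J / (2 ^ j * 4 ^ K)"
    proof (rule frac_le)
      show "2 * real n \<le> 2 * real n * ?J" by (simp add: algebra_simps)
      show "2 ^ j * 4 ^ K \<le> (4 ^ j * 4 ^ K :: real)" by (intro mult_right_mono power_mono) auto
    qed auto
    finally have "E (j + K) \<le> 31 * (?K * ?J) / (2 ^ j * 2 ^ K) + 2 * real n * ?J / (2 ^ j * 4 ^ K)" by simp
    then have "(2 * real (j + K) + 1) * E (j + K)
        \<le> 2 * (?K * ?J) * (31 * (?K * ?J) / (2 ^ j * 2 ^ K) + 2 * real n * ?J / (2 ^ j * 4 ^ K))"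
      using a by (intro mult_mono) (auto simp: E_def)
    also have "\<dots> = ?J\<^sup>2 * (1 / 2) ^ j * (62 * ?K\<^sup>2 / 2 ^ K + 4 * real n * ?K / 4 ^ K)"
    proof -
      have "2 * (k * J) * (31 * (k * J) / (a * b) + 2 * m * J / (a * c))
          = J\<^sup>2 * (1 / a) * (62 * k\<^sup>2 / b + 4 * m * k / c)" for k J m a b c :: real
        by (simp add: power2_eq_square distrib_left mult_ac)
      then show ?thesis unfolding power_one_over .
    qed
    finally show "(2 * real (j + K) + 1) * E (j + K)
        \<le> ?J\<^sup>2 * (1 / 2) ^ j * (62 * ?K\<^sup>2 / 2 ^ K + 4 * real n * ?K / 4 ^ K)" .
  qed
  also have "\<dots> = S * (62 * (real K + 1)\<^sup>2 / 2 ^ K + 4 * real n * (real K + 1) / 4 ^ K)"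
    unfolding S_def by (rule suminf_mult2[OF summable_square_geometric, symmetric])
  finally have "(\<Sum>k. (2 * real k + 1) * E k) \<le> 3 * (real K)\<^sup>2 * exp (- (real n / 2 ^ (K + 2)))
     + S * (62 * (real K + 1)\<^sup>2 / 2 ^ K + 4 * real n * (real K + 1) / 4 ^ K)" by simp
  moreover have "(\<Sum>k. (2 * real k + 1) * exp (- (real n / 4 * 2 ^ k))) \<le> exp (- (real n / 4)) * R"
  proof -
    have sR: "summable (\<lambda>k. (2 * real k + 1) * exp (- (1 / 4)) ^ k)"
      by (intro summable_odd_geometric) auto
    have "(\<Sum>k. (2 * real k + 1) * exp (- (real n / 4 * 2 ^ k)))
        \<le> (\<Sum>k. exp (- (real n / 4)) * ((2 * real k + 1) * exp (- (1 / 4)) ^ k))"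
    proof (rule suminf_le[OF _ round_log_moments(3)[OF n] summable_mult[OF sR]])
      fix k :: nat
      have "Suc k \<le> 2 ^ k" by (induction k) auto
      then have "real (Suc k) \<le> real (2 ^ k)" by (rule of_nat_mono)
      then have "real n / 4 * (real k + 1) \<le> real n / 4 * 2 ^ k" by (intro mult_left_mono) auto
      moreover have "1 / 4 * real k \<le> real n / 4 * real k" using n by (intro mult_right_mono) auto
      ultimately have "- (real n / 4 * 2 ^ k) \<le> - (real n / 4) + real k * - (1 / 4)" by (simp add: algebra_simps)
      then have "exp (- (real n / 4 * 2 ^ k)) \<le> exp (- (real n / 4)) * exp (- (1 / 4)) ^ k"
        unfolding exp_of_nat_mult[symmetric] exp_add[symmetric] by simp
      then show "(2 * real k + 1) * exp (- (real n / 4 * 2 ^ k))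
          \<le> exp (- (real n / 4)) * ((2 * real k + 1) * exp (- (1 / 4)) ^ k)"
        by (simp add: mult_left_mono mult.left_commute)
    qed
    also have "\<dots> = exp (- (real n / 4)) * R" unfolding R_def by (rule suminf_mult[OF sR])
    finally show ?thesis .
  qed
  ultimately show ?thesis unfolding run_error_def E_def by linarith
qed

lemma run_error_nonneg:
  assumes "0 < n"
  shows "0 \<le> run_error n"
  unfolding run_error_def
  using round_log_moments(3)[OF assms] run_error_summable[OF assms]
  by (intro add_nonneg_nonneg suminf_nonneg) auto


text \<open>
  The cut \<open>K\<close> near \<open>3 / 4 * log 2 n\<close> balances the estimates. Since \<open>2 ^ K\<close> is of order
  \<open>n powr (3 / 4)\<close>, the lower part is at most \<open>exp (- n powr (1 / 4) / 4)\<close> up to logarithms, and the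
  upper part is governed by \<open>n / 4 ^ K\<close>, of order \<open>1 / sqrt n\<close>.
\<close>

lemma run_error_bigo: "run_error \<in> O(\<lambda>n. ln (real n) ^ 2 / sqrt (real n))"
proof -
  define S where "S = (\<Sum>j. (real j + 1)\<^sup>2 * (1 / 2) ^ j)"
  define R where "R = (\<Sum>k. (2 * real k + 1) * exp (- (1 / 4)) ^ k)"
  define f where "f = (\<lambda>n. 3 * (log 2 (real n))\<^sup>2 * exp (- (real n powr (1 / 4) / 4))
     + S * (124 * (log 2 (real n) + 1)\<^sup>2 * real n powr (- (3 / 4)) + 16 * (log 2 (real n) + 1) * real n powr (- (1 / 2)))
     + exp (- (real n / 4)) * R)"
  have S0: "0 \<le> S" unfolding S_def by (intro suminf_nonneg summable_square_geometric) auto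
  have bound: "run_error n \<le> f n" if n: "256 \<le> n" for n
  proof -
    define l where "l = log 2 (real n)"
    define K where "K = nat \<lfloor>3 / 4 * l\<rfloor>"
    have npow: "real n = 2 powr l" using n by (simp add: l_def)
    \<comment> \<open>This is where 256 comes from: it makes the cut at least 6, as the exponential approximation requires.\<close>
    have "8 \<le> l" using n by (simp add: l_def le_log_iff)
    then have K: "6 \<le> K" "real K \<le> 3 / 4 * l" "3 / 4 * l - 1 \<le> real K" unfolding K_def by linarith+
    then have Kl: "real K \<le> l" using \<open>8 \<le> l\<close> by linarith
    have pow: "real n powr a = 2 powr (l * a)" for a unfolding npow by (rule powr_powr)
    have upper: "2 ^ K \<le> real n powr (3 / 4)"
    proof -
      have "2 powr (real K) \<le> 2 powr (l * (3 / 4))" using K by (intro powr_mono) auto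
      then show ?thesis by (simp add: pow powr_realpow)
    qed
    have lower: "1 / 2 ^ K \<le> 2 * real n powr (- (3 / 4))"
    proof -
      have "2 powr (- real K) \<le> 2 powr (1 + l * (- (3 / 4)))" using K by (intro powr_mono) auto
      moreover have "2 powr (- real K) = 1 / 2 ^ K" by (simp add: powr_minus_divide powr_realpow)
      moreover have "2 powr (1 + l * (- (3 / 4))) = 2 * 2 powr (l * (- (3 / 4)))"
        unfolding powr_add by simp
      ultimately show ?thesis unfolding pow by (simp only:)
    qed
    have e1: "exp (- (real n / 2 ^ (K + 2))) \<le> exp (- (real n powr (1 / 4) / 4))"
    proof -
      have "real n powr (1 / 4) = real n / real n powr (3 / 4)"
        using n powr_diff[of "real n" 1 "3 / 4"] by simp
      also have "\<dots> \<le> real n / 2 ^ K" using upper n by (intro divide_left_mono) auto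
      finally show ?thesis by (simp add: power_add)
    qed
    have t1: "3 * (real K)\<^sup>2 * exp (- (real n / 2 ^ (K + 2))) \<le> 3 * l\<^sup>2 * exp (- (real n powr (1 / 4) / 4))"
      using e1 Kl by (intro mult_mono power_mono) auto
    have t2: "62 * (real K + 1)\<^sup>2 / 2 ^ K \<le> 124 * (l + 1)\<^sup>2 * real n powr (- (3 / 4))"
    proof -
      have "62 * (real K + 1)\<^sup>2 * (1 / 2 ^ K) \<le> 62 * (l + 1)\<^sup>2 * (2 * real n powr (- (3 / 4)))"
        using lower Kl by (intro mult_mono power_mono) auto
      then show ?thesis by simp
    qed
    have t3: "4 * real n * (real K + 1) / 4 ^ K \<le> 16 * (l + 1) * real n powr (- (1 / 2))"
    proof -
      have "(1 / 2 ^ K)\<^sup>2 \<le> (2 * real n powr (- (3 / 4)))\<^sup>2" using lower by (intro power_mono) auto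
      moreover have "(1 / 2 ^ K :: real)\<^sup>2 = 1 / 4 ^ K"
        by (simp add: power2_eq_square power_mult_distrib[symmetric])
      moreover have "(2 * real n powr (- (3 / 4)))\<^sup>2 = 4 * real n powr (- (3 / 2))"
        by (simp add: power2_eq_square powr_add[symmetric])
      ultimately have q: "1 / 4 ^ K \<le> 4 * real n powr (- (3 / 2))" by simp
      have "4 * real n * (real K + 1) * (1 / 4 ^ K) \<le> 4 * real n * (l + 1) * (4 * real n powr (- (3 / 2)))"
        using q Kl by (intro mult_mono) auto
      also have "\<dots> = 16 * (l + 1) * (real n powr 1 * real n powr (- (3 / 2)))" using n by simp
      also have "real n powr 1 * real n powr (- (3 / 2)) = real n powr (- (1 / 2))"
        unfolding powr_add[symmetric] by simp
      finally show ?thesis by simp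
    qed
    have "run_error n \<le> 3 * (real K)\<^sup>2 * exp (- (real n / 2 ^ (K + 2)))
       + S * (62 * (real K + 1)\<^sup>2 / 2 ^ K + 4 * real n * (real K + 1) / 4 ^ K) + exp (- (real n / 4)) * R"
      unfolding S_def R_def using K(1) n by (intro run_error_le) auto
    also have "\<dots> \<le> f n"
      unfolding f_def l_def[symmetric] using t1 t2 t3 S0 by (intro add_mono mult_left_mono) auto
    finally show ?thesis .
  qed
  have "run_error \<in> O(f)"
  proof (rule bigoI[of _ 1])
    show "\<forall>\<^sub>F n in sequentially. norm (run_error n) \<le> 1 * norm (f n)"
      using eventually_ge_at_top[of 256]
    proof eventually_elim
      case (elim n)
      then show ?case using bound[of n] run_error_nonneg[of n] by simp
    qed
  qed
  also have "f \<in> O(\<lambda>n. ln (real n) ^ 2 / sqrt (real n))"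
    unfolding f_def
  proof (intro sum_in_bigo)
    show "(\<lambda>n. 3 * (log 2 (real n))\<^sup>2 * exp (- (real n powr (1 / 4) / 4))) \<in> O(\<lambda>n. ln (real n) ^ 2 / sqrt (real n))"
      by real_asymp
    have "(\<lambda>n. 124 * (log 2 (real n) + 1)\<^sup>2 * real n powr (- (3 / 4)) + 16 * (log 2 (real n) + 1) * real n powr (- (1 / 2)))
        \<in> O(\<lambda>n. ln (real n) ^ 2 / sqrt (real n))"
      by real_asymp
    then show "(\<lambda>n. S * (124 * (log 2 (real n) + 1)\<^sup>2 * real n powr (- (3 / 4)) + 16 * (log 2 (real n) + 1) * real n powr (- (1 / 2))))
        \<in> O(\<lambda>n. ln (real n) ^ 2 / sqrt (real n))" by simp
    have "(\<lambda>n. exp (- (real n / 4))) \<in> O(\<lambda>n. ln (real n) ^ 2 / sqrt (real n))"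
      by real_asymp
    then show "(\<lambda>n. exp (- (real n / 4)) * R) \<in> O(\<lambda>n. ln (real n) ^ 2 / sqrt (real n))"
      by simp
  qed
  finally show ?thesis .
qed

theorem theorem3:
  "\<exists>\<epsilon> :: nat \<Rightarrow> real.
     (\<forall>n. \<bar>\<epsilon> n\<bar> < 1 / 10 ^ 4) \<and>
     (\<lambda>n. measure_pmf.variance (random_composition n) (\<lambda>xs. real (longest_run xs))
            - (1 / 12 + pi ^ 2 / (6 * ln 2 ^ 2) + \<epsilon> n))
       \<in> O(\<lambda>n. ln (real n) ^ 4 / sqrt (real n))"
proof -
  define x where "x = (\<lambda>n::nat. log 2 (real n) - 2)"
  define \<epsilon> where "\<epsilon> = (\<lambda>n. saw_moment 2 (x n) - (saw_moment 1 (x n))\<^sup>2 - (1 / 12 + pi\<^sup>2 / (6 * (ln 2)\<^sup>2)))"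
  let ?V = "\<lambda>n. measure_pmf.variance (random_composition n) (\<lambda>xs. real (longest_run xs))"
  let ?e = run_error
  have small: "\<bar>\<epsilon> n\<bar> < 1 / 10 ^ 4" for n
    unfolding \<epsilon>_def by (rule saw_variance_fluctuation)
  have "(\<lambda>n. ?V n - (1 / 12 + pi ^ 2 / (6 * ln 2 ^ 2) + \<epsilon> n))
      \<in> O(\<lambda>n. ?e n + ?e n * (2 * (\<bar>x n\<bar> + 1) + ?e n))"
  proof (rule bigoI[of _ 1])
    show "\<forall>\<^sub>F n in sequentially. norm (?V n - (1 / 12 + pi ^ 2 / (6 * ln 2 ^ 2) + \<epsilon> n))
        \<le> 1 * norm (?e n + ?e n * (2 * (\<bar>x n\<bar> + 1) + ?e n))"
      using eventually_gt_at_top[of 0]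
    proof eventually_elim
      case (elim n)
      have "\<bar>?V n - (saw_moment 2 (x n) - (saw_moment 1 (x n))\<^sup>2)\<bar> \<le> ?e n + ?e n * (2 * (\<bar>x n\<bar> + 1) + ?e n)"
        unfolding x_def using elim by (rule variance_longest_run_approx)
      then show ?case by (simp add: \<epsilon>_def)
    qed
  qed
  also have "(\<lambda>n. ?e n + ?e n * (2 * (\<bar>x n\<bar> + 1) + ?e n)) \<in> O(\<lambda>n. ln (real n) ^ 4 / sqrt (real n))"
  proof (rule sum_in_bigo)
    show "?e \<in> O(\<lambda>n. ln (real n) ^ 4 / sqrt (real n))"
      by (rule landau_o.big_trans[OF run_error_bigo]) real_asymp
    have "(\<lambda>n. 2 * (\<bar>x n\<bar> + 1)) \<in> O(\<lambda>n. ln (real n))"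
      unfolding x_def by real_asymp
    moreover have "?e \<in> O(\<lambda>n. ln (real n))"
      by (rule landau_o.big_trans[OF run_error_bigo]) real_asymp
    ultimately have "(\<lambda>n. 2 * (\<bar>x n\<bar> + 1) + ?e n) \<in> O(\<lambda>n. ln (real n))"
      by (rule sum_in_bigo)
    from landau_o.big.mult[OF run_error_bigo this]
    have "(\<lambda>n. ?e n * (2 * (\<bar>x n\<bar> + 1) + ?e n)) \<in> O(\<lambda>n. ln (real n) ^ 2 / sqrt (real n) * ln (real n))" .
    also have "(\<lambda>n. ln (real n) ^ 2 / sqrt (real n) * ln (real n)) \<in> O(\<lambda>n. ln (real n) ^ 4 / sqrt (real n))"
      by real_asymp
    finally show "(\<lambda>n. ?e n * (2 * (\<bar>x n\<bar> + 1) + ?e n)) \<in> O(\<lambda>n. ln (real n) ^ 4 / sqrt (real n))" .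
  qed
  finally show ?thesis using small by blast
qed


end
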